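(* Let $e\ge3$, let $\mathcal O$ be a commutative ring with identity, let $d>k\ge0$ be integers, $\lambda=(d-k,1^k)$ and $\alpha=\operatorname{cont}(\lambda)$. Let $\sigma\in\operatorname{Sh}^\lambda$ and write $\mathbf i_\sigma=\sigma\cdot\mathbf i^\lambda=(i_1,\dots,i_d)$. Then the generators of $R_\alpha$ act on the basis element $[\sigma]$ of $S^\lambda$ as follows. (i) For $\mathbf j\in\langle I\rangle_\alpha$, $e(\mathbf j)[\sigma]=\delta_{\mathbf i_\sigma,\mathbf j}[\sigma]$. (ii) For $1\le r\le d$, $$y_r[\sigma]=\begin{cases}-[s_r\sigma],&\text{if } i_r=i_{r+1},\ r\in\operatorname{Leg}(\sigma),\ r+1\in\operatorname{Arm}(\sigma);\\ [s_{r-1}\sigma],&\text{if } i_{r-1}=i_r,\ r-1\in\operatorname{Leg}(\sigma),\ r\in\operatorname{Arm}(\sigma);\\ 0,&\text{otherwise.}\end{cases}$$ (iii) $\psi_1[\sigma]=0$, and for $2\le r\le d-1$, $$\psi_r[\sigma]=\begin{cases}[s_r\sigma],&\text{if } r\in\operatorname{Arm}(\sigma)\text{ and }r+1\in\operatorname{Leg}(\sigma),\text{ or if } i_{r+1}\notin\{i_r,i_r+1,i_r-1\};\\ [s_{r+1}s_r\sigma],&\text{if } r\in\operatorname{Leg}(\sigma),\ r+1,r+2\in\operatorname{Arm}(\sigma),\ i_r\to i_{r+1};\\ -[s_{r-1}s_r\sigma],&\text{if } r-1,r\in\operatorname{Leg}(\sigma),\ r+1\in\operatorname{Arm}(\sigma),\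 i_r\leftarrow i_{r+1};\\ [s_rs_{r-1}\sigma],&\text{if } r-1\in\operatorname{Leg}(\sigma),\ r,r+1\in\operatorname{Arm}(\sigma),\ i_r=i_{r-1};\\ -[s_rs_{r+1}\sigma],&\text{if } r,r+1\in\operatorname{Leg}(\sigma),\ r+2\in\operatorname{Arm}(\sigma),\ i_{r+1}=i_{r+2};\\ 0,&\text{otherwise.}\end{cases}$$
   Context: **Hook notation.** $\operatorname{Sh}^\lambda=\{\sigma\in\mathfrak S_d\mid \sigma(1)=1,\ \sigma(2)<\dots<\sigma(d-k),\ \sigma(d-k+1)<\dots<\sigma(d)\}$, equivalently those $\sigma$ for which $\sigma T^\lambda$ is standard. For $\sigma\in\operatorname{Sh}^\lambda$ put $[\sigma]=\psi_\sigma z^\lambda\in S^\lambda$ (independent of the reduced decomposition of $\sigma$, as $\sigma$ is fully commutative). The $[\sigma]$, $\sigma\in\operatorname{Sh}^\lambda$, form an $\mathcal O$-basis of $S^\lambda$. $\operatorname{Arm}(\sigma)=\{\sigma(2),\dots,\sigma(d-k)\}$ and $\operatorname{Leg}(\sigma)=\{\sigma(d-k+1),\dots,\sigma(d)\}$. **KLR algebras.** Let $I=\mathbb Z/e\mathbb Z$. For $i,j\in I$ write $i\to j$ (or $j\leftarrow i$) if $j=i-1$. Put $a_{i,i}=2$, $a_{i,j}=-1$ if $j=i\pm1$, and $a_{i,j}=0$ otherwise. Let $Q_+=\bigoplus_{i\in I}\mathbb Z_{\ge0}\alpha_i$; the height of $\alpha\in Q_+$ is the sum of its coefficients. $\mathfrak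 S_d$ acts on $I^d$ by $(w\cdot\mathbf i)_{w(r)}=i_r$; $s_r=(r,r+1)$. For $\alpha$ of height $d$ let $\langle I\rangle_\alpha=\{\mathbf i\in I^d\mid \alpha_{i_1}+\dots+\alpha_{i_d}=\alpha\}$. $R_\alpha=R_\alpha(\mathcal O)$ is the unital $\mathcal O$-algebra generated by $e(\mathbf i)$ ($\mathbf i\in\langle I\rangle_\alpha$), $y_1,\dots,y_d$, $\psi_1,\dots,\psi_{d-1}$ with relations: $e(\mathbf i)e(\mathbf j)=\delta_{\mathbf i,\mathbf j}e(\mathbf i)$; $\sum_{\mathbf i}e(\mathbf i)=1$; $y_re(\mathbf i)=e(\mathbf i)y_r$; $\psi_re(\mathbf i)=e(s_r\mathbf i)\psi_r$; $y_ry_s=y_sy_r$; $\psi_ry_s=y_s\psi_r$ if $s\ne r,r+1$; $\psi_r\psi_s=\psi_s\psi_r$ if $|r-s|>1$; $\psi_ry_{r+1}e(\mathbf i)=(y_r\psi_r+\delta_{i_r,i_{r+1}})e(\mathbf i)$; $y_{r+1}\psi_re(\mathbf i)=(\psi_ry_r+\delta_{i_r,i_{r+1}})e(\mathbf i)$; $\psi_r^2e(\mathbf i)$ equals $0$ if $i_r=i_{r+1}$, $(y_{r+1}-y_r)e(\mathbf i)$ if $i_r\to i_{r+1}$, $(y_r-y_{r+1})e(\mathbf i)$ if $i_r\leftarrow i_{r+1}$, and $e(\mathbf i)$ otherwise; $\psi_r\psi_{r+1}\psi_re(\mathbf i)$ equals $(\psi_{r+1}\psi_r\psi_{r+1}+1)e(\mathbf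 i)$ if $i_{r+2}=i_r\to i_{r+1}$, $(\psi_{r+1}\psi_r\psi_{r+1}-1)e(\mathbf i)$ if $i_{r+2}=i_r\leftarrow i_{r+1}$, and $\psi_{r+1}\psi_r\psi_{r+1}e(\mathbf i)$ otherwise. Grading: $\deg e(\mathbf i)=0$, $\deg y_r=2$, $\deg\psi_re(\mathbf i)=-a_{i_r,i_{r+1}}$. For each $w\in\mathfrak S_d$ fix a reduced decomposition $w=s_{r_1}\cdots s_{r_l}$ and set $\psi_w=\psi_{r_1}\cdots\psi_{r_l}$. **Partitions and tableaux.** Partitions are identified with Young diagrams $\{(x,y)\mid 1\le y\le\mu_x\}$. The residue of the node $(x,y)$ is $y-x\bmod e$, and $\operatorname{cont}(\mu)=\sum_{A\in\mu}\alpha_{\operatorname{res}A}$. A $\mu$-tableau $T$ is a bijective filling of the nodes of $\mu$ by $1,\dots,d$; its residue sequence is $\mathbf i(T)=(i_1,\dots,i_d)$, $i_r$ being the residue of the node containing $r$; it is standard if entries increase along rows and down columns. $T^\mu$ is the tableau with $1,\dots,d$ in order along successive rows from top to bottom; $\mathbf i^\mu=\mathbf i(T^\mu)$; $\mathfrak S_d$ acts on entries and $w^T$ is defined by $w^TT^\mu=T$; $\psi^T=\psi_{w^T}$. **Garnir elements.** $A=(x,y)\in\mu$ is a Garnir node if $(x+1,y)\in\mu$. Its Garnir belt is $\mathbf B^A=\{(x,z)\in\mu\mid y\le z\le\mu_x\}\cup\{(x+1,z)\in\mu\mid 1\le z\le y\}$. An $A$-brick is a set of $e$ successive nodes $\{(w,z),\dots,(w,z+e-1)\}\subseteq\mathbf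 B^A$ in one row with $\operatorname{res}(w,z)=\operatorname{res}A$. Let $B^A_1,\dots,B^A_b$ be the bricks, labelled left to right along row $x$, then left to right along row $x+1$; let $b_1$ be the number of bricks in row $x$; let $C^A$ (resp. $D^A$) be the set of nodes of $\mathbf B^A$ in row $x$ (resp. $x+1$) not in any brick. $T^A$ is obtained from $T^\mu$ by placing the entries of $\mathbf B^A$ in increasing order, left to right, into $D^A,B^A_1,\dots,B^A_b,C^A$ in this order, leaving other entries unchanged; $\mathbf i^A=\mathbf i(T^A)$. If $b>0$ let $n$ be the smallest entry of $T^A$ in $B_1^A$ and $w^A_r=\prod_{z=n+re-e}^{n+re-1}(z,z+e)$ for $1\le r<b$. These are Coxeter generators of a group $\mathfrak S^A\cong\mathfrak S_b$ (trivial if $b=0$). Let $\mathscr D^A$ be the set of minimal length left coset representatives of $\mathfrak S_{b_1}\times\mathfrak S_{b-b_1}$ in $\mathfrak S^A$. Put $\tau^A_r=(\psi_{w^A_r}+1)e(\mathbf i^A)$, $\tau^A_u=\tau^A_{r_1}\cdots\tau^A_{r_l}$ for a reduced expression $u=w^A_{r_1}\cdots w^A_{r_l}\in\mathscr D^A$ (independent of the choice), and $g^A=\sum_{u\in\mathscr D^A}\tau^A_u\psi^{T^A}$. **Specht modules.** For $\alpha=\operatorname{cont}(\mu)$, $J^\mu=J_1^\mu+J_2^\mu+J_3^\mu+J_4^\mu$ with left ideals of $R_\alpha$: $J_1^\mu$ generated by all $e(\mathbf j)-\delta_{\mathbf j,\mathbf i^\mu}$; $J_2^\mu$ by $y_1,\dots,y_d$;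 $J_3^\mu$ by all $\psi_r$ with $r,r+1$ in the same row of $T^\mu$; $J_4^\mu$ by all $g^A$, $A$ a Garnir node of $\mu$. $S^\mu=R_\alpha/J^\mu$ (up to a grading shift) and $z^\mu=1+J^\mu$. *)

theory Defs
  imports
    "HOL-Library.Poly_Mapping"
    "HOL-Library.Multiset"
    "HOL-Library.FuncSet"
    "HOL-Combinatorics.Permutations"
    "HOL-Algebra.QuotRing"
    "HOL-Algebra.Module"
begin

section \<open>Free associative algebras\<close>

text \<open>
  Lists under concatenation are the free monoid. The ring structure on finitely supported
  functions needs it written additively; its convolution product then makes
  \<^typ>\<open>'x list \<Rightarrow>\<^sub>0 'a\<close> the free associative algebra on \<^typ>\<open>'x\<close>.
\<close>

instantiation list :: (type) monoid_add
begin

definition zero_list :: "'a list" where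
  "zero_list = []"

definition plus_list :: "'a list \<Rightarrow> 'a list \<Rightarrow> 'a list" where
  "plus_list u v = u @ v"

instance
  by standard (simp_all add: zero_list_def plus_list_def)

end

definition free_algebra :: "'x set \<Rightarrow> ('x list \<Rightarrow>\<^sub>0 'a::comm_ring_1) ring" where
  "free_algebra X =
     \<lparr>carrier = {f. \<forall>w\<in>Poly_Mapping.keys f. set w \<subseteq> X},
      mult = (*), one = 1, zero = 0, add = (+)\<rparr>"

definition gen :: "'x \<Rightarrow> ('x list \<Rightarrow>\<^sub>0 'a::comm_ring_1)" where
  "gen x = Poly_Mapping.single [x] 1"


section \<open>Left ideals and quotients by them\<close>

definition left_ideal :: "'r set \<Rightarrow> ('r, 'm) ring_scheme \<Rightarrow> bool" where
  "left_ideal J R \<longleftrightarrow>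
     additive_subgroup J R \<and> (\<forall>a\<in>J. \<forall>x\<in>carrier R. x \<otimes>\<^bsub>R\<^esub> a \<in> J)"

definition gen_left_ideal :: "('r, 'm) ring_scheme \<Rightarrow> 'r set \<Rightarrow> 'r set" where
  "gen_left_ideal R S = \<Inter>{J. left_ideal J R \<and> S \<subseteq> J}"

text \<open>
  The left module \<open>R/J\<close>. The record type \<^typ>\<open>('r, 'm) module\<close> extends that of rings; its
  multiplicative fields play no role for modules.
\<close>

definition quot_left_module :: "('r, 'm) ring_scheme \<Rightarrow> 'r set \<Rightarrow> ('r, 'r set) module" where
  "quot_left_module R J =
     \<lparr>carrier = a_rcosets\<^bsub>R\<^esub> J, mult = undefined, one = undefined,
      zero = J, add = set_add R,
      smult = (\<lambda>r M. \<Union>m\<in>M. J +>\<^bsub>R\<^esub> (r \<otimes>\<^bsub>R\<^esub> m))\<rparr>"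


section \<open>Words in generators of a permutation group\<close>

text \<open>Products of permutations are composed from right to left.\<close>

definition word_prod :: "(nat \<Rightarrow> nat \<Rightarrow> nat) \<Rightarrow> nat list \<Rightarrow> nat \<Rightarrow> nat" where
  "word_prod s rs = foldr (\<lambda>r f. s r \<circ> f) rs id"

definition generated_perms :: "(nat \<Rightarrow> nat \<Rightarrow> nat) \<Rightarrow> nat set \<Rightarrow> (nat \<Rightarrow> nat) set" where
  "generated_perms s N = {word_prod s rs |rs. set rs \<subseteq> N}"

definition reduced_expr ::
    "(nat \<Rightarrow> nat \<Rightarrow> nat) \<Rightarrow> nat set \<Rightarrow> (nat \<Rightarrow> nat) \<Rightarrow> nat list \<Rightarrow> bool" where
  "reduced_expr s N w rs \<longleftrightarrow> set rs \<subseteq> N \<and> word_prod s rs = w \<and>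
     (\<forall>rs'. set rs' \<subseteq> N \<and> word_prod s rs' = w \<longrightarrow> length rs \<le> length rs')"

definition expr_length :: "(nat \<Rightarrow> nat \<Rightarrow> nat) \<Rightarrow> nat set \<Rightarrow> (nat \<Rightarrow> nat) \<Rightarrow> nat" where
  "expr_length s N w = (LEAST l. \<exists>rs. set rs \<subseteq> N \<and> word_prod s rs = w \<and> length rs = l)"

definition adj :: "nat \<Rightarrow> nat \<Rightarrow> nat" where
  "adj r = transpose r (Suc r)"

definition reduced_choice :: "nat \<Rightarrow> ((nat \<Rightarrow> nat) \<Rightarrow> nat list) \<Rightarrow> bool" where
  "reduced_choice d rd \<longleftrightarrow>
     (\<forall>w. w permutes {1..d} \<longrightarrow> reduced_expr adj {1..<d} w (rd w))"


section \<open>Residue sequences\<close>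

text \<open>
  \<open>I = \<int>/e\<int>\<close> is represented by \<open>{0..<e}\<close> with arithmetic modulo \<open>e\<close>, the monoid \<open>Q\<^sub>+\<close> by the
  finite multisets over \<open>I\<close> (so that \<^const>\<open>size\<close> is the height), and \<open>I\<^sup>d\<close> by the functions on
  \<open>{1..d}\<close>, extended by \<^const>\<open>undefined\<close>.
\<close>

definition arrow :: "nat \<Rightarrow> int \<Rightarrow> int \<Rightarrow> bool" where
  "arrow e i j \<longleftrightarrow> j = (i - 1) mod int e"

definition res_seqs :: "nat \<Rightarrow> int multiset \<Rightarrow> (nat \<Rightarrow> int) set" where
  "res_seqs e \<alpha> = {i \<in> {1..size \<alpha>} \<rightarrow>\<^sub>E {0..<int e}. image_mset i (mset_set {1..size \<alpha>}) = \<alpha>}"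

definition perm_seq :: "nat \<Rightarrow> (nat \<Rightarrow> nat) \<Rightarrow> (nat \<Rightarrow> int) \<Rightarrow> nat \<Rightarrow> int" where
  "perm_seq d w i = (\<lambda>r\<in>{1..d}. i (inv_into UNIV w r))"


section \<open>KLR algebras\<close>

datatype klr_gen = Gen_e "nat \<Rightarrow> int" | Gen_y nat | Gen_psi nat

type_synonym 'a klr_free = "klr_gen list \<Rightarrow>\<^sub>0 'a"
type_synonym 'a klr_elt = "'a klr_free set"

definition klr_gens :: "nat \<Rightarrow> int multiset \<Rightarrow> klr_gen set" where
  "klr_gens e \<alpha> =
     Gen_e ` res_seqs e \<alpha> \<union> Gen_y ` {1..size \<alpha>} \<union> Gen_psi ` {1..<size \<alpha>}"

abbreviation fe :: "(nat \<Rightarrow> int) \<Rightarrow> 'a::comm_ring_1 klr_free" where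
  "fe i \<equiv> gen (Gen_e i)"

abbreviation fy :: "nat \<Rightarrow> 'a::comm_ring_1 klr_free" where
  "fy r \<equiv> gen (Gen_y r)"

abbreviation fpsi :: "nat \<Rightarrow> 'a::comm_ring_1 klr_free" where
  "fpsi r \<equiv> gen (Gen_psi r)"

inductive klr_rel ::
    "nat \<Rightarrow> int multiset \<Rightarrow> 'a::comm_ring_1 klr_free \<Rightarrow> 'a klr_free \<Rightarrow> bool"
  for e :: nat and \<alpha> :: "int multiset" where
  e_e: "i \<in> res_seqs e \<alpha> \<Longrightarrow> j \<in> res_seqs e \<alpha> \<Longrightarrow>
    klr_rel e \<alpha> (fe i * fe j) (if i = j then fe i else 0)"
| sum_e: "klr_rel e \<alpha> (\<Sum>i\<in>res_seqs e \<alpha>. fe i) 1"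
| y_e: "r \<in> {1..size \<alpha>} \<Longrightarrow> i \<in> res_seqs e \<alpha> \<Longrightarrow>
    klr_rel e \<alpha> (fy r * fe i) (fe i * fy r)"
| psi_e: "r \<in> {1..<size \<alpha>} \<Longrightarrow> i \<in> res_seqs e \<alpha> \<Longrightarrow>
    klr_rel e \<alpha> (fpsi r * fe i) (fe (perm_seq (size \<alpha>) (adj r) i) * fpsi r)"
| y_y: "r \<in> {1..size \<alpha>} \<Longrightarrow> s \<in> {1..size \<alpha>} \<Longrightarrow>
    klr_rel e \<alpha> (fy r * fy s) (fy s * fy r)"
| psi_y: "r \<in> {1..<size \<alpha>} \<Longrightarrow> s \<in> {1..size \<alpha>} \<Longrightarrow> s \<noteq> r \<Longrightarrow> s \<noteq> Suc r \<Longrightarrow>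
    klr_rel e \<alpha> (fpsi r * fy s) (fy s * fpsi r)"
| psi_psi: "r \<in> {1..<size \<alpha>} \<Longrightarrow> s \<in> {1..<size \<alpha>} \<Longrightarrow> \<bar>int r - int s\<bar> > 1 \<Longrightarrow>
    klr_rel e \<alpha> (fpsi r * fpsi s) (fpsi s * fpsi r)"
| psi_y_Suc: "r \<in> {1..<size \<alpha>} \<Longrightarrow> i \<in> res_seqs e \<alpha> \<Longrightarrow>
    klr_rel e \<alpha> (fpsi r * fy (Suc r) * fe i)
      ((fy r * fpsi r + (if i r = i (Suc r) then 1 else 0)) * fe i)"
| y_Suc_psi: "r \<in> {1..<size \<alpha>} \<Longrightarrow> i \<in> res_seqs e \<alpha> \<Longrightarrow>
    klr_rel e \<alpha> (fy (Suc r) * fpsi r * fe i)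
      ((fpsi r * fy r + (if i r = i (Suc r) then 1 else 0)) * fe i)"
| psi_square: "r \<in> {1..<size \<alpha>} \<Longrightarrow> i \<in> res_seqs e \<alpha> \<Longrightarrow>
    klr_rel e \<alpha> (fpsi r * fpsi r * fe i)
      (if i r = i (Suc r) then 0
       else if arrow e (i r) (i (Suc r)) then (fy (Suc r) - fy r) * fe i
       else if arrow e (i (Suc r)) (i r) then (fy r - fy (Suc r)) * fe i
       else fe i)"
| braid: "1 \<le> r \<Longrightarrow> r + 2 \<le> size \<alpha> \<Longrightarrow> i \<in> res_seqs e \<alpha> \<Longrightarrow>
    klr_rel e \<alpha> (fpsi r * fpsi (Suc r) * fpsi r * fe i)
      (if i (r + 2) = i r \<and> arrow e (i r) (i (Suc r))
         then (fpsi (Suc r) * fpsi r * fpsi (Suc r) + 1) * fe i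
       else if i (r + 2) = i r \<and> arrow e (i (Suc r)) (i r)
         then (fpsi (Suc r) * fpsi r * fpsi (Suc r) - 1) * fe i
       else fpsi (Suc r) * fpsi r * fpsi (Suc r) * fe i)"

definition klr_ideal :: "nat \<Rightarrow> int multiset \<Rightarrow> 'a::comm_ring_1 klr_free set" where
  "klr_ideal e \<alpha> = Idl\<^bsub>free_algebra (klr_gens e \<alpha>)\<^esub> {a - b |a b. klr_rel e \<alpha> a b}"

definition klr :: "nat \<Rightarrow> int multiset \<Rightarrow> 'a::comm_ring_1 klr_elt ring" where
  "klr e \<alpha> = free_algebra (klr_gens e \<alpha>) Quot klr_ideal e \<alpha>"

definition klr_of :: "nat \<Rightarrow> int multiset \<Rightarrow> klr_gen \<Rightarrow> 'a::comm_ring_1 klr_elt" where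
  "klr_of e \<alpha> g = klr_ideal e \<alpha> +>\<^bsub>free_algebra (klr_gens e \<alpha>)\<^esub> gen g"

definition klr_e :: "nat \<Rightarrow> int multiset \<Rightarrow> (nat \<Rightarrow> int) \<Rightarrow> 'a::comm_ring_1 klr_elt" where
  "klr_e e \<alpha> i = klr_of e \<alpha> (Gen_e i)"

definition klr_y :: "nat \<Rightarrow> int multiset \<Rightarrow> nat \<Rightarrow> 'a::comm_ring_1 klr_elt" where
  "klr_y e \<alpha> r = klr_of e \<alpha> (Gen_y r)"

definition klr_psi :: "nat \<Rightarrow> int multiset \<Rightarrow> nat \<Rightarrow> 'a::comm_ring_1 klr_elt" where
  "klr_psi e \<alpha> r = klr_of e \<alpha> (Gen_psi r)"

definition psi_perm ::
    "nat \<Rightarrow> int multiset \<Rightarrow> ((nat \<Rightarrow> nat) \<Rightarrow> nat list) \<Rightarrow> (nat \<Rightarrow> nat) \<Rightarrow> 'a::comm_ring_1 klr_elt" where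
  "psi_perm e \<alpha> rd w =
     foldr (\<lambda>r a. klr_psi e \<alpha> r \<otimes>\<^bsub>klr e \<alpha>\<^esub> a) (rd w) \<one>\<^bsub>klr e \<alpha>\<^esub>"


section \<open>Young diagrams and tableaux\<close>

text \<open>
  A partition is given by the list of its parts; nodes and entries are counted from 1. A tableau
  is a function on nodes, of which only the values on the diagram matter.
\<close>

definition young :: "nat list \<Rightarrow> (nat \<times> nat) set" where
  "young \<mu> = {(x, y). 1 \<le> x \<and> x \<le> length \<mu> \<and> 1 \<le> y \<and> y \<le> \<mu> ! (x - 1)}"

fun res :: "nat \<Rightarrow> nat \<times> nat \<Rightarrow> int" where
  "res e (x, y) = (int y - int x) mod int e"

definition cont :: "nat \<Rightarrow> nat list \<Rightarrow> int multiset" where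
  "cont e \<mu> = image_mset (res e) (mset_set (young \<mu>))"

fun init_tab :: "nat list \<Rightarrow> nat \<times> nat \<Rightarrow> nat" where
  "init_tab \<mu> (x, y) = sum_list (take (x - 1) \<mu>) + y"

definition res_seq :: "nat \<Rightarrow> nat list \<Rightarrow> (nat \<times> nat \<Rightarrow> nat) \<Rightarrow> nat \<Rightarrow> int" where
  "res_seq e \<mu> T = (\<lambda>r\<in>{1..sum_list \<mu>}. res e (inv_into (young \<mu>) T r))"

definition tab_perm :: "nat list \<Rightarrow> (nat \<times> nat \<Rightarrow> nat) \<Rightarrow> nat \<Rightarrow> nat" where
  "tab_perm \<mu> T =
     (THE w. w permutes {1..sum_list \<mu>} \<and> (\<forall>N\<in>young \<mu>. w (init_tab \<mu> N) = T N))"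


section \<open>Garnir elements\<close>

definition garnir_node :: "nat list \<Rightarrow> nat \<times> nat \<Rightarrow> bool" where
  "garnir_node \<mu> A \<longleftrightarrow> A \<in> young \<mu> \<and> (Suc (fst A), snd A) \<in> young \<mu>"

text \<open>The Garnir belt: first row \<open>x\<close>, then row \<open>x + 1\<close>, each from left to right.\<close>

fun belt :: "nat list \<Rightarrow> nat \<times> nat \<Rightarrow> (nat \<times> nat) list" where
  "belt \<mu> (x, y) = map (Pair x) [y..<Suc (\<mu> ! (x - 1))] @ map (Pair (Suc x)) [1..<Suc y]"

fun brick :: "nat \<Rightarrow> nat \<times> nat \<Rightarrow> (nat \<times> nat) list" where
  "brick e (w, z) = map (Pair w) [z..<z + e]"

definition bricks :: "nat \<Rightarrow> nat list \<Rightarrow> nat \<times> nat \<Rightarrow> (nat \<times> nat) list list" where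
  "bricks e \<mu> A = map (brick e)
     (filter (\<lambda>N. set (brick e N) \<subseteq> set (belt \<mu> A) \<and> res e N = res e A) (belt \<mu> A))"

definition bricks_upper :: "nat \<Rightarrow> nat list \<Rightarrow> nat \<times> nat \<Rightarrow> (nat \<times> nat) list list" where
  "bricks_upper e \<mu> A = filter (\<lambda>B. fst (hd B) = fst A) (bricks e \<mu> A)"

definition garnir_C :: "nat \<Rightarrow> nat list \<Rightarrow> nat \<times> nat \<Rightarrow> (nat \<times> nat) list" where
  "garnir_C e \<mu> A =
     filter (\<lambda>N. fst N = fst A \<and> N \<notin> set (concat (bricks e \<mu> A))) (belt \<mu> A)"

definition garnir_D :: "nat \<Rightarrow> nat list \<Rightarrow> nat \<times> nat \<Rightarrow> (nat \<times> nat) list" where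
  "garnir_D e \<mu> A =
     filter (\<lambda>N. fst N = Suc (fst A) \<and> N \<notin> set (concat (bricks e \<mu> A))) (belt \<mu> A)"

definition garnir_tab :: "nat \<Rightarrow> nat list \<Rightarrow> nat \<times> nat \<Rightarrow> nat \<times> nat \<Rightarrow> nat" where
  "garnir_tab e \<mu> A N =
     (case map_of (zip (garnir_D e \<mu> A @ concat (bricks e \<mu> A) @ garnir_C e \<mu> A)
                       (sorted_list_of_set (init_tab \<mu> ` set (belt \<mu> A)))) N of
        Some m \<Rightarrow> m
      | None \<Rightarrow> init_tab \<mu> N)"

definition brick_perm :: "nat \<Rightarrow> nat list \<Rightarrow> nat \<times> nat \<Rightarrow> nat \<Rightarrow> nat \<Rightarrow> nat" where
  "brick_perm e \<mu> A r =
     (let n = Min (garnir_tab e \<mu> A ` set (bricks e \<mu> A ! 0))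
      in word_prod (\<lambda>z. transpose z (z + e)) [n + r * e - e..<n + r * e])"

definition garnir_reps :: "nat \<Rightarrow> nat list \<Rightarrow> nat \<times> nat \<Rightarrow> (nat \<Rightarrow> nat) set" where
  "garnir_reps e \<mu> A =
     (let N = {1..<length (bricks e \<mu> A)}; s = brick_perm e \<mu> A;
          P = generated_perms s (N - {length (bricks_upper e \<mu> A)})
      in {u \<in> generated_perms s N. \<forall>v\<in>P. expr_length s N u \<le> expr_length s N (u \<circ> v)})"

definition garnir_tau ::
    "nat \<Rightarrow> ((nat \<Rightarrow> nat) \<Rightarrow> nat list) \<Rightarrow> nat list \<Rightarrow> nat \<times> nat \<Rightarrow> nat \<Rightarrow> 'a::comm_ring_1 klr_elt" where
  "garnir_tau e rd \<mu> A r =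
     (let \<alpha> = cont e \<mu>; R = klr e \<alpha>
      in (psi_perm e \<alpha> rd (brick_perm e \<mu> A r) \<oplus>\<^bsub>R\<^esub> \<one>\<^bsub>R\<^esub>)
           \<otimes>\<^bsub>R\<^esub> klr_e e \<alpha> (res_seq e \<mu> (garnir_tab e \<mu> A)))"

text \<open>Which reduced expression of \<open>u\<close> is taken is immaterial.\<close>

definition garnir_tau_perm ::
    "nat \<Rightarrow> ((nat \<Rightarrow> nat) \<Rightarrow> nat list) \<Rightarrow> nat list \<Rightarrow> nat \<times> nat \<Rightarrow> (nat \<Rightarrow> nat) \<Rightarrow> 'a::comm_ring_1 klr_elt" where
  "garnir_tau_perm e rd \<mu> A u =
     (let R = klr e (cont e \<mu>);
          rs = (SOME rs. reduced_expr (brick_perm e \<mu> A) {1..<length (bricks e \<mu> A)} u rs)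
      in foldr (\<lambda>r a. garnir_tau e rd \<mu> A r \<otimes>\<^bsub>R\<^esub> a) rs \<one>\<^bsub>R\<^esub>)"

definition garnir ::
    "nat \<Rightarrow> ((nat \<Rightarrow> nat) \<Rightarrow> nat list) \<Rightarrow> nat list \<Rightarrow> nat \<times> nat \<Rightarrow> 'a::comm_ring_1 klr_elt" where
  "garnir e rd \<mu> A =
     (let \<alpha> = cont e \<mu>; R = klr e \<alpha>
      in \<Oplus>\<^bsub>R\<^esub>u\<in>garnir_reps e \<mu> A. garnir_tau_perm e rd \<mu> A u \<otimes>\<^bsub>R\<^esub>
           psi_perm e \<alpha> rd (tab_perm \<mu> (garnir_tab e \<mu> A)))"


section \<open>Specht modules\<close>

definition J1 :: "nat \<Rightarrow> nat list \<Rightarrow> 'a::comm_ring_1 klr_elt set" where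
  "J1 e \<mu> =
     (let \<alpha> = cont e \<mu>; R = klr e \<alpha>
      in gen_left_ideal R
           {klr_e e \<alpha> j \<ominus>\<^bsub>R\<^esub> (if j = res_seq e \<mu> (init_tab \<mu>) then \<one>\<^bsub>R\<^esub> else \<zero>\<^bsub>R\<^esub>) |j.
              j \<in> res_seqs e \<alpha>})"

definition J2 :: "nat \<Rightarrow> nat list \<Rightarrow> 'a::comm_ring_1 klr_elt set" where
  "J2 e \<mu> =
     (let \<alpha> = cont e \<mu> in gen_left_ideal (klr e \<alpha>) {klr_y e \<alpha> r |r. r \<in> {1..sum_list \<mu>}})"

definition J3 :: "nat \<Rightarrow> nat list \<Rightarrow> 'a::comm_ring_1 klr_elt set" where
  "J3 e \<mu> =
     (let \<alpha> = cont e \<mu>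
      in gen_left_ideal (klr e \<alpha>)
           {klr_psi e \<alpha> r |r. \<exists>x y y'. (x, y) \<in> young \<mu> \<and> (x, y') \<in> young \<mu> \<and>
              init_tab \<mu> (x, y) = r \<and> init_tab \<mu> (x, y') = Suc r})"

definition J4 ::
    "nat \<Rightarrow> ((nat \<Rightarrow> nat) \<Rightarrow> nat list) \<Rightarrow> nat list \<Rightarrow> 'a::comm_ring_1 klr_elt set" where
  "J4 e rd \<mu> =
     gen_left_ideal (klr e (cont e \<mu>)) {garnir e rd \<mu> A |A. garnir_node \<mu> A}"

definition specht_ideal ::
    "nat \<Rightarrow> ((nat \<Rightarrow> nat) \<Rightarrow> nat list) \<Rightarrow> nat list \<Rightarrow> 'a::comm_ring_1 klr_elt set" where
  "specht_ideal e rd \<mu> =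
     (let R = klr e (cont e \<mu>)
      in J1 e \<mu> <+>\<^bsub>R\<^esub> J2 e \<mu> <+>\<^bsub>R\<^esub> J3 e \<mu> <+>\<^bsub>R\<^esub> J4 e rd \<mu>)"

definition specht ::
    "nat \<Rightarrow> ((nat \<Rightarrow> nat) \<Rightarrow> nat list) \<Rightarrow> nat list
     \<Rightarrow> ('a::comm_ring_1 klr_elt, 'a klr_elt set) module" where
  "specht e rd \<mu> = quot_left_module (klr e (cont e \<mu>)) (specht_ideal e rd \<mu>)"

definition specht_z ::
    "nat \<Rightarrow> ((nat \<Rightarrow> nat) \<Rightarrow> nat list) \<Rightarrow> nat list \<Rightarrow> 'a::comm_ring_1 klr_elt set" where
  "specht_z e rd \<mu> =
     (let R = klr e (cont e \<mu>) in specht_ideal e rd \<mu> +>\<^bsub>R\<^esub> \<one>\<^bsub>R\<^esub>)"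

definition specht_vec ::
    "nat \<Rightarrow> ((nat \<Rightarrow> nat) \<Rightarrow> nat list) \<Rightarrow> nat list \<Rightarrow> (nat \<Rightarrow> nat) \<Rightarrow> 'a::comm_ring_1 klr_elt set" where
  "specht_vec e rd \<mu> w = psi_perm e (cont e \<mu>) rd w \<odot>\<^bsub>specht e rd \<mu>\<^esub> specht_z e rd \<mu>"


section \<open>Hooks\<close>

definition hook :: "nat \<Rightarrow> nat \<Rightarrow> nat list" where
  "hook d k = (d - k) # replicate k 1"

definition Sh :: "nat \<Rightarrow> nat \<Rightarrow> (nat \<Rightarrow> nat) set" where
  "Sh d k = {\<sigma>. \<sigma> permutes {1..d} \<and> \<sigma> 1 = 1 \<and>
     strict_mono_on {2..d - k} \<sigma> \<and> strict_mono_on {d - k + 1..d} \<sigma>}"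

definition Arm :: "nat \<Rightarrow> nat \<Rightarrow> (nat \<Rightarrow> nat) \<Rightarrow> nat set" where
  "Arm d k \<sigma> = \<sigma> ` {2..d - k}"

definition Leg :: "nat \<Rightarrow> nat \<Rightarrow> (nat \<Rightarrow> nat) \<Rightarrow> nat set" where
  "Leg d k \<sigma> = \<sigma> ` {d - k + 1..d}"

end

theory Submission
  imports Defs
begin

text \<open>
  The formulas are proved for all shuffles at once by induction on the number of inversions. If
  \<open>\<sigma> \<noteq> id\<close> there is a descent \<open>t\<close>, with \<open>t\<close> in the leg and \<open>t + 1\<close> in the arm, and \<open>[\<sigma>] = \<psi>\<^sub>t[\<tau>]\<close> for the
  shorter shuffle \<open>\<tau> = s\<^sub>t\<sigma>\<close>. A generator far from \<open>t\<close> is commuted past \<open>\<psi>\<^sub>t\<close>; \<open>y\<^sub>t\<close> and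
  \<open>y\<^sub>t\<^sub>+\<^sub>1\<close> are moved past it by the KLR relations; \<open>\<psi>\<^sub>t\<close> itself meets \<open>\<psi>\<^sub>t\<^sup>2\<close>, which is a
  polynomial in the \<open>y\<close>'s acting on \<open>[\<tau>]\<close>; and when \<open>\<psi>\<^sub>r\<close> hits two consecutive arm (or leg) entries
  next to the descent, the braid relation applies to a vector two steps shorter. All superfluous
  terms vanish because residues along the arm increase and along the leg decrease by one and
  \<open>e \<ge> 3\<close>. For a hook every Garnir element is a single \<open>\<psi>\<^sub>w\<close>: the bricks of the first
  belt all lie in the upper row, and the other belts have none. Linear independence of the
  \<open>[\<sigma>]\<close> plays no role.
\<close>

section \<open>Free algebras and quotients by left ideals\<close>

text \<open>The y- and psi-formulas have to pass through one common induction. If y_{t+1}[\<tau>] is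
  itself, up to sign, a vector [\<rho>], then psi_t must kill it by the arm-arm formula for
  [\<rho>]; and the braid argument for an arm-arm pair may need the leg-leg formula on a shorter
  shuffle, and vice versa. The leg-arm values of psi_t stay outside the induction hypothesis and are
  read off afterwards from psi_t^2. The generator psi_1 needs an argument of its own. It commutes
  with psi_t for every descent t > 2; if 2 is the sole descent, then [\<sigma>] = psi_2 ...
  psi_{d-k} z, and psi_1 kills it by the Garnir relation of the corner node. The induction runs in
  an abstract abelian group with operators, away from cosets and ideals. Two facts on reduced words
  link it to the Specht module. Words of a shuffle differ by commutations only, so psi_t[\<sigma>] =
  [s_t \<sigma>] for an arm-leg pair whatever words \<open>rd\<close> picks. The cycles arising from
  Garnir tableaux have a single reduced word, so each Garnir relation concerns a known
  product.\<close>

lemma free_algebra_ring: "ring (free_algebra X :: ('x list \<Rightarrow>\<^sub>0 'a::comm_ring_1) ring)"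
proof -
  let ?F = "free_algebra X :: ('x list \<Rightarrow>\<^sub>0 'a) ring"
  have mult: "f * g \<in> carrier ?F" if "f \<in> carrier ?F" "g \<in> carrier ?F" for f g
  proof -
    \<comment> \<open>Words in the support of a product are concatenations of words from the two
      supports.\<close>
    have "set w \<subseteq> X" if w: "w \<in> Poly_Mapping.keys (f * g)" for w
    proof -
      obtain u v where "w = u + v" "u \<in> Poly_Mapping.keys f" "v \<in> Poly_Mapping.keys g"
        using keys_mult[of f g] w by blast
      then show ?thesis
        using \<open>f \<in> carrier ?F\<close> \<open>g \<in> carrier ?F\<close> by (auto simp: free_algebra_def plus_list_def)
    qed
    then show ?thesis by (simp add: free_algebra_def)
  qed
  have add: "f + g \<in> carrier ?F" if "f \<in> carrier ?F" "g \<in> carrier ?F" for f g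
    using that Poly_Mapping.keys_add[of f g] by (auto simp: free_algebra_def)
  have one: "1 \<in> carrier ?F"
    by (auto simp: free_algebra_def zero_list_def)
  have neg: "- f \<in> carrier ?F" if "f \<in> carrier ?F" for f
    using that by (simp add: free_algebra_def)
  show ?thesis
  proof (rule ringI)
    show "abelian_group ?F"
    proof (rule abelian_groupI)
      fix x assume x: "x \<in> carrier ?F"
      have "- x \<oplus>\<^bsub>?F\<^esub> x = \<zero>\<^bsub>?F\<^esub>"
        by (simp add: free_algebra_def)
      with neg[OF x] show "\<exists>y\<in>carrier ?F. y \<oplus>\<^bsub>?F\<^esub> x = \<zero>\<^bsub>?F\<^esub>"
        by blast
    next
      fix x y assume "x \<in> carrier ?F" "y \<in> carrier ?F"
      from add[OF this] show "x \<oplus>\<^bsub>?F\<^esub> y \<in> carrier ?F"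
        by (simp add: free_algebra_def)
    qed (simp_all add: free_algebra_def add_ac)
    show "monoid ?F"
    proof (rule monoidI)
      fix x y assume "x \<in> carrier ?F" "y \<in> carrier ?F"
      from mult[OF this] show "x \<otimes>\<^bsub>?F\<^esub> y \<in> carrier ?F"
        by (simp add: free_algebra_def)
    next
      show "\<one>\<^bsub>?F\<^esub> \<in> carrier ?F"
        using one by (simp add: free_algebra_def)
    qed (simp_all add: free_algebra_def mult.assoc)
  qed (simp_all add: free_algebra_def algebra_simps)
qed

lemma free_algebra_simps [simp]:
  "f \<otimes>\<^bsub>free_algebra X\<^esub> g = f * g"
  "f \<oplus>\<^bsub>free_algebra X\<^esub> g = f + g"
  "\<one>\<^bsub>free_algebra X\<^esub> = 1"
  "\<zero>\<^bsub>free_algebra X\<^esub> = 0"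
  by (simp_all add: free_algebra_def)

text \<open>The record's \<open>\<ominus>\<close> is defined as an inverse in its additive monoid,
  so its agreement with the type class \<open>-\<close> has to be shown.\<close>

lemma free_algebra_uminus:
  assumes "f \<in> carrier (free_algebra X)"
  shows "\<ominus>\<^bsub>free_algebra X\<^esub> f = - f"
proof -
  interpret ring "free_algebra X" by (rule free_algebra_ring)
  have "- f \<in> carrier (free_algebra X)"
    using assms by (simp add: free_algebra_def)
  then show ?thesis
    by (intro minus_equality) (simp_all add: assms)
qed

lemma free_algebra_minus:
  assumes "f \<in> carrier (free_algebra X)" "g \<in> carrier (free_algebra X)"
  shows "f \<ominus>\<^bsub>free_algebra X\<^esub> g = f - g"
  using assms by (simp add: a_minus_def free_algebra_uminus)

lemma gen_closed: "x \<in> X \<Longrightarrow> gen x \<in> carrier (free_algebra X)"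
  by (simp add: gen_def free_algebra_def)


text \<open>R_\<alpha> need not be commutative, so the scalars form a plain ring; the axioms are
  those of a unital left module.\<close>

locale left_module = R?: ring R + M?: abelian_group M
  for R :: "('r, 'm) ring_scheme" and M :: "('r, 'b, 'n) module_scheme" +
  assumes smult_closed: "\<lbrakk>a \<in> carrier R; x \<in> carrier M\<rbrakk> \<Longrightarrow> a \<odot>\<^bsub>M\<^esub> x \<in> carrier M"
    and smult_l_distr: "\<lbrakk>a \<in> carrier R; b \<in> carrier R; x \<in> carrier M\<rbrakk>
      \<Longrightarrow> (a \<oplus>\<^bsub>R\<^esub> b) \<odot>\<^bsub>M\<^esub> x = a \<odot>\<^bsub>M\<^esub> x \<oplus>\<^bsub>M\<^esub> b \<odot>\<^bsub>M\<^esub> x"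
    and smult_r_distr: "\<lbrakk>a \<in> carrier R; x \<in> carrier M; y \<in> carrier M\<rbrakk>
      \<Longrightarrow> a \<odot>\<^bsub>M\<^esub> (x \<oplus>\<^bsub>M\<^esub> y) = a \<odot>\<^bsub>M\<^esub> x \<oplus>\<^bsub>M\<^esub> a \<odot>\<^bsub>M\<^esub> y"
    and smult_assoc: "\<lbrakk>a \<in> carrier R; b \<in> carrier R; x \<in> carrier M\<rbrakk>
      \<Longrightarrow> (a \<otimes>\<^bsub>R\<^esub> b) \<odot>\<^bsub>M\<^esub> x = a \<odot>\<^bsub>M\<^esub> (b \<odot>\<^bsub>M\<^esub> x)"
    and smult_one: "x \<in> carrier M \<Longrightarrow> \<one>\<^bsub>R\<^esub> \<odot>\<^bsub>M\<^esub> x = x"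
begin

lemma smult_r_null: "a \<in> carrier R \<Longrightarrow> a \<odot>\<^bsub>M\<^esub> \<zero>\<^bsub>M\<^esub> = \<zero>\<^bsub>M\<^esub>"
  using smult_r_distr[of a "\<zero>\<^bsub>M\<^esub>" "\<zero>\<^bsub>M\<^esub>"] smult_closed[of a "\<zero>\<^bsub>M\<^esub>"]
  by simp

lemma smult_l_null: "x \<in> carrier M \<Longrightarrow> \<zero>\<^bsub>R\<^esub> \<odot>\<^bsub>M\<^esub> x = \<zero>\<^bsub>M\<^esub>"
  using smult_l_distr[of "\<zero>\<^bsub>R\<^esub>" "\<zero>\<^bsub>R\<^esub>" x] smult_closed[of "\<zero>\<^bsub>R\<^esub>" x]
  by simp

lemma smult_r_minus:
  assumes "a \<in> carrier R" "x \<in> carrier M"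
  shows "a \<odot>\<^bsub>M\<^esub> (\<ominus>\<^bsub>M\<^esub> x) = \<ominus>\<^bsub>M\<^esub> (a \<odot>\<^bsub>M\<^esub> x)"
  using assms smult_r_distr[of a "\<ominus>\<^bsub>M\<^esub> x" x]
  by (intro M.minus_equality[symmetric]) (simp_all add: smult_closed smult_r_null M.l_neg)

lemma smult_l_minus:
  assumes "a \<in> carrier R" "x \<in> carrier M"
  shows "(\<ominus>\<^bsub>R\<^esub> a) \<odot>\<^bsub>M\<^esub> x = \<ominus>\<^bsub>M\<^esub> (a \<odot>\<^bsub>M\<^esub> x)"
  using assms smult_l_distr[of "\<ominus>\<^bsub>R\<^esub> a" a x]
  by (intro M.minus_equality[symmetric]) (simp_all add: smult_closed smult_l_null R.l_neg)

end

section \<open>Cosets of a left ideal as a left module\<close>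

context
  fixes R :: "('r, 'm) ring_scheme" and J :: "'r set"
  assumes R: "ring R" and J: "left_ideal J R"
begin

interpretation R: ring R by (rule R)

interpretation abelian_subgroup J R
proof -
  from J have "additive_subgroup J R" by (simp add: left_ideal_def)
  then show "abelian_subgroup J R"
    by (rule abelian_subgroupI3) (rule R.is_abelian_group)
qed

lemma left_ideal_mult: "\<lbrakk>a \<in> J; x \<in> carrier R\<rbrakk> \<Longrightarrow> x \<otimes>\<^bsub>R\<^esub> a \<in> J"
  using J by (simp add: left_ideal_def)

text \<open>The scalar action is defined as a union over all representatives. Since \<open>J\<close>
  absorbs multiplication from the left, the cosets in this union coincide.\<close>

lemma left_coset_smult:
  assumes r: "r \<in> carrier R" and m: "m \<in> carrier R"
  shows "r \<odot>\<^bsub>quot_left_module R J\<^esub> (J +>\<^bsub>R\<^esub> m) = J +>\<^bsub>R\<^esub> (r \<otimes>\<^bsub>R\<^esub> m)"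
proof -
  have "J +>\<^bsub>R\<^esub> (r \<otimes>\<^bsub>R\<^esub> x) = J +>\<^bsub>R\<^esub> (r \<otimes>\<^bsub>R\<^esub> m)" if x: "x \<in> J +>\<^bsub>R\<^esub> m" for x
  proof -
    obtain j where j: "j \<in> J" "x = j \<oplus>\<^bsub>R\<^esub> m"
      using x by (auto simp: a_r_coset_def')
    then have "r \<otimes>\<^bsub>R\<^esub> x = r \<otimes>\<^bsub>R\<^esub> j \<oplus>\<^bsub>R\<^esub> r \<otimes>\<^bsub>R\<^esub> m"
      using r m by (simp add: R.r_distr)
    then have "r \<otimes>\<^bsub>R\<^esub> x \<in> J +>\<^bsub>R\<^esub> (r \<otimes>\<^bsub>R\<^esub> m)"
      using left_ideal_mult[OF j(1) r] by (auto simp: a_r_coset_def')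
    then show ?thesis
      using a_repr_independence'[of "r \<otimes>\<^bsub>R\<^esub> x" "r \<otimes>\<^bsub>R\<^esub> m"] r m by simp
  qed
  moreover have "m \<in> J +>\<^bsub>R\<^esub> m"
    using a_rcos_self m by blast
  ultimately have "(\<Union>x\<in>J +>\<^bsub>R\<^esub> m. J +>\<^bsub>R\<^esub> (r \<otimes>\<^bsub>R\<^esub> x)) = J +>\<^bsub>R\<^esub> (r \<otimes>\<^bsub>R\<^esub> m)"
    by blast
  then show ?thesis
    by (simp add: quot_left_module_def)
qed

lemma left_coset_add:
  assumes "x \<in> carrier R" "y \<in> carrier R"
  shows "(J +>\<^bsub>R\<^esub> x) \<oplus>\<^bsub>quot_left_module R J\<^esub> (J +>\<^bsub>R\<^esub> y) = J +>\<^bsub>R\<^esub> (x \<oplus>\<^bsub>R\<^esub> y)"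
  using a_rcos_sum[OF assms] by (simp add: quot_left_module_def)

lemma left_coset_closed:
  "x \<in> carrier R \<Longrightarrow> J +>\<^bsub>R\<^esub> x \<in> carrier (quot_left_module R J)"
  by (auto simp: quot_left_module_def A_RCOSETS_def')

lemma left_coset_cases:
  assumes "M \<in> carrier (quot_left_module R J)"
  obtains x where "x \<in> carrier R" "M = J +>\<^bsub>R\<^esub> x"
  using assms by (auto simp: quot_left_module_def A_RCOSETS_def')

lemma left_coset_zero: "J +>\<^bsub>R\<^esub> \<zero>\<^bsub>R\<^esub> = \<zero>\<^bsub>quot_left_module R J\<^esub>"
  using a_rcos_const[OF zero_closed] by (simp add: quot_left_module_def)

lemma left_coset_eq_zero: "x \<in> J \<Longrightarrow> J +>\<^bsub>R\<^esub> x = \<zero>\<^bsub>quot_left_module R J\<^esub>"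
  by (simp add: quot_left_module_def a_rcos_const)

lemma left_module_quot: "left_module R (quot_left_module R J)"
proof -
  let ?M = "quot_left_module R J"
  note coset = left_coset_smult left_coset_add left_coset_closed
  have "abelian_group ?M"
  proof (rule abelian_groupI)
    show "\<zero>\<^bsub>?M\<^esub> \<in> carrier ?M"
      using left_coset_closed[OF R.zero_closed] by (simp only: left_coset_zero)
  next
    fix x assume "x \<in> carrier ?M"
    then obtain a where "a \<in> carrier R" "x = J +>\<^bsub>R\<^esub> a" by (rule left_coset_cases)
    note a = this
    show "\<zero>\<^bsub>?M\<^esub> \<oplus>\<^bsub>?M\<^esub> x = x"
      using left_coset_add[OF R.zero_closed a(1)] a by (simp add: left_coset_zero)
    have "(J +>\<^bsub>R\<^esub> (\<ominus>\<^bsub>R\<^esub> a)) \<oplus>\<^bsub>?M\<^esub> x = \<zero>\<^bsub>?M\<^esub>"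
      using a by (simp add: coset R.l_neg left_coset_zero)
    then show "\<exists>y\<in>carrier ?M. y \<oplus>\<^bsub>?M\<^esub> x = \<zero>\<^bsub>?M\<^esub>"
      using left_coset_closed a(1) by blast
  next
    fix x y assume "x \<in> carrier ?M" and "y \<in> carrier ?M"
    then obtain m n where m: "m \<in> carrier R" "x = J +>\<^bsub>R\<^esub> m" "n \<in> carrier R" "y = J +>\<^bsub>R\<^esub> n"
      by (auto elim!: left_coset_cases)
    show "x \<oplus>\<^bsub>?M\<^esub> y \<in> carrier ?M"
      by (simp add: m coset)
    show "x \<oplus>\<^bsub>?M\<^esub> y = y \<oplus>\<^bsub>?M\<^esub> x"
      by (simp add: m coset R.a_comm)
    fix z assume "z \<in> carrier ?M"
    then obtain l where l: "l \<in> carrier R" "z = J +>\<^bsub>R\<^esub> l" by (rule left_coset_cases)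
    show "x \<oplus>\<^bsub>?M\<^esub> y \<oplus>\<^bsub>?M\<^esub> z = x \<oplus>\<^bsub>?M\<^esub> (y \<oplus>\<^bsub>?M\<^esub> z)"
      by (simp add: m l coset R.a_assoc)
  qed
  then interpret M: abelian_group ?M .
  show ?thesis
  proof unfold_locales
    fix a x assume a: "a \<in> carrier R" and "x \<in> carrier ?M"
    then obtain m where m: "m \<in> carrier R" "x = J +>\<^bsub>R\<^esub> m" by (auto elim: left_coset_cases)
    show "a \<odot>\<^bsub>?M\<^esub> x \<in> carrier ?M"
      by (simp add: a m coset)
    fix b assume b: "b \<in> carrier R"
    show "(a \<oplus>\<^bsub>R\<^esub> b) \<odot>\<^bsub>?M\<^esub> x = a \<odot>\<^bsub>?M\<^esub> x \<oplus>\<^bsub>?M\<^esub> b \<odot>\<^bsub>?M\<^esub> x"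
      by (simp add: a b m coset R.l_distr)
    show "(a \<otimes>\<^bsub>R\<^esub> b) \<odot>\<^bsub>?M\<^esub> x = a \<odot>\<^bsub>?M\<^esub> (b \<odot>\<^bsub>?M\<^esub> x)"
      by (simp add: a b m coset R.m_assoc)
  next
    fix a x y assume a: "a \<in> carrier R" and "x \<in> carrier ?M" and "y \<in> carrier ?M"
    then obtain m n where m: "m \<in> carrier R" "x = J +>\<^bsub>R\<^esub> m" "n \<in> carrier R" "y = J +>\<^bsub>R\<^esub> n"
      by (auto elim!: left_coset_cases)
    show "a \<odot>\<^bsub>?M\<^esub> (x \<oplus>\<^bsub>?M\<^esub> y) = a \<odot>\<^bsub>?M\<^esub> x \<oplus>\<^bsub>?M\<^esub> a \<odot>\<^bsub>?M\<^esub> y"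
      by (simp add: a m coset R.r_distr)
  next
    fix x assume "x \<in> carrier ?M"
    then obtain m where m: "m \<in> carrier R" "x = J +>\<^bsub>R\<^esub> m" by (auto elim: left_coset_cases)
    show "\<one>\<^bsub>R\<^esub> \<odot>\<^bsub>?M\<^esub> x = x"
      by (simp add: m coset)
  qed
qed

end

section \<open>Reduced words of permutations\<close>

abbreviation pinv :: "(nat \<Rightarrow> nat) \<Rightarrow> nat \<Rightarrow> nat" where
  "pinv \<equiv> inv_into UNIV"

lemma adj_simps [simp]:
  "adj r r = Suc r" "adj r (Suc r) = r" "s \<noteq> r \<Longrightarrow> s \<noteq> Suc r \<Longrightarrow> adj r s = s"
  by (auto simp: adj_def transpose_def)

lemma adj_involutory [simp]: "adj r (adj r s) = s"
  by (simp add: adj_def)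

lemma adj_comp_adj [simp]: "adj r \<circ> adj r = id" "adj r \<circ> (adj r \<circ> f) = f"
  by (simp_all add: fun_eq_iff)

lemma image_adj_comp: "r \<in> (adj t \<circ> \<sigma>) ` X \<longleftrightarrow> adj t r \<in> \<sigma> ` X"
proof -
  have "r = adj t (\<sigma> x) \<longleftrightarrow> adj t r = \<sigma> x" for x
    by (metis adj_involutory)
  then show ?thesis by (simp add: image_iff)
qed

lemma adj_comm:
  assumes "s \<noteq> r" "s \<noteq> Suc r" "r \<noteq> Suc s"
  shows "adj r \<circ> adj s = adj s \<circ> adj r"
proof
  fix x show "(adj r \<circ> adj s) x = (adj s \<circ> adj r) x"
    using assms by (cases "x \<in> {r, Suc r, s, Suc s}") auto
qed

lemma adj_permutes: "1 \<le> r \<Longrightarrow> r < d \<Longrightarrow> adj r permutes {1..d}"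
  by (auto simp: adj_def intro: permutes_swap_id)

lemma inv_adj [simp]: "pinv (adj r) = adj r"
  by (simp add: adj_def)

lemma bij_adj [simp]: "bij (adj r)"
  by (simp add: adj_def)

lemma inv_adj_comp: "w permutes X \<Longrightarrow> pinv (adj r \<circ> w) = pinv w \<circ> adj r"
  by (simp add: o_inv_distrib permutes_bij)

text \<open>A simple transposition reverses one pair of values only. This is why exchanging an arm
  entry with a leg entry leaves both pieces increasing.\<close>

lemma adj_less: "x < y \<Longrightarrow> x \<noteq> r \<or> y \<noteq> Suc r \<Longrightarrow> adj r x < adj r y"
  by (auto simp: adj_def transpose_def)

lemma word_prod_simps:
  "word_prod s [] = id" "word_prod s (r # rs) = s r \<circ> word_prod s rs"
  by (simp_all add: word_prod_def)

lemma word_prod_append: "word_prod s (rs @ rs') = word_prod s rs \<circ> word_prod s rs'"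
  by (induction rs) (simp_all add: word_prod_simps o_assoc)

lemma word_prod_adj_permutes: "set rs \<subseteq> {1..<d} \<Longrightarrow> word_prod adj rs permutes {1..d}"
proof (induction rs)
  case (Cons r rs)
  then have "adj r permutes {1..d}" "word_prod adj rs permutes {1..d}"
    using adj_permutes[of r d] by auto
  then show ?case
    unfolding word_prod_simps by (intro permutes_compose)
qed (simp add: word_prod_simps permutes_id)

text \<open>Inversions are counted through the inverse permutation because words are extended on the left.\<close>

definition inversions :: "nat \<Rightarrow> (nat \<Rightarrow> nat) \<Rightarrow> (nat \<times> nat) set" where
  "inversions d w = {(x, y). x \<in> {1..d} \<and> y \<in> {1..d} \<and> x < y \<and> pinv w x > pinv w y}"

lemma finite_inversions [simp]: "finite (inversions d w)"
  by (rule finite_subset[of _ "{1..d} \<times> {1..d}"]) (auto simp: inversions_def)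

lemma inversions_id [simp]: "inversions d id = {}"
  by (auto simp: inversions_def)

text \<open>Applying s_r to both coordinates carries the inversions of \<open>w\<close> bijectively
  to those of s_r w other than (r, r+1), and this pair is new.\<close>

lemma card_inversions_adj:
  assumes w: "w permutes {1..d}" and r: "1 \<le> r" "r < d" and less: "pinv w r < pinv w (Suc r)"
  shows "card (inversions d (adj r \<circ> w)) = Suc (card (inversions d w))"
proof -
  have range: "adj r x \<in> {1..d} \<longleftrightarrow> x \<in> {1..d}" for x
    using r permutes_in_image[OF adj_permutes[of r d]] by blast
  have "inversions d (adj r \<circ> w) =
      insert (r, Suc r) (map_prod (adj r) (adj r) ` inversions d w)" (is "?A = insert ?p ?B")
  proof (rule Set.set_eqI)
    fix z :: "nat \<times> nat"
    obtain x y where z: "z = (x, y)" by (cases z)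
    have B: "z \<in> ?B \<longleftrightarrow> (adj r x, adj r y) \<in> inversions d w"
      unfolding z by (force simp: image_iff)
    show "z \<in> ?A \<longleftrightarrow> z \<in> insert ?p ?B"
    proof (cases "z = ?p")
      case True
      then show ?thesis
        using less r by (simp add: inversions_def inv_adj_comp[OF w])
    next
      case False
      then have "z \<in> insert ?p ?B \<longleftrightarrow> (adj r x, adj r y) \<in> inversions d w"
        using B by simp
      also have "\<dots> \<longleftrightarrow> z \<in> ?A"
      \<comment> \<open>Such a pair would come from (r, r+1), which is no inversion of
        \<open>w\<close> by \<open>less\<close>; both sides are false.\<close>
      proof (cases "x = Suc r \<and> y = r")
        case True
        then show ?thesis
          using less by (simp add: inversions_def z)
      next
        case F: False
        have "x < y \<longleftrightarrow> adj r x < adj r y"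
          using adj_less[of x y r] adj_less[of "adj r x" "adj r y" r] False F
          by (metis adj_involutory adj_simps(1,2) z)
        then show ?thesis
          using range[of x] range[of y]
          by (simp only: inversions_def z inv_adj_comp[OF w] mem_Collect_eq prod.case o_apply adj_involutory)
      qed
      finally show ?thesis by simp
    qed
  qed
  moreover have "?p \<notin> ?B"
  proof
    assume "?p \<in> ?B"
    then obtain x y where "(x, y) \<in> inversions d w" "adj r x = r" "adj r y = Suc r"
      by auto
    then have "x = Suc r" "y = r"
      by (metis adj_involutory adj_simps(1,2))+
    with \<open>(x, y) \<in> inversions d w\<close> show False
      by (simp add: inversions_def)
  qed
  moreover have "inj_on (map_prod (adj r) (adj r)) (inversions d w)"
    by (auto simp: inj_on_def) (metis adj_involutory)+
  ultimately show ?thesis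
    by (simp add: card_image)
qed

lemma card_inversions_adj':
  assumes w: "w permutes {1..d}" and r: "1 \<le> r" "r < d" and gr: "pinv w r > pinv w (Suc r)"
  shows "card (inversions d w) = Suc (card (inversions d (adj r \<circ> w)))"
  using card_inversions_adj[of "adj r \<circ> w" d r] r gr
    permutes_compose[OF w adj_permutes[OF r]] by (simp add: inv_adj_comp[OF w])

lemma inv_neq_Suc:
  assumes "w permutes {1..d}" shows "pinv w r \<noteq> pinv w (Suc r)"
  by (metis assms n_not_Suc_n permutes_inverses(1))

section \<open>Reduced words and the number of inversions\<close>

lemma card_inversions_le_length:
  "set rs \<subseteq> {1..<d} \<Longrightarrow> card (inversions d (word_prod adj rs)) \<le> length rs"
proof (induction rs)
  case (Cons r rs)
  let ?w = "word_prod adj rs"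
  have w: "?w permutes {1..d}" using Cons.prems by (intro word_prod_adj_permutes) auto
  have "card (inversions d (adj r \<circ> ?w)) \<le> Suc (card (inversions d ?w))"
    using card_inversions_adj[OF w, of r] card_inversions_adj'[OF w, of r] Cons.prems
      inv_neq_Suc[OF w, of r]
    by (cases "pinv ?w r < pinv ?w (Suc r)") auto
  also have "\<dots> \<le> length (r # rs)" using Cons by simp
  finally show ?case unfolding word_prod_simps .
qed (simp add: word_prod_simps)

text \<open>An increasing inverse q satisfies r <= q r. Downward induction from d forces equality:
  if q r > r, then q r is already a fixed point of q, against injectivity.\<close>

lemma permutes_eq_id_if_inv_mono:
  assumes w: "w permutes {1..d}" and mono: "\<And>r. 1 \<le> r \<Longrightarrow> r < d \<Longrightarrow> pinv w r < pinv w (Suc r)"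
  shows "w = id"
proof -
  let ?q = "pinv w"
  have q: "?q permutes {1..d}" using w by (rule permutes_inv)
  have ge: "r \<le> ?q r" if "r \<in> {1..d}" for r
    using that
  proof (induction r)
    case (Suc r)
    then show ?case
    proof (cases "r = 0")
      case True
      then show ?thesis using permutes_in_image[OF q, of 1] Suc.prems by auto
    next
      case False
      then show ?thesis using Suc mono[of r] by auto
    qed
  qed simp
  have "?q r = r" if "r \<in> {1..d}" for r
    using that
  proof (induction "d - r" arbitrary: r rule: less_induct)
    case less
    show ?case
    proof (rule ccontr)
      assume "?q r \<noteq> r"
      then have gt: "?q r > r" using ge[OF less.prems] by simp
      have "?q r \<in> {1..d}" using permutes_in_image[OF q] less.prems by blast
      moreover from this gt have "?q (?q r) = ?q r"
        by (intro less.hyps) auto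
      ultimately have "?q r = r" using permutes_inj[OF q] by (auto dest: injD)
      then show False using gt by simp
    qed
  qed
  then have "?q = id"
    using permutes_not_in[OF q] by (auto simp: fun_eq_iff)
  then show ?thesis
    by (metis w permutes_inv_inv inv_id)
qed

text \<open>Peeling a descent off the left lowers the count by one; a permutation without descents
  is the identity.\<close>

lemma ex_word_card_inversions:
  "w permutes {1..d} \<Longrightarrow>
    \<exists>rs. set rs \<subseteq> {1..<d} \<and> word_prod adj rs = w \<and> length rs = card (inversions d w)"
proof (induction "card (inversions d w)" arbitrary: w rule: less_induct)
  case less
  show ?case
  proof (cases "\<exists>r. 1 \<le> r \<and> r < d \<and> pinv w r > pinv w (Suc r)")
    case True
    then obtain r where r: "1 \<le> r" "r < d" "pinv w r > pinv w (Suc r)" by blast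
    note c = card_inversions_adj'[OF less.prems r]
    obtain rs where "set rs \<subseteq> {1..<d}" "word_prod adj rs = adj r \<circ> w"
      "length rs = card (inversions d (adj r \<circ> w))"
      using less.hyps[of "adj r \<circ> w"] permutes_compose[OF less.prems adj_permutes[OF r(1,2)]] c
      by auto
    then show ?thesis
      using r c by (intro exI[of _ "r # rs"]) (simp add: word_prod_simps)
  next
    case False
    then have "w = id"
      using less.prems inv_neq_Suc[OF less.prems]
      by (intro permutes_eq_id_if_inv_mono[of w d]) (metis linorder_neqE_nat)+
    then show ?thesis by (intro exI[of _ "[]"]) (simp add: word_prod_simps)
  qed
qed

text \<open>Each letter changes the number of inversions by one, so minimality over all words
  becomes a count on a single word.\<close>

lemma reduced_expr_adj_iff:
  assumes "w permutes {1..d}"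
  shows "reduced_expr adj {1..<d} w rs \<longleftrightarrow>
    set rs \<subseteq> {1..<d} \<and> word_prod adj rs = w \<and> length rs = card (inversions d w)"
  using ex_word_card_inversions[OF assms] card_inversions_le_length[of _ d]
  unfolding reduced_expr_def by (metis le_antisym)

text \<open>If r were no descent, s_r w would have more inversions than the remaining letters can
  produce.\<close>

lemma reduced_expr_adj_Cons:
  assumes w: "w permutes {1..d}" and red: "reduced_expr adj {1..<d} w (r # rs)"
  shows "r \<in> {1..<d}" "pinv w r > pinv w (Suc r)" "reduced_expr adj {1..<d} (adj r \<circ> w) rs"
proof -
  from red have r: "1 \<le> r" "r < d" and rs: "set rs \<subseteq> {1..<d}"
    and eq: "adj r \<circ> word_prod adj rs = w" and len: "Suc (length rs) = card (inversions d w)"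
    unfolding reduced_expr_adj_iff[OF w] word_prod_simps by simp_all
  have eq': "word_prod adj rs = adj r \<circ> w" using eq by auto
  have w': "adj r \<circ> w permutes {1..d}"
    using permutes_compose[OF w adj_permutes[OF r]] .
  have le: "card (inversions d (adj r \<circ> w)) \<le> length rs"
    using card_inversions_le_length[OF rs] eq' by simp
  show "r \<in> {1..<d}" using r by simp
  show gr: "pinv w r > pinv w (Suc r)"
    using card_inversions_adj[OF w r] le len inv_neq_Suc[OF w, of r] by fastforce
  show "reduced_expr adj {1..<d} (adj r \<circ> w) rs"
    using card_inversions_adj'[OF w r gr] rs eq' len unfolding reduced_expr_adj_iff[OF w'] by simp
qed

lemma reduced_expr_adj_ConsI:
  assumes w: "w permutes {1..d}" and red: "reduced_expr adj {1..<d} (adj r \<circ> w) rs"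
    and r: "1 \<le> r" "r < d" and gr: "pinv w r > pinv w (Suc r)"
  shows "reduced_expr adj {1..<d} w (r # rs)"
  using red card_inversions_adj'[OF w r gr] r
  unfolding reduced_expr_adj_iff[OF w] reduced_expr_adj_iff[OF permutes_compose[OF w adj_permutes[OF r]]]
    word_prod_simps
  by simp

lemma reduced_expr_id: "reduced_expr s N id rs \<longleftrightarrow> rs = []"
  by (auto simp: reduced_expr_def word_prod_simps dest: spec[of _ "[]"])


section \<open>Hooks and their shuffles\<close>

locale hook_shape =
  fixes e d k :: nat
  assumes e3: "3 \<le> e" and kd: "k < d"
begin

lemma sum_list_hook: "sum_list (hook d k) = d"
  using kd by (simp add: hook_def sum_list_replicate)

lemma young_hook: "young (hook d k) = {1} \<times> {1..d - k} \<union> {2..k + 1} \<times> {1}"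
  using kd by (auto simp: young_def hook_def nth_Cons split: nat.splits)

lemma init_tab_hook: "(x, y) \<in> young (hook d k) \<Longrightarrow>
    init_tab (hook d k) (x, y) = (if x = 1 then y else d - k + x - 1)"
  unfolding young_hook by (auto simp: hook_def take_Cons' sum_list_replicate)

lemma bij_init_tab_hook: "bij_betw (init_tab (hook d k)) (young (hook d k)) {1..d}"
proof -
  \<comment> \<open>The inverse map: entries up to d-k fill the first row, and a later entry j sits
    in row j-(d-k)+1 of the first column.\<close>
  let ?node = "\<lambda>j. if j \<le> d - k then (1, j) else (j - (d - k) + 1, 1 :: nat)"
  have node: "?node j \<in> young (hook d k)" if "j \<in> {1..d}" for j
    using that kd by (auto simp: young_hook)
  have node': "init_tab (hook d k) (?node j) = j" if j: "j \<in> {1..d}" for j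
    using node[OF j] init_tab_hook[of 1 j] init_tab_hook[of "j - (d - k) + 1" 1]
    by (cases "j \<le> d - k") (simp_all del: init_tab.simps)
  have entry: "init_tab (hook d k) N \<in> {1..d}" "?node (init_tab (hook d k) N) = N"
    if "N \<in> young (hook d k)" for N
    using that kd init_tab_hook[of "fst N" "snd N"] by (auto simp: young_hook)
  show ?thesis
    by (rule bij_betw_byWitness[of _ ?node]) (use node node' entry in blast)+
qed

text \<open>In these terms i -> j reads \<open>i = up j\<close>, so every condition on neighbouring
  residues becomes an equation in \<open>up\<close>.\<close>

definition up :: "int \<Rightarrow> int" where
  "up x = (x + 1) mod int e"

abbreviation base_res :: "nat \<Rightarrow> int" where
  "base_res \<equiv> res_seq e (hook d k) (init_tab (hook d k))"

abbreviation c :: "(nat \<Rightarrow> nat) \<Rightarrow> nat \<Rightarrow> int" where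
  "c \<sigma> \<equiv> perm_seq d \<sigma> base_res"

text \<open>The node of the first row holding j has content j - 1; the leg node in row j-(d-k)+1 has
  content -(j-(d-k)).\<close>

lemma base_res:
  assumes j: "j \<in> {1..d}"
  shows "base_res j = (if j \<le> d - k then (int j - 1) mod int e else (- int (j - (d - k))) mod int e)"
proof -
  define N where "N = (if j \<le> d - k then (1, j) else (j - (d - k) + 1, 1 :: nat))"
  have "N \<in> young (hook d k)" "init_tab (hook d k) N = j"
  proof -
    show N: "N \<in> young (hook d k)"
      using j kd by (auto simp: N_def young_hook)
    then show "init_tab (hook d k) N = j"
      using init_tab_hook[of "fst N" "snd N"] j kd by (auto simp: N_def simp del: init_tab.simps split: if_splits)
  qed
  then have "inv_into (young (hook d k)) (init_tab (hook d k)) j = N"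
    using bij_init_tab_hook by (auto simp: bij_betw_def intro: inv_into_f_eq)
  then show ?thesis
    using j by (auto simp: res_seq_def sum_list_hook N_def algebra_simps of_nat_diff)
qed

lemma up_eq: "x \<in> {0..<int e} \<Longrightarrow> up x = (if x + 1 = int e then 0 else x + 1)"
  by (auto simp: up_def)

lemma up_range: "up x \<in> {0..<int e}"
  using e3 by (simp add: up_def)

text \<open>Here e >= 3 enters in full strength: neither 1 nor 2 vanishes modulo e.\<close>

lemma up_neq:
  assumes x: "x \<in> {0..<int e}" shows "up x \<noteq> x" "up (up x) \<noteq> x"
proof -
  show "up x \<noteq> x"
    using x e3 up_eq[OF x] by (cases "x + 1 = int e") auto
  show "up (up x) \<noteq> x"
    using x e3 up_eq[OF x] up_eq[OF up_range, of x]
    by (cases "x + 1 = int e"; cases "up x + 1 = int e") auto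
qed

lemma arrow_iff: "x \<in> {0..<int e} \<Longrightarrow> y \<in> {0..<int e} \<Longrightarrow> arrow e x y \<longleftrightarrow> x = up y"
proof -
  assume "x \<in> {0..<int e}" "y \<in> {0..<int e}"
  moreover from this have "(x - 1) mod int e = (if x = 0 then int e - 1 else x - 1)"
    by (auto simp: zmod_minus1)
  ultimately show ?thesis by (auto simp: arrow_def up_eq)
qed

section \<open>Arm and leg of a shuffle and their residues\<close>

lemma Sh_permutes: "\<sigma> \<in> Sh d k \<Longrightarrow> \<sigma> permutes {1..d}"
  by (simp add: Sh_def)

lemma mem_image_permutes_iff:
  assumes "\<sigma> permutes S" shows "r \<in> \<sigma> ` X \<longleftrightarrow> pinv \<sigma> r \<in> X"
proof
  assume "pinv \<sigma> r \<in> X"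
  then have "\<sigma> (pinv \<sigma> r) \<in> \<sigma> ` X" by (rule imageI)
  then show "r \<in> \<sigma> ` X" by (simp only: permutes_inverses(1)[OF assms])
qed (auto simp: permutes_inverses(2)[OF assms])

lemma Arm_iff: "\<sigma> permutes {1..d} \<Longrightarrow> r \<in> Arm d k \<sigma> \<longleftrightarrow> pinv \<sigma> r \<in> {2..d - k}"
  unfolding Arm_def by (rule mem_image_permutes_iff)

lemma Leg_iff: "\<sigma> permutes {1..d} \<Longrightarrow> r \<in> Leg d k \<sigma> \<longleftrightarrow> pinv \<sigma> r \<in> {d - k + 1..d}"
  unfolding Leg_def by (rule mem_image_permutes_iff)

lemma inv_Sh_1: "\<sigma> \<in> Sh d k \<Longrightarrow> pinv \<sigma> 1 = 1"
  using permutes_inv_eq[of \<sigma> "{1..d}" 1 1] unfolding Sh_def by blast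

lemma Arm_range: "\<sigma> \<in> Sh d k \<Longrightarrow> r \<in> Arm d k \<sigma> \<Longrightarrow> 2 \<le> r \<and> r \<le> d"
proof -
  assume s: "\<sigma> \<in> Sh d k" and r: "r \<in> Arm d k \<sigma>"
  have "pinv \<sigma> r \<in> {2..d}" using Arm_iff[OF Sh_permutes[OF s], of r] r by auto
  then have "r \<in> {1..d}" "r \<noteq> 1"
    using permutes_in_image[OF permutes_inv[OF Sh_permutes[OF s]], of r] inv_Sh_1[OF s] by auto
  then show ?thesis by auto
qed

lemma Leg_range: "\<sigma> \<in> Sh d k \<Longrightarrow> r \<in> Leg d k \<sigma> \<Longrightarrow> 2 \<le> r \<and> r \<le> d"
proof -
  assume s: "\<sigma> \<in> Sh d k" and r: "r \<in> Leg d k \<sigma>"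
  have "pinv \<sigma> r \<in> {2..d}" using Leg_iff[OF Sh_permutes[OF s], of r] r kd by auto
  then have "r \<in> {1..d}" "r \<noteq> 1"
    using permutes_in_image[OF permutes_inv[OF Sh_permutes[OF s]], of r] inv_Sh_1[OF s] by auto
  then show ?thesis by auto
qed

text \<open>Position 1 holds the entry 1, so every other entry occupies one of the positions 2, ...,
  d, which the two ranges partition.\<close>

lemma Leg_iff_not_Arm:
  assumes s: "\<sigma> \<in> Sh d k" and r: "2 \<le> r" "r \<le> d"
  shows "r \<in> Leg d k \<sigma> \<longleftrightarrow> r \<notin> Arm d k \<sigma>"
proof -
  have "pinv \<sigma> r \<in> {1..d}"
    using permutes_in_image[OF permutes_inv[OF Sh_permutes[OF s]], of r] r by auto
  moreover have "pinv \<sigma> r \<noteq> 1"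
    using r s Sh_permutes[OF s] inv_Sh_1[OF s] by (metis permutes_inverses(1) numeral_le_one_iff semiring_norm(69))
  ultimately show ?thesis
    using Arm_iff[OF Sh_permutes[OF s]] Leg_iff[OF Sh_permutes[OF s]] by auto
qed

lemma Arm_adj: "r \<in> Arm d k (adj t \<circ> \<sigma>) \<longleftrightarrow> adj t r \<in> Arm d k \<sigma>"
  unfolding Arm_def by (rule image_adj_comp)

lemma Leg_adj: "r \<in> Leg d k (adj t \<circ> \<sigma>) \<longleftrightarrow> adj t r \<in> Leg d k \<sigma>"
  unfolding Leg_def by (rule image_adj_comp)

text \<open>The entries t and t+1 lie in different pieces, while s_t can only disturb the order of a
  piece containing both.\<close>

lemma Sh_swap:
  assumes s: "\<sigma> \<in> Sh d k"
    and t: "t \<in> Arm d k \<sigma> \<and> Suc t \<in> Leg d k \<sigma> \<or> t \<in> Leg d k \<sigma> \<and> Suc t \<in> Arm d k \<sigma>"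
  shows "adj t \<circ> \<sigma> \<in> Sh d k"
proof -
  have t': "2 \<le> t" "Suc t \<le> d"
    using t Arm_range[OF s, of t] Arm_range[OF s, of "Suc t"] Leg_range[OF s, of t] Leg_range[OF s, of "Suc t"]
    by auto
  have disj: "r \<in> Leg d k \<sigma> \<longleftrightarrow> r \<notin> Arm d k \<sigma>" if "r = t \<or> r = Suc t" for r
    using Leg_iff_not_Arm[OF s, of r] that t' by auto
  have mono: "strict_mono_on X (adj t \<circ> \<sigma>)"
    if X: "strict_mono_on X \<sigma>" "X \<subseteq> {2..d - k} \<or> X \<subseteq> {d - k + 1..d}" for X
  proof (rule strict_mono_onI)
    fix x y assume xy: "x \<in> X" "y \<in> X" "x < y"
    have "\<sigma> x \<noteq> t \<or> \<sigma> y \<noteq> Suc t"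
    proof (rule ccontr)
      assume "\<not> ?thesis"
      then have "t \<in> \<sigma> ` X" "Suc t \<in> \<sigma> ` X" using xy by force+
      then have "t \<in> Arm d k \<sigma> \<and> Suc t \<in> Arm d k \<sigma> \<or> t \<in> Leg d k \<sigma> \<and> Suc t \<in> Leg d k \<sigma>"
        using X(2) by (auto simp: Arm_def Leg_def)
      then show False using t disj by blast
    qed
    moreover have "\<sigma> x < \<sigma> y" using X(1) xy by (auto dest: strict_mono_onD)
    ultimately show "(adj t \<circ> \<sigma>) x < (adj t \<circ> \<sigma>) y" by (simp add: adj_less)
  qed
  have "adj t \<circ> \<sigma> permutes {1..d}"
    using t' permutes_compose[OF Sh_permutes[OF s] adj_permutes[of t d]] by simp
  then show ?thesis
    using mono[of "{2..d - k}"] mono[of "{d - k + 1..d}"] s t' by (simp add: Sh_def)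
qed

lemma c_range:
  assumes "\<sigma> permutes {1..d}" "r \<in> {1..d}"
  shows "c \<sigma> r \<in> {0..<int e}"
  using assms e3 permutes_in_image[OF permutes_inv[OF assms(1)], of r]
  by (simp add: perm_seq_def base_res)

text \<open>A position strictly in between would carry a value strictly between two consecutive
  numbers.\<close>

lemma strict_mono_on_consecutive:
  fixes \<sigma> :: "nat \<Rightarrow> nat"
  assumes "strict_mono_on {m..n} \<sigma>" "p \<in> {m..n}" "q \<in> {m..n}" "\<sigma> q = Suc (\<sigma> p)"
  shows "q = Suc p"
proof -
  have "p < q"
    using assms by (metis linorder_not_less lessI less_irrefl strict_mono_onD le_neq_implies_less not_less_iff_gr_or_eq)
  moreover have "\<not> Suc p < q"
  proof
    assume "Suc p < q"
    then have "\<sigma> p < \<sigma> (Suc p)" "\<sigma> (Suc p) < \<sigma> q"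
      using assms(2,3) by (auto intro!: strict_mono_onD[OF assms(1)])
    then show False using assms(4) by simp
  qed
  ultimately show ?thesis by simp
qed

lemma inv_Suc_Arm:
  assumes s: "\<sigma> \<in> Sh d k" and r: "r \<in> Arm d k \<sigma>" "Suc r \<in> Arm d k \<sigma>"
  shows "pinv \<sigma> (Suc r) = Suc (pinv \<sigma> r)"
proof (rule strict_mono_on_consecutive)
  show "strict_mono_on {2..d - k} \<sigma>" using s by (simp add: Sh_def)
  show "pinv \<sigma> r \<in> {2..d - k}" "pinv \<sigma> (Suc r) \<in> {2..d - k}"
    using r Arm_iff[OF Sh_permutes[OF s]] by blast+
  show "\<sigma> (pinv \<sigma> (Suc r)) = Suc (\<sigma> (pinv \<sigma> r))"
    by (simp only: permutes_inverses(1)[OF Sh_permutes[OF s]])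
qed

lemma inv_Suc_Leg:
  assumes s: "\<sigma> \<in> Sh d k" and r: "r \<in> Leg d k \<sigma>" "Suc r \<in> Leg d k \<sigma>"
  shows "pinv \<sigma> (Suc r) = Suc (pinv \<sigma> r)"
proof (rule strict_mono_on_consecutive)
  show "strict_mono_on {d - k + 1..d} \<sigma>" using s by (simp add: Sh_def)
  show "pinv \<sigma> r \<in> {d - k + 1..d}" "pinv \<sigma> (Suc r) \<in> {d - k + 1..d}"
    using r Leg_iff[OF Sh_permutes[OF s]] by blast+
  show "\<sigma> (pinv \<sigma> (Suc r)) = Suc (\<sigma> (pinv \<sigma> r))"
    by (simp only: permutes_inverses(1)[OF Sh_permutes[OF s]])
qed

lemma c_Arm:
  assumes s: "\<sigma> \<in> Sh d k" and r: "r \<in> Arm d k \<sigma>" "Suc r \<in> Arm d k \<sigma>"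
  shows "c \<sigma> (Suc r) = up (c \<sigma> r)"
proof -
  have "pinv \<sigma> r \<in> {2..d - k}" "pinv \<sigma> (Suc r) \<in> {2..d - k}"
    using r Arm_iff[OF Sh_permutes[OF s]] by blast+
  then show ?thesis
    using kd Arm_range[OF s r(1)] Arm_range[OF s r(2)] inv_Suc_Arm[OF s r]
    by (simp add: perm_seq_def base_res up_def mod_simps)
qed

lemma c_Leg:
  assumes s: "\<sigma> \<in> Sh d k" and r: "r \<in> Leg d k \<sigma>" "Suc r \<in> Leg d k \<sigma>"
  shows "c \<sigma> r = up (c \<sigma> (Suc r))"
proof -
  let ?p = "pinv \<sigma> r"
  have p: "?p \<in> {d - k + 1..d}" "pinv \<sigma> (Suc r) \<in> {d - k + 1..d}"
    using r Leg_iff[OF Sh_permutes[OF s]] by blast+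
  then have "int (Suc ?p - (d - k)) = int (?p - (d - k)) + 1"
    by (simp add: Suc_diff_le)
  then show ?thesis
    using p kd Leg_range[OF s r(1)] Leg_range[OF s r(2)] inv_Suc_Leg[OF s r]
    by (simp add: perm_seq_def base_res up_def mod_simps del: of_nat_diff)
qed

text \<open>Consecutive entries of one piece stand in order, and arm positions precede leg
  positions; leg-arm is the only pattern left.\<close>

lemma Sh_descent:
  assumes s: "\<sigma> \<in> Sh d k" and r: "1 \<le> r" "r < d" and gr: "pinv \<sigma> r > pinv \<sigma> (Suc r)"
  shows "r \<in> Leg d k \<sigma>" "Suc r \<in> Arm d k \<sigma>"
proof -
  have range: "pinv \<sigma> (Suc r) \<in> {1..d}"
    using permutes_in_image[OF permutes_inv[OF Sh_permutes[OF s]], of "Suc r"] r by simp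
  have "r \<noteq> 1" using gr range inv_Sh_1[OF s] by auto
  then have cover: "r \<in> Leg d k \<sigma> \<longleftrightarrow> r \<notin> Arm d k \<sigma>" "Suc r \<in> Leg d k \<sigma> \<longleftrightarrow> Suc r \<notin> Arm d k \<sigma>"
    using r Leg_iff_not_Arm[OF s] by simp_all
  have "\<not> (r \<in> Arm d k \<sigma> \<and> Suc r \<in> Arm d k \<sigma>)" "\<not> (r \<in> Leg d k \<sigma> \<and> Suc r \<in> Leg d k \<sigma>)"
    using inv_Suc_Arm[OF s] inv_Suc_Leg[OF s] gr by fastforce+
  moreover have "\<not> (r \<in> Arm d k \<sigma> \<and> Suc r \<in> Leg d k \<sigma>)"
    using Leg_iff[OF Sh_permutes[OF s]] Arm_iff[OF Sh_permutes[OF s]] gr by fastforce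
  ultimately show "r \<in> Leg d k \<sigma>" "Suc r \<in> Arm d k \<sigma>" using cover by blast+
qed

lemma Leg_not_Arm: "\<sigma> \<in> Sh d k \<Longrightarrow> r \<in> Leg d k \<sigma> \<Longrightarrow> r \<notin> Arm d k \<sigma>"
  using Leg_iff_not_Arm Leg_range by blast

lemma pinv_gr:
  assumes "\<sigma> \<in> Sh d k" "r \<in> Leg d k \<sigma>" "s \<in> Arm d k \<sigma>"
  shows "pinv \<sigma> r > pinv \<sigma> s"
  using assms Leg_iff[OF Sh_permutes[OF assms(1)]] Arm_iff[OF Sh_permutes[OF assms(1)]] by fastforce

end

context hook_shape
begin

text \<open>Unlike \<open>c\<close>, this residue function commutes with swaps of entries without side conditions on the entries.\<close>

definition cl :: "(nat \<Rightarrow> nat) \<Rightarrow> nat \<Rightarrow> int" where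
  "cl \<sigma> r = base_res (pinv \<sigma> r)"

lemma c_eq_cl: "r \<in> {1..d} \<Longrightarrow> c \<sigma> r = cl \<sigma> r"
  by (simp add: cl_def perm_seq_def)

lemma cl_adj [simp]: "bij \<sigma> \<Longrightarrow> cl (adj t \<circ> \<sigma>) r = cl \<sigma> (adj t r)"
  by (simp add: cl_def o_inv_distrib)

lemma bij_adj_comp [simp]: "bij \<sigma> \<Longrightarrow> bij (adj t \<circ> \<sigma>)"
  by (rule bij_comp) simp_all

lemma Sh_bij: "\<sigma> \<in> Sh d k \<Longrightarrow> bij \<sigma>"
  by (rule permutes_bij) (rule Sh_permutes)

lemma cl_range: "\<sigma> \<in> Sh d k \<Longrightarrow> r \<in> {1..d} \<Longrightarrow> cl \<sigma> r \<in> {0..<int e}"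
  using c_range[OF Sh_permutes] by (simp add: c_eq_cl)

lemma cl_Arm:
  assumes "\<sigma> \<in> Sh d k" "r \<in> Arm d k \<sigma>" "Suc r \<in> Arm d k \<sigma>"
  shows "cl \<sigma> (Suc r) = up (cl \<sigma> r)"
  using c_Arm[OF assms] Arm_range[OF assms(1,2)] Arm_range[OF assms(1,3)] by (simp add: c_eq_cl)

lemma cl_Leg:
  assumes "\<sigma> \<in> Sh d k" "r \<in> Leg d k \<sigma>" "Suc r \<in> Leg d k \<sigma>"
  shows "cl \<sigma> r = up (cl \<sigma> (Suc r))"
  using c_Leg[OF assms] Leg_range[OF assms(1,2)] Leg_range[OF assms(1,3)] by (simp add: c_eq_cl)

lemma up_up_neq: "\<sigma> \<in> Sh d k \<Longrightarrow> r \<in> {1..d} \<Longrightarrow> up (up (cl \<sigma> r)) \<noteq> cl \<sigma> r"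
  using up_neq cl_range by blast

lemma up_cl_neq: "\<sigma> \<in> Sh d k \<Longrightarrow> r \<in> {1..d} \<Longrightarrow> up (cl \<sigma> r) \<noteq> cl \<sigma> r"
  using up_neq cl_range by blast

lemma inversions_swap_less:
  assumes s: "\<sigma> \<in> Sh d k" and t: "t \<in> Leg d k \<sigma>" "Suc t \<in> Arm d k \<sigma>"
  shows "card (inversions d (adj t \<circ> \<sigma>)) < card (inversions d \<sigma>)"
  using card_inversions_adj'[OF Sh_permutes[OF s], of t] pinv_gr[OF s t]
    Leg_range[OF s t(1)] Arm_range[OF s t(2)] by simp

lemma Arm_id: "r \<in> Arm d k id \<longleftrightarrow> 2 \<le> r \<and> r \<le> d - k"
  by (simp add: Arm_def)

lemma Leg_id: "r \<in> Leg d k id \<longleftrightarrow> d - k < r \<and> r \<le> d"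
  by (auto simp: Leg_def)

text \<open>Base case of the inductions: without a leg-arm descent the inverse increases at every
  step.\<close>

lemma Sh_no_descent_imp_id:
  assumes s: "\<sigma> \<in> Sh d k" and no: "\<And>t. t \<in> Leg d k \<sigma> \<Longrightarrow> Suc t \<notin> Arm d k \<sigma>"
  shows "\<sigma> = id"
proof (rule permutes_eq_id_if_inv_mono[OF Sh_permutes[OF s]])
  fix r assume "1 \<le> r" "r < d"
  then have "\<not> pinv \<sigma> (Suc r) < pinv \<sigma> r" using Sh_descent[OF s] no by blast
  then show "pinv \<sigma> r < pinv \<sigma> (Suc r)"
    using inv_neq_Suc[OF Sh_permutes[OF s], of r] by simp
qed

end


section \<open>The action on the vectors of shuffles\<close>

text \<open>The KLR relations are only ever applied to vectors \<open>V \<sigma>\<close>, where the idempotents have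
  already turned them into conditions on residues.\<close>

locale hook_action = hook_shape e d k + abelian_group M
  for e d k :: nat and M (structure) +
  fixes y p :: "nat \<Rightarrow> 'b \<Rightarrow> 'b" and V :: "(nat \<Rightarrow> nat) \<Rightarrow> 'b"
  assumes V_closed: "\<sigma> \<in> Sh d k \<Longrightarrow> V \<sigma> \<in> carrier M"
    and y_closed: "r \<in> {1..d} \<Longrightarrow> x \<in> carrier M \<Longrightarrow> y r x \<in> carrier M"
    and p_closed: "r \<in> {1..<d} \<Longrightarrow> x \<in> carrier M \<Longrightarrow> p r x \<in> carrier M"
    and p_zero: "r \<in> {1..<d} \<Longrightarrow> p r \<zero> = \<zero>"
    and p_minus: "r \<in> {1..<d} \<Longrightarrow> x \<in> carrier M \<Longrightarrow> p r (\<ominus> x) = \<ominus> p r x"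
    and p_V: "\<sigma> \<in> Sh d k \<Longrightarrow> t \<in> Arm d k \<sigma> \<Longrightarrow> Suc t \<in> Leg d k \<sigma> \<Longrightarrow> p t (V \<sigma>) = V (adj t \<circ> \<sigma>)"
    and y_id: "r \<in> {1..d} \<Longrightarrow> y r (V id) = \<zero>"
    and p_Arm_id: "1 \<le> r \<Longrightarrow> r < d - k \<Longrightarrow> p r (V id) = \<zero>"
    and p_Leg_id: "d - k < r \<Longrightarrow> r < d \<Longrightarrow> p r (V id) = \<zero>"
    and p_Garnir: "0 < k \<Longrightarrow> foldr p [1..<Suc (d - k)] (V id) = \<zero>"
    and y_p_comm: "\<sigma> \<in> Sh d k \<Longrightarrow> t \<in> {1..<d} \<Longrightarrow> r \<in> {1..d} \<Longrightarrow> r \<noteq> t \<Longrightarrow> r \<noteq> Suc t \<Longrightarrow>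
      y r (p t (V \<sigma>)) = p t (y r (V \<sigma>))"
    and y_p: "\<sigma> \<in> Sh d k \<Longrightarrow> t \<in> {1..<d} \<Longrightarrow>
      y t (p t (V \<sigma>)) = p t (y (Suc t) (V \<sigma>)) \<ominus> (if cl \<sigma> t = cl \<sigma> (Suc t) then V \<sigma> else \<zero>)"
    and y_Suc_p: "\<sigma> \<in> Sh d k \<Longrightarrow> t \<in> {1..<d} \<Longrightarrow>
      y (Suc t) (p t (V \<sigma>)) = p t (y t (V \<sigma>)) \<oplus> (if cl \<sigma> t = cl \<sigma> (Suc t) then V \<sigma> else \<zero>)"
    and p_p_comm: "\<sigma> \<in> Sh d k \<Longrightarrow> t \<in> {1..<d} \<Longrightarrow> r \<in> {1..<d} \<Longrightarrow> Suc t < r \<or> Suc r < t \<Longrightarrow>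
      p r (p t (V \<sigma>)) = p t (p r (V \<sigma>))"
    and p_p: "\<sigma> \<in> Sh d k \<Longrightarrow> t \<in> {1..<d} \<Longrightarrow> p t (p t (V \<sigma>)) =
      (if cl \<sigma> t = cl \<sigma> (Suc t) then \<zero>
       else if cl \<sigma> t = up (cl \<sigma> (Suc t)) then y (Suc t) (V \<sigma>) \<ominus> y t (V \<sigma>)
       else if cl \<sigma> (Suc t) = up (cl \<sigma> t) then y t (V \<sigma>) \<ominus> y (Suc t) (V \<sigma>)
       else V \<sigma>)"
    and braid: "\<sigma> \<in> Sh d k \<Longrightarrow> 1 \<le> t \<Longrightarrow> Suc (Suc t) \<le> d \<Longrightarrow> p t (p (Suc t) (p t (V \<sigma>))) =
      (if cl \<sigma> (Suc (Suc t)) = cl \<sigma> t \<and> cl \<sigma> t = up (cl \<sigma> (Suc t))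
         then p (Suc t) (p t (p (Suc t) (V \<sigma>))) \<oplus> V \<sigma>
       else if cl \<sigma> (Suc (Suc t)) = cl \<sigma> t \<and> cl \<sigma> (Suc t) = up (cl \<sigma> t)
         then p (Suc t) (p t (p (Suc t) (V \<sigma>))) \<ominus> V \<sigma>
       else p (Suc t) (p t (p (Suc t) (V \<sigma>))))"
begin

text \<open>These are the descents at which \<open>y s\<close> and \<open>y (Suc s)\<close> may act
  nontrivially.\<close>

definition match :: "(nat \<Rightarrow> nat) \<Rightarrow> nat \<Rightarrow> bool" where
  "match \<sigma> s \<longleftrightarrow> s \<in> Leg d k \<sigma> \<and> Suc s \<in> Arm d k \<sigma> \<and> cl \<sigma> s = cl \<sigma> (Suc s)"

definition y_match where
  "y_match \<sigma> \<longleftrightarrow> (\<forall>s. match \<sigma> s \<longrightarrow>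
     y s (V \<sigma>) = \<ominus> V (adj s \<circ> \<sigma>) \<and> y (Suc s) (V \<sigma>) = V (adj s \<circ> \<sigma>))"

definition y_no_match where
  "y_no_match \<sigma> \<longleftrightarrow> (\<forall>r\<in>{1..d}. \<not> match \<sigma> r \<longrightarrow> (\<forall>s. r = Suc s \<longrightarrow> \<not> match \<sigma> s) \<longrightarrow> y r (V \<sigma>) = \<zero>)"

text \<open>The generator has index \<open>Suc s\<close>, so that the entry before it is
  \<open>s\<close> and no truncated subtraction occurs.\<close>

definition p_Arm_Arm where
  "p_Arm_Arm \<sigma> \<longleftrightarrow> (\<forall>s. Suc s \<in> Arm d k \<sigma> \<longrightarrow> Suc (Suc s) \<in> Arm d k \<sigma> \<longrightarrow>
     p (Suc s) (V \<sigma>) = (if s \<in> Leg d k \<sigma> \<and> cl \<sigma> s = cl \<sigma> (Suc s)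
       then V (adj (Suc s) \<circ> (adj s \<circ> \<sigma>)) else \<zero>))"

definition p_Leg_Leg where
  "p_Leg_Leg \<sigma> \<longleftrightarrow> (\<forall>r. r \<in> Leg d k \<sigma> \<longrightarrow> Suc r \<in> Leg d k \<sigma> \<longrightarrow>
     p r (V \<sigma>) = (if Suc (Suc r) \<in> Arm d k \<sigma> \<and> cl \<sigma> (Suc r) = cl \<sigma> (Suc (Suc r))
       then \<ominus> V (adj r \<circ> (adj (Suc r) \<circ> \<sigma>)) else \<zero>))"

text \<open>The statement carried through the induction. Arm-leg pairs are already settled by
  \<open>p_V\<close>, and leg-arm pairs will follow from psi_t^2 without further induction.\<close>

definition formulas where
  "formulas \<sigma> \<longleftrightarrow> y_match \<sigma> \<and> y_no_match \<sigma> \<and> p_Arm_Arm \<sigma> \<and> p_Leg_Leg \<sigma>"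

lemma minus_eq_zero_imp_eq: "\<lbrakk>a \<in> carrier M; b \<in> carrier M; \<zero> = a \<ominus> b\<rbrakk> \<Longrightarrow> a = b"
  by (metis a_minus_def add.inv_equality add.inv_closed minus_minus)

lemma formulasD:
  assumes "formulas \<sigma>"
  shows "match \<sigma> s \<Longrightarrow> y s (V \<sigma>) = \<ominus> V (adj s \<circ> \<sigma>)"
    and "match \<sigma> s \<Longrightarrow> y (Suc s) (V \<sigma>) = V (adj s \<circ> \<sigma>)"
    and "r \<in> {1..d} \<Longrightarrow> \<not> match \<sigma> r \<Longrightarrow> (\<And>s. r = Suc s \<Longrightarrow> \<not> match \<sigma> s) \<Longrightarrow> y r (V \<sigma>) = \<zero>"
    and "Suc s \<in> Arm d k \<sigma> \<Longrightarrow> Suc (Suc s) \<in> Arm d k \<sigma> \<Longrightarrow>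
     p (Suc s) (V \<sigma>) = (if s \<in> Leg d k \<sigma> \<and> cl \<sigma> s = cl \<sigma> (Suc s)
       then V (adj (Suc s) \<circ> (adj s \<circ> \<sigma>)) else \<zero>)"
    and "r \<in> Leg d k \<sigma> \<Longrightarrow> Suc r \<in> Leg d k \<sigma> \<Longrightarrow>
     p r (V \<sigma>) = (if Suc (Suc r) \<in> Arm d k \<sigma> \<and> cl \<sigma> (Suc r) = cl \<sigma> (Suc (Suc r))
       then \<ominus> V (adj r \<circ> (adj (Suc r) \<circ> \<sigma>)) else \<zero>)"
  using assms unfolding formulas_def y_match_def y_no_match_def p_Arm_Arm_def p_Leg_Leg_def by blast+

text \<open>The equation for \<open>V \<sigma>\<close> is \<open>p_V\<close> read backwards: in s_t
  \<sigma> the entry t is in the arm and t+1 in the leg.\<close>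

lemma descentD:
  assumes s: "\<sigma> \<in> Sh d k" and t: "t \<in> Leg d k \<sigma>" "Suc t \<in> Arm d k \<sigma>"
  shows "adj t \<circ> \<sigma> \<in> Sh d k" "card (inversions d (adj t \<circ> \<sigma>)) < card (inversions d \<sigma>)"
    "V \<sigma> = p t (V (adj t \<circ> \<sigma>))" "2 \<le> t" "t < d"
proof -
  show *: "adj t \<circ> \<sigma> \<in> Sh d k" using Sh_swap[OF s] t by blast
  show "card (inversions d (adj t \<circ> \<sigma>)) < card (inversions d \<sigma>)" by (rule inversions_swap_less) fact+
  show "V \<sigma> = p t (V (adj t \<circ> \<sigma>))" using p_V[OF *, of t] t by (simp add: Arm_adj Leg_adj)
  show "2 \<le> t" "t < d" using Leg_range[OF s t(1)] Arm_range[OF s t(2)] by auto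
qed

section \<open>Induction step: the formulas for one shuffle from those for shuffles with fewer
  inversions\<close>

context
  fixes \<sigma>
  assumes s: "\<sigma> \<in> Sh d k"
    and IH: "\<And>\<tau>. \<tau> \<in> Sh d k \<Longrightarrow> card (inversions d \<tau>) < card (inversions d \<sigma>) \<Longrightarrow> formulas \<tau>"
begin

text \<open>Disposes of psi_t y_{t+1}[\<tau>] when \<tau> = s_t \<sigma> has a match at t+1. The
  vector has arm entries t and t+1, so a nonzero value of psi_t needs a leg entry t-1 with the
  residue that t+1 has in \<sigma>; together with the match this gives
  \<open>up (up x) = x\<close>.\<close>

lemma p_match_Suc_eq_zero:
  assumes t: "t \<in> Leg d k \<sigma>" "Suc t \<in> Arm d k \<sigma>" and m: "match (adj t \<circ> \<sigma>) (Suc t)"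
  shows "p t (V (adj (Suc t) \<circ> (adj t \<circ> \<sigma>))) = \<zero>"
proof -
  note D = descentD[OF s t]
  let ?\<tau> = "adj t \<circ> \<sigma>" and ?\<rho> = "adj (Suc t) \<circ> (adj t \<circ> \<sigma>)"
  note [simp] = Arm_adj Leg_adj Sh_bij[OF s]
  have m': "Suc (Suc t) \<in> Arm d k \<sigma>" "cl \<sigma> t = cl \<sigma> (Suc (Suc t))"
    using m unfolding match_def by simp_all
  have m1: "Suc t \<in> Leg d k ?\<tau>" "Suc (Suc t) \<in> Arm d k ?\<tau>" using t m' by simp_all
  note D' = descentD[OF D(1) m1]
  obtain u where u: "t = Suc u" using D(4) by (cases t) auto
  have "\<not> (u \<in> Leg d k \<sigma> \<and> cl \<sigma> u = cl \<sigma> (Suc t))"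
  proof
    assume u': "u \<in> Leg d k \<sigma> \<and> cl \<sigma> u = cl \<sigma> (Suc t)"
    then have "cl \<sigma> u = up (cl \<sigma> t)" using cl_Leg[OF s, of u] t by (simp add: u)
    moreover have "cl \<sigma> (Suc (Suc t)) = up (cl \<sigma> (Suc t))"
      using cl_Arm[OF s t(2) m'(1)] .
    ultimately show False
      using u' m'(2) up_up_neq[OF s, of "Suc t"] D(4,5) by simp
  qed
  then show ?thesis
    using formulasD(4)[OF IH[OF D'(1)], of u] D(2) D'(2) t m' by (auto simp: u)
qed

text \<open>Mirror image for psi_t y_t[\<tau>], with t = \<open>Suc u\<close>: the vector has leg
  entries t and t+1, and a nonzero value needs an arm entry t+2 with the residue that t has in
  \<sigma>, again leading to \<open>up (up x) = x\<close>.\<close>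

lemma p_match_pred_eq_zero:
  assumes t: "Suc u \<in> Leg d k \<sigma>" "Suc (Suc u) \<in> Arm d k \<sigma>" and m: "match (adj (Suc u) \<circ> \<sigma>) u"
  shows "p (Suc u) (V (adj u \<circ> (adj (Suc u) \<circ> \<sigma>))) = \<zero>"
proof -
  note D = descentD[OF s t]
  let ?\<tau> = "adj (Suc u) \<circ> \<sigma>" and ?\<rho> = "adj u \<circ> (adj (Suc u) \<circ> \<sigma>)"
  note [simp] = Arm_adj Leg_adj Sh_bij[OF s]
  have m': "u \<in> Leg d k \<sigma>" "cl \<sigma> u = cl \<sigma> (Suc (Suc u))"
    using m unfolding match_def by simp_all
  have m1: "u \<in> Leg d k ?\<tau>" "Suc u \<in> Arm d k ?\<tau>" using t m' by simp_all
  note D' = descentD[OF D(1) m1]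
  have "\<not> (Suc (Suc (Suc u)) \<in> Arm d k \<sigma> \<and> cl \<sigma> (Suc u) = cl \<sigma> (Suc (Suc (Suc u))))"
  proof
    assume a: "Suc (Suc (Suc u)) \<in> Arm d k \<sigma> \<and> cl \<sigma> (Suc u) = cl \<sigma> (Suc (Suc (Suc u)))"
    then have "cl \<sigma> (Suc (Suc (Suc u))) = up (cl \<sigma> (Suc (Suc u)))" using cl_Arm[OF s t(2)] by simp
    moreover have "cl \<sigma> u = up (cl \<sigma> (Suc u))"
      using cl_Leg[OF s m'(1) t(1)] .
    ultimately show False
      using a m'(2) up_up_neq[OF s, of "Suc u"] D(4,5) by simp
  qed
  then show ?thesis
    using formulasD(5)[OF IH[OF D'(1)], of "Suc u"] D(2) D'(2) t m' by auto
qed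

text \<open>Only the constant term of the KLR relation survives. A match of \<open>?\<tau>\<close>
  at t-1 or t+1 would give \<open>up x = x\<close>, hence y_t and y_{t+1} both kill the shorter
  vector.\<close>

lemma y_match_step: "y_match \<sigma>"
  unfolding y_match_def
proof (intro allI impI)
  fix t assume "match \<sigma> t"
  then have t: "t \<in> Leg d k \<sigma>" "Suc t \<in> Arm d k \<sigma>" and eq: "cl \<sigma> t = cl \<sigma> (Suc t)"
    by (auto simp: match_def)
  note D = descentD[OF s t]
  let ?\<tau> = "adj t \<circ> \<sigma>"
  note [simp] = Arm_adj Leg_adj Sh_bij[OF s]
  note A = Leg_not_Arm[OF s t(1)]
  have "\<not> match ?\<tau> (Suc t)"
    using cl_Arm[OF s t(2)] eq up_cl_neq[OF s, of "Suc t"] D(4,5) by (auto simp: match_def)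
  moreover have tA: "\<not> match ?\<tau> t"
    using A Leg_not_Arm[OF s, of "Suc t"] t by (auto simp: match_def)
  ultimately have 1: "y (Suc t) (V ?\<tau>) = \<zero>"
    using formulasD(3)[OF IH[OF D(1,2)], of "Suc t"] D(5) by auto
  have "\<not> match ?\<tau> u" if "t = Suc u" for u
    using cl_Leg[OF s, of u] t eq up_cl_neq[OF s, of "Suc u"] D(4,5) that by (auto simp: match_def)
  then have 2: "y t (V ?\<tau>) = \<zero>"
    using formulasD(3)[OF IH[OF D(1,2)], of t] D(4,5) tA by auto
  have "y t (V \<sigma>) = y t (p t (V ?\<tau>))" "y (Suc t) (V \<sigma>) = y (Suc t) (p t (V ?\<tau>))"
    using D(3) by simp_all
  then show "y t (V \<sigma>) = \<ominus> V ?\<tau> \<and> y (Suc t) (V \<sigma>) = V ?\<tau>"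
    using y_p[OF D(1), of t] y_Suc_p[OF D(1), of t] D(4,5) V_closed[OF D(1)] eq
    by (simp add: 1 2 p_zero a_minus_def)
qed

lemma y_no_match_step: "y_no_match \<sigma>"
  unfolding y_no_match_def
proof (intro ballI impI)
  fix r assume r: "r \<in> {1..d}" and no: "\<not> match \<sigma> r" "\<forall>s. r = Suc s \<longrightarrow> \<not> match \<sigma> s"
  show "y r (V \<sigma>) = \<zero>"
  proof (cases "\<exists>t. t \<in> Leg d k \<sigma> \<and> Suc t \<in> Arm d k \<sigma>")
    case False
    then show ?thesis using Sh_no_descent_imp_id[OF s] y_id[OF r] by blast
  next
    case True
    then obtain t where t: "t \<in> Leg d k \<sigma>" "Suc t \<in> Arm d k \<sigma>" by blast
    note D = descentD[OF s t]
    let ?\<tau> = "adj t \<circ> \<sigma>"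
    have td: "t \<in> {1..<d}" using D(4,5) by simp
    note [simp] = Arm_adj Leg_adj Sh_bij[OF s]
    note F = formulasD[OF IH[OF D(1,2)]]
    have tA: "\<not> match ?\<tau> t"
      using Leg_not_Arm[OF s, of "Suc t"] t by (auto simp: match_def)
    \<comment> \<open>With this and \<open>t0\<close>, moving y_t or y_{t+1} past psi_t leaves just
      the constant term, which is absent because the residues at a descent without a match
      differ.\<close>
    have Suc0: "p t (y (Suc t) (V ?\<tau>)) = \<zero>"
    proof (cases "match ?\<tau> (Suc t)")
      case True
      then have "Suc t \<in> Leg d k ?\<tau>" "Suc (Suc t) \<in> Arm d k ?\<tau>" by (auto simp: match_def)
      note V = V_closed[OF descentD(1)[OF D(1) this]]
      show ?thesis
        using p_match_Suc_eq_zero[OF t True] F(1)[OF True] V td by (simp add: p_minus)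
    next
      case False
      then show ?thesis using F(3)[of "Suc t"] tA td by (simp add: p_zero)
    qed
    have t0: "p t (y t (V ?\<tau>)) = \<zero>"
    proof (cases "\<exists>u. t = Suc u \<and> match ?\<tau> u")
      case True
      then obtain u where u: "t = Suc u" "match ?\<tau> u" by blast
      then show ?thesis using F(2)[of u] p_match_pred_eq_zero[of u] t by simp
    next
      case False
      then show ?thesis using F(3)[of t] tA td by (auto simp: p_zero)
    qed
    consider "r = t" | "r = Suc t" | "r \<noteq> t" "r \<noteq> Suc t" by blast
    then show ?thesis
    proof cases
      case 1
      then have "cl ?\<tau> t \<noteq> cl ?\<tau> (Suc t)" using no(1) t by (auto simp: match_def)
      then show ?thesis
        using y_p[OF D(1) td] Suc0 D(3) 1 by (simp add: a_minus_def)
    next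
      case 2
      then have "cl ?\<tau> t \<noteq> cl ?\<tau> (Suc t)" using no(2) t by (auto simp: match_def)
      then show ?thesis
        using y_Suc_p[OF D(1) td] t0 D(3) 2 by simp
    next
      case 3
      \<comment> \<open>A match of \<open>?\<tau>\<close> at r or r-1 that is not one of \<sigma>
        involves t or t+1; as r is neither of these, r is t-1 or t+2.\<close>
      have "p t (y r (V ?\<tau>)) = \<zero>"
      proof (cases "match ?\<tau> r")
        case True
        then have m: "r \<in> Leg d k ?\<tau>" "Suc r \<in> Arm d k ?\<tau>" by (auto simp: match_def)
        note V = V_closed[OF descentD(1)[OF D(1) m]]
        have "Suc r = t"
        proof (rule ccontr)
          assume "Suc r \<noteq> t"
          then have "match \<sigma> r" using True 3 by (simp add: match_def)
          then show False using no by simp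
        qed
        then show ?thesis
          using p_match_pred_eq_zero[of r] t True F(1)[OF True] V td by (auto simp: p_minus)
      next
        case nm: False
        show ?thesis
        proof (cases "\<exists>q. r = Suc q \<and> match ?\<tau> q")
          case True
          then obtain q where q: "r = Suc q" "match ?\<tau> q" by blast
          have "q = Suc t"
          proof (rule ccontr)
            assume "q \<noteq> Suc t"
            then have "match \<sigma> q" using q 3 by (auto simp: match_def)
            then show False using no q by simp
          qed
          then show ?thesis
            using p_match_Suc_eq_zero[OF t] q F(2)[OF q(2)] by simp
        next
          case False
          then show ?thesis using F(3)[OF r nm] td by (auto simp: p_zero)
        qed
      qed
      then show ?thesis
        using y_p_comm[OF D(1) td r 3] D(3) by simp
    qed
  qed
qed

lemma p_Arm_Arm_step: "p_Arm_Arm \<sigma>"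
  unfolding p_Arm_Arm_def
proof (intro allI impI)
  fix r assume r: "Suc r \<in> Arm d k \<sigma>" "Suc (Suc r) \<in> Arm d k \<sigma>"
  let ?m = "r \<in> Leg d k \<sigma> \<and> cl \<sigma> r = cl \<sigma> (Suc r)"
  note [simp] = Arm_adj Leg_adj Sh_bij[OF s]
  have rd: "1 \<le> r" "Suc (Suc r) \<le> d" using Arm_range[OF s r(1)] Arm_range[OF s r(2)] by auto
  show "p (Suc r) (V \<sigma>) = (if ?m then V (adj (Suc r) \<circ> (adj r \<circ> \<sigma>)) else \<zero>)"
  proof (cases "r \<in> Leg d k \<sigma>")
    case True
    note t = True r(1)
    note D = descentD[OF s t]
    have m1: "Suc r \<in> Leg d k (adj r \<circ> \<sigma>)" "Suc (Suc r) \<in> Arm d k (adj r \<circ> \<sigma>)"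
      using t r by simp_all
    note D' = descentD[OF D(1) m1]
    \<comment> \<open>At \<open>r, r + 1, r + 2\<close> the pattern of \<open>\<sigma>\<close> is leg-arm-arm and that of \<open>\<rho>\<close> is arm-arm-leg;
      hence \<open>\<psi>\<^sub>r\<^sub>+\<^sub>1[\<sigma>] = \<psi>\<^sub>r\<^sub>+\<^sub>1\<psi>\<^sub>r\<psi>\<^sub>r\<^sub>+\<^sub>1[\<rho>]\<close>.\<close>
    define \<rho> where "\<rho> = adj (Suc r) \<circ> (adj r \<circ> \<sigma>)"
    have \<rho>: "\<rho> \<in> Sh d k" "card (inversions d \<rho>) < card (inversions d \<sigma>)"
      using D(2) D'(1,2) by (simp_all add: \<rho>_def)
    have b: "bij \<rho>" by (rule Sh_bij[OF \<rho>(1)])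
    have mem: "r \<in> Arm d k \<rho>" "Suc r \<in> Arm d k \<rho>" "Suc (Suc r) \<in> Leg d k \<rho>"
      using t r by (simp_all add: \<rho>_def)
    have cl: "cl \<rho> r = cl \<sigma> (Suc r)" "cl \<rho> (Suc r) = cl \<sigma> (Suc (Suc r))" "cl \<rho> (Suc (Suc r)) = cl \<sigma> r"
      by (simp_all add: \<rho>_def)
    obtain u where u: "r = Suc u" using rd(1) by (cases r) auto
    \<comment> \<open>One side of the braid relation on [\<rho>] vanishes, which leaves
      psi_{r+1}[\<sigma>] equal to the error term, if there is one.\<close>
    have "p r (p (Suc r) (p r (V \<rho>))) = \<zero>"
    proof (cases "u \<in> Leg d k \<rho> \<and> cl \<rho> u = cl \<rho> r")
      case False
      then have "p r (V \<rho>) = \<zero>"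
        using formulasD(4)[OF IH[OF \<rho>], of u] mem by (auto simp: u)
      then show ?thesis using rd by (simp add: p_zero)
    next
      case True
      define \<rho>' where "\<rho>' = adj u \<circ> \<rho>"
      define \<pi> where "\<pi> = adj r \<circ> \<rho>'"
      have 1: "p r (V \<rho>) = V \<pi>"
        using formulasD(4)[OF IH[OF \<rho>], of u] mem True by (auto simp: u \<pi>_def \<rho>'_def)
      have d1: "u \<in> Leg d k \<rho>" "Suc u \<in> Arm d k \<rho>" using True mem by (simp_all add: u)
      note E1 = descentD[OF \<rho>(1) d1, folded \<rho>'_def]
      have d2: "r \<in> Leg d k \<rho>'" "Suc r \<in> Arm d k \<rho>'" using True mem by (simp_all add: u \<rho>'_def)
      note E2 = descentD[OF E1(1) d2, folded \<pi>_def]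
      have pi: "\<pi> \<in> Sh d k" "card (inversions d \<pi>) < card (inversions d \<sigma>)"
        using E1 E2 \<rho> by simp_all
      have mempi: "u \<in> Arm d k \<pi>" "r \<in> Arm d k \<pi>" "Suc r \<in> Leg d k \<pi>" "Suc (Suc r) \<in> Leg d k \<pi>"
        using True mem b by (simp_all add: u \<rho>'_def \<pi>_def)
      show ?thesis
      proof (cases "Suc (Suc (Suc r)) \<in> Arm d k \<pi> \<and> cl \<pi> (Suc (Suc r)) = cl \<pi> (Suc (Suc (Suc r)))")
        case False
        then have "p (Suc r) (V \<pi>) = \<zero>"
          using formulasD(5)[OF IH[OF pi], of "Suc r"] mempi by auto
        then show ?thesis using rd 1 by (simp add: p_zero)
      next
        case tr: True
        \<comment> \<open>The residues allow this only for \<open>e = 3\<close>.\<close>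
        define \<pi>' where "\<pi>' = adj (Suc (Suc r)) \<circ> \<pi>"
        define \<kappa> where "\<kappa> = adj (Suc r) \<circ> \<pi>'"
        have 2: "p (Suc r) (V \<pi>) = \<ominus> V \<kappa>"
          using formulasD(5)[OF IH[OF pi], of "Suc r"] mempi tr by (auto simp: \<kappa>_def \<pi>'_def)
        have d3: "Suc (Suc r) \<in> Leg d k \<pi>" "Suc (Suc (Suc r)) \<in> Arm d k \<pi>" using tr mempi by simp_all
        note E3 = descentD[OF pi(1) d3, folded \<pi>'_def]
        have d4: "Suc r \<in> Leg d k \<pi>'" "Suc (Suc r) \<in> Arm d k \<pi>'" using tr mempi by (simp_all add: \<pi>'_def)
        note E4 = descentD[OF E3(1) d4, folded \<kappa>_def]
        \<comment> \<open>In \<kappa> the entries r-1, r and r+1 are all in the arm, a pattern on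
          which psi_r vanishes.\<close>
        have "u \<in> Arm d k \<kappa>" "r \<in> Arm d k \<kappa>" "Suc r \<in> Arm d k \<kappa>"
          using tr mempi by (simp_all add: \<kappa>_def \<pi>'_def u)
        then have "p r (V \<kappa>) = \<zero>"
          using formulasD(4)[OF IH[OF E4(1)], of u] E3(2) E4(2) pi(2) Leg_not_Arm[OF E4(1), of u]
          by (auto simp: u)
        then show ?thesis
          using rd 1 2 V_closed[OF E4(1)] by (simp add: p_minus)
      qed
    qed
    note zero = this
    have "V \<sigma> = p r (p (Suc r) (V \<rho>))"
      using D(3) D'(3) by (simp add: \<rho>_def)
    moreover have "cl \<rho> (Suc r) = up (cl \<rho> r)" using cl_Arm[OF \<rho>(1) mem(1,2)] .
    \<comment> \<open>Excludes the branch of the braid relation with +1, which would need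
      \<open>up (up x) = x\<close>.\<close>
    moreover have "cl \<rho> r \<noteq> up (cl \<rho> (Suc r))"
      using calculation(2) up_up_neq[OF \<rho>(1), of r] rd by auto
    moreover have "p (Suc r) (p r (p (Suc r) (V \<rho>))) \<in> carrier M"
      using rd by (intro p_closed V_closed[OF \<rho>(1)]) auto
    ultimately have eq: "\<zero> = (if cl \<sigma> r = cl \<sigma> (Suc r) then p (Suc r) (V \<sigma>) \<ominus> V \<rho> else p (Suc r) (V \<sigma>))"
      and closed: "p (Suc r) (V \<sigma>) \<in> carrier M"
      using braid[OF \<rho>(1) rd] zero by (auto simp: cl)
    show ?thesis
    proof (cases "cl \<sigma> r = cl \<sigma> (Suc r)")
      case True
      then have "p (Suc r) (V \<sigma>) = V \<rho>"
        using eq closed V_closed[OF \<rho>(1)] minus_eq_zero_imp_eq by simp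
      then show ?thesis using True t by (simp add: \<rho>_def)
    next
      case False
      then show ?thesis using eq by simp
    qed
  next
    case F: False
    show ?thesis
    proof (cases "\<exists>t. t \<in> Leg d k \<sigma> \<and> Suc t \<in> Arm d k \<sigma>")
      case False
      then have "\<sigma> = id" using Sh_no_descent_imp_id[OF s] by blast
      then show ?thesis using F r p_Arm_id[of "Suc r"] by (simp add: Arm_id)
    next
      case True
      then obtain t where t: "t \<in> Leg d k \<sigma>" "Suc t \<in> Arm d k \<sigma>" by blast
      note D = descentD[OF s t]
      have td: "t \<in> {1..<d}" using D(4,5) by simp
      let ?\<tau> = "adj t \<circ> \<sigma>"
      \<comment> \<open>As r+1 and r+2 are in the arm and r is not in the leg, no descent lies
        within distance one of r+1.\<close>
      have ne: "t \<noteq> r" "t \<noteq> Suc r" "t \<noteq> Suc (Suc r)"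
        using t F r Leg_not_Arm[OF s] by auto
      then have far: "Suc t < Suc r \<or> Suc (Suc r) < t" by arith
      have "p (Suc r) (V \<sigma>) = p t (p (Suc r) (V ?\<tau>))"
        using p_p_comm[OF D(1) td, of "Suc r"] D(3) far rd by auto
      also have "\<dots> = \<zero>"
      proof (cases "r \<in> Leg d k ?\<tau> \<and> cl ?\<tau> r = cl ?\<tau> (Suc r)")
        case False
        moreover have "Suc r \<in> Arm d k ?\<tau>" "Suc (Suc r) \<in> Arm d k ?\<tau>" using r ne by auto
        ultimately have "p (Suc r) (V ?\<tau>) = \<zero>"
          using formulasD(4)[OF IH[OF D(1,2)], of r] by auto
        then show ?thesis using td by (simp add: p_zero)
      next
        case True
        \<comment> \<open>The entry r is not in the leg of \<sigma>, so the swap at t must have put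
          it there.\<close>
        have rt: "r = Suc t" using True F ne by (cases "r = Suc t") auto
        define \<pi>' where "\<pi>' = adj r \<circ> ?\<tau>"
        define \<pi> where "\<pi> = adj (Suc r) \<circ> \<pi>'"
        have mem: "Suc r \<in> Arm d k ?\<tau>" "Suc (Suc r) \<in> Arm d k ?\<tau>" using r ne by auto
        then have 1: "p (Suc r) (V ?\<tau>) = V \<pi>"
          using formulasD(4)[OF IH[OF D(1,2)], of r] True by (simp add: \<pi>_def \<pi>'_def)
        have d1: "r \<in> Leg d k ?\<tau>" using True by simp
        note E1 = descentD[OF D(1) d1 mem(1), folded \<pi>'_def]
        have d2: "Suc r \<in> Leg d k \<pi>'" "Suc (Suc r) \<in> Arm d k \<pi>'"
          using d1 mem by (simp_all add: \<pi>'_def rt)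
        note E2 = descentD[OF E1(1) d2, folded \<pi>_def]
        obtain u where u: "t = Suc u" using D(4) by (cases t) auto
        have mempi: "t \<in> Arm d k \<pi>" "Suc t \<in> Arm d k \<pi>"
          using t r by (simp_all add: \<pi>_def \<pi>'_def rt)
        \<comment> \<open>One residue step along the leg of \<sigma> and one along its arm would
          give \<open>cl \<sigma> r = up (up (cl \<sigma> r))\<close>.\<close>
        have "\<not> (u \<in> Leg d k \<pi> \<and> cl \<pi> u = cl \<pi> t)"
        proof
          assume a: "u \<in> Leg d k \<pi> \<and> cl \<pi> u = cl \<pi> t"
          then have "u \<in> Leg d k \<sigma>" "cl \<sigma> u = cl \<sigma> r"
            by (simp_all add: \<pi>_def \<pi>'_def rt u)
          moreover have "cl \<sigma> u = up (cl \<sigma> t)"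
            using cl_Leg[OF s \<open>u \<in> Leg d k \<sigma>\<close>] t by (simp add: u)
          moreover have "cl \<sigma> t = cl \<sigma> (Suc r)" using True by (simp add: rt)
          moreover have "cl \<sigma> (Suc r) = up (cl \<sigma> r)" using cl_Arm[OF s] t r by (simp add: rt)
          ultimately show False using up_up_neq[OF s, of r] rd by auto
        qed
        then have "p t (V \<pi>) = \<zero>"
          using formulasD(4)[OF IH[OF E2(1)], of u] E2(2) E1(2) D(2) mempi by (auto simp: u)
        then show ?thesis using 1 by simp
      qed
      finally show ?thesis using F by simp
    qed
  qed
qed

text \<open>Same scheme as for the arm, but the other side of the braid relation vanishes. There
  psi_{r+1}[\<sigma>] stood next to the error term, here psi_r[\<sigma>] is the opposite side,
  whence the sign.\<close>

lemma p_Leg_Leg_step: "p_Leg_Leg \<sigma>"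
  unfolding p_Leg_Leg_def
proof (intro allI impI)
  fix r assume r: "r \<in> Leg d k \<sigma>" "Suc r \<in> Leg d k \<sigma>"
  let ?m = "Suc (Suc r) \<in> Arm d k \<sigma> \<and> cl \<sigma> (Suc r) = cl \<sigma> (Suc (Suc r))"
  note [simp] = Arm_adj Leg_adj Sh_bij[OF s]
  have rd: "2 \<le> r" "Suc r \<le> d" using Leg_range[OF s r(1)] Leg_range[OF s r(2)] by auto
  show "p r (V \<sigma>) = (if ?m then \<ominus> V (adj r \<circ> (adj (Suc r) \<circ> \<sigma>)) else \<zero>)"
  proof (cases "Suc (Suc r) \<in> Arm d k \<sigma>")
    case True
    note t = r(2) True
    have rd': "Suc (Suc r) \<le> d" using Arm_range[OF s True] by simp
    note D = descentD[OF s t]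
    have m1: "r \<in> Leg d k (adj (Suc r) \<circ> \<sigma>)" "Suc r \<in> Arm d k (adj (Suc r) \<circ> \<sigma>)"
      using t r by simp_all
    note D' = descentD[OF D(1) m1]
    \<comment> \<open>At \<open>r, r + 1, r + 2\<close> the pattern of \<open>\<sigma>\<close> is leg-leg-arm and that of \<open>\<rho>\<close> is arm-leg-leg;
      hence \<open>\<psi>\<^sub>r[\<sigma>] = \<psi>\<^sub>r\<psi>\<^sub>r\<^sub>+\<^sub>1\<psi>\<^sub>r[\<rho>]\<close>.\<close>
    define \<rho> where "\<rho> = adj r \<circ> (adj (Suc r) \<circ> \<sigma>)"
    have \<rho>: "\<rho> \<in> Sh d k" "card (inversions d \<rho>) < card (inversions d \<sigma>)"
      using D(2) D'(1,2) by (simp_all add: \<rho>_def)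
    have b: "bij \<rho>" by (rule Sh_bij[OF \<rho>(1)])
    have mem: "r \<in> Arm d k \<rho>" "Suc r \<in> Leg d k \<rho>" "Suc (Suc r) \<in> Leg d k \<rho>"
      using t r by (simp_all add: \<rho>_def)
    have cl: "cl \<rho> r = cl \<sigma> (Suc (Suc r))" "cl \<rho> (Suc r) = cl \<sigma> r" "cl \<rho> (Suc (Suc r)) = cl \<sigma> (Suc r)"
      by (simp_all add: \<rho>_def)
    have "p (Suc r) (p r (p (Suc r) (V \<rho>))) = \<zero>"
    proof (cases "Suc (Suc (Suc r)) \<in> Arm d k \<rho> \<and> cl \<rho> (Suc (Suc r)) = cl \<rho> (Suc (Suc (Suc r)))")
      case False
      then have "p (Suc r) (V \<rho>) = \<zero>"
        using formulasD(5)[OF IH[OF \<rho>], of "Suc r"] mem by auto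
      then show ?thesis using rd rd' by (simp add: p_zero)
    next
      case tr: True
      define \<rho>' where "\<rho>' = adj (Suc (Suc r)) \<circ> \<rho>"
      define \<pi> where "\<pi> = adj (Suc r) \<circ> \<rho>'"
      have 1: "p (Suc r) (V \<rho>) = \<ominus> V \<pi>"
        using formulasD(5)[OF IH[OF \<rho>], of "Suc r"] mem tr by (auto simp: \<pi>_def \<rho>'_def)
      have d1: "Suc (Suc r) \<in> Leg d k \<rho>" "Suc (Suc (Suc r)) \<in> Arm d k \<rho>" using tr mem by simp_all
      note E1 = descentD[OF \<rho>(1) d1, folded \<rho>'_def]
      have d2: "Suc r \<in> Leg d k \<rho>'" "Suc (Suc r) \<in> Arm d k \<rho>'" using tr mem by (simp_all add: \<rho>'_def)
      note E2 = descentD[OF E1(1) d2, folded \<pi>_def]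
      have pi: "\<pi> \<in> Sh d k" "card (inversions d \<pi>) < card (inversions d \<sigma>)"
        using E1 E2 \<rho> by simp_all
      note V1 = V_closed[OF pi(1)]
      obtain u where u: "r = Suc u" using rd(1) by (cases r) auto
      have mempi: "r \<in> Arm d k \<pi>" "Suc r \<in> Arm d k \<pi>" "Suc (Suc r) \<in> Leg d k \<pi>" "Suc (Suc (Suc r)) \<in> Leg d k \<pi>"
        using tr mem b by (simp_all add: \<rho>'_def \<pi>_def)
      have "p (Suc r) (p r (V \<pi>)) = \<zero>"
      proof (cases "u \<in> Leg d k \<pi> \<and> cl \<pi> u = cl \<pi> r")
        case False
        then have "p r (V \<pi>) = \<zero>"
          using formulasD(4)[OF IH[OF pi], of u] mempi by (auto simp: u)
        then show ?thesis using rd rd' by (simp add: p_zero)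
      next
        case True
        \<comment> \<open>The residues allow this only for \<open>e = 3\<close>.\<close>
        define \<pi>' where "\<pi>' = adj u \<circ> \<pi>"
        define \<kappa> where "\<kappa> = adj r \<circ> \<pi>'"
        have 2: "p r (V \<pi>) = V \<kappa>"
          using formulasD(4)[OF IH[OF pi], of u] mempi True by (auto simp: \<kappa>_def \<pi>'_def u)
        have d3: "u \<in> Leg d k \<pi>" "Suc u \<in> Arm d k \<pi>" using True mempi by (simp_all add: u)
        note E3 = descentD[OF pi(1) d3, folded \<pi>'_def]
        have d4: "r \<in> Leg d k \<pi>'" "Suc r \<in> Arm d k \<pi>'" using True mempi by (simp_all add: \<pi>'_def u)
        note E4 = descentD[OF E3(1) d4, folded \<kappa>_def]
        \<comment> \<open>In \<kappa> the entries r+1, r+2 and r+3 are all in the leg, a pattern on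
          which psi_{r+1} vanishes.\<close>
        have "Suc r \<in> Leg d k \<kappa>" "Suc (Suc r) \<in> Leg d k \<kappa>" "Suc (Suc (Suc r)) \<in> Leg d k \<kappa>"
          using True mempi by (simp_all add: \<kappa>_def \<pi>'_def u)
        then have "p (Suc r) (V \<kappa>) = \<zero>"
          using formulasD(5)[OF IH[OF E4(1)], of "Suc r"] E3(2) E4(2) pi(2)
            Leg_not_Arm[OF E4(1), of "Suc (Suc (Suc r))"] by auto
        then show ?thesis using 2 by simp
      qed
      then show ?thesis
        using 1 V1 rd rd' p_closed[OF _ V1, of r] by (simp add: p_minus)
    qed
    note zero = this
    have "V \<sigma> = p (Suc r) (p r (V \<rho>))"
      using D(3) D'(3) by (simp add: \<rho>_def)
    moreover have up: "cl \<rho> (Suc r) = up (cl \<rho> (Suc (Suc r)))" using cl_Leg[OF \<rho>(1) mem(2,3)] .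
    moreover have "\<not> (cl \<rho> (Suc (Suc r)) = cl \<rho> r \<and> cl \<rho> r = up (cl \<rho> (Suc r)))"
      using up up_up_neq[OF \<rho>(1), of "Suc (Suc r)"] rd' by auto
    ultimately have "p r (V \<sigma>) = (if cl \<sigma> (Suc r) = cl \<sigma> (Suc (Suc r)) then \<zero> \<ominus> V \<rho> else \<zero>)"
      using braid[OF \<rho>(1) _ rd'] zero rd by (auto simp: cl)
    then show ?thesis
      using t V_closed[OF \<rho>(1)] by (simp add: \<rho>_def a_minus_def)
  next
    case F: False
    show ?thesis
    proof (cases "\<exists>t. t \<in> Leg d k \<sigma> \<and> Suc t \<in> Arm d k \<sigma>")
      case False
      then have "\<sigma> = id" using Sh_no_descent_imp_id[OF s] by blast
      then show ?thesis using F r p_Leg_id[of r] by (simp add: Leg_id)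
    next
      case True
      then obtain t where t: "t \<in> Leg d k \<sigma>" "Suc t \<in> Arm d k \<sigma>" by blast
      note D = descentD[OF s t]
      have td: "t \<in> {1..<d}" using D(4,5) by simp
      let ?\<tau> = "adj t \<circ> \<sigma>"
      have ne: "t \<noteq> r" "t \<noteq> Suc r" "Suc t \<noteq> r"
        using t F r Leg_not_Arm[OF s] by auto
      then have far: "Suc t < r \<or> Suc r < t" by arith
      have "p r (V \<sigma>) = p t (p r (V ?\<tau>))"
        using p_p_comm[OF D(1) td, of r] D(3) far rd by auto
      also have "\<dots> = \<zero>"
      proof (cases "Suc (Suc r) \<in> Arm d k ?\<tau> \<and> cl ?\<tau> (Suc r) = cl ?\<tau> (Suc (Suc r))")
        case False
        moreover have "r \<in> Leg d k ?\<tau>" "Suc r \<in> Leg d k ?\<tau>" using r ne by auto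
        ultimately have "p r (V ?\<tau>) = \<zero>"
          using formulasD(5)[OF IH[OF D(1,2)], of r] by auto
        then show ?thesis using td by (simp add: p_zero)
      next
        case True
        \<comment> \<open>The entry r+2 is not in the arm of \<sigma>, so the swap at t must have
          put it there.\<close>
        have rt: "t = Suc (Suc r)" using True F ne by (cases "t = Suc (Suc r)") auto
        define \<pi>' where "\<pi>' = adj (Suc r) \<circ> ?\<tau>"
        define \<pi> where "\<pi> = adj r \<circ> \<pi>'"
        have mem: "r \<in> Leg d k ?\<tau>" "Suc r \<in> Leg d k ?\<tau>" using r ne by auto
        then have 1: "p r (V ?\<tau>) = \<ominus> V \<pi>"
          using formulasD(5)[OF IH[OF D(1,2)], of r] True by (simp add: \<pi>_def \<pi>'_def)
        have d1: "Suc (Suc r) \<in> Arm d k ?\<tau>" using True by simp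
        note E1 = descentD[OF D(1) mem(2) d1, folded \<pi>'_def]
        have d2: "r \<in> Leg d k \<pi>'" "Suc r \<in> Arm d k \<pi>'"
          using d1 mem by (simp_all add: \<pi>'_def rt)
        note E2 = descentD[OF E1(1) d2, folded \<pi>_def]
        have mempi: "t \<in> Leg d k \<pi>" "Suc t \<in> Leg d k \<pi>"
          using t r by (simp_all add: \<pi>_def \<pi>'_def rt)
        have "\<not> (Suc (Suc t) \<in> Arm d k \<pi> \<and> cl \<pi> (Suc t) = cl \<pi> (Suc (Suc t)))"
        proof
          assume a: "Suc (Suc t) \<in> Arm d k \<pi> \<and> cl \<pi> (Suc t) = cl \<pi> (Suc (Suc t))"
          then have "Suc (Suc t) \<in> Arm d k \<sigma>" "cl \<sigma> t = cl \<sigma> (Suc (Suc t))"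
            by (simp_all add: \<pi>_def \<pi>'_def rt)
          moreover have "cl \<sigma> (Suc (Suc t)) = up (cl \<sigma> (Suc t))"
            using cl_Arm[OF s t(2) \<open>Suc (Suc t) \<in> Arm d k \<sigma>\<close>] .
          moreover have "cl \<sigma> (Suc r) = cl \<sigma> (Suc t)" using True by (simp add: rt)
          moreover have "cl \<sigma> (Suc r) = up (cl \<sigma> t)" using cl_Leg[OF s] t r by (simp add: rt)
          ultimately show False using up_up_neq[OF s, of t] D(4,5) by auto
        qed
        then have "p t (V \<pi>) = \<zero>"
          using formulasD(5)[OF IH[OF E2(1)], of t] E2(2) E1(2) D(2) mempi by auto
        then show ?thesis using 1 td V_closed[OF E2(1)] by (simp add: p_minus)
      qed
      finally show ?thesis using F by simp
    qed
  qed
qed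

end

section \<open>The formulas for all shuffles and the remaining values of psi\<close>

lemma formulas_Sh: "\<sigma> \<in> Sh d k \<Longrightarrow> formulas \<sigma>"
proof (induction "card (inversions d \<sigma>)" arbitrary: \<sigma> rule: less_induct)
  case less
  note step = y_match_step y_no_match_step p_Arm_Arm_step p_Leg_Leg_step
  have IH: "formulas \<tau>" if "\<tau> \<in> Sh d k" "card (inversions d \<tau>) < card (inversions d \<sigma>)" for \<tau>
    by (rule less.hyps) (use that in auto)
  show ?case
    unfolding formulas_def using step[OF less.prems IH] by blast
qed

text \<open>For the shorter shuffle, y_{t+1} survives only through a match at t+1 and y_t only
  through one at t-1. One residue step along the arm or the leg turns these matches into the
  conditions that t+2 is in the arm or t-1 in the leg.\<close>

lemma p_Leg_Arm:
  assumes s: "\<sigma> \<in> Sh d k" and t: "t \<in> Leg d k \<sigma>" "Suc t \<in> Arm d k \<sigma>"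
  shows "p t (V \<sigma>) =
    (if cl \<sigma> t = cl \<sigma> (Suc t) then \<zero>
     else if cl \<sigma> t = up (cl \<sigma> (Suc t))
       then (if Suc (Suc t) \<in> Arm d k \<sigma> then V (adj (Suc t) \<circ> (adj t \<circ> \<sigma>)) else \<zero>)
     else if cl \<sigma> (Suc t) = up (cl \<sigma> t)
       then (if t - 1 \<in> Leg d k \<sigma> then \<ominus> V (adj (t - 1) \<circ> (adj t \<circ> \<sigma>)) else \<zero>)
     else V (adj t \<circ> \<sigma>))"
proof -
  note D = descentD[OF s t]
  let ?\<tau> = "adj t \<circ> \<sigma>"
  have td: "t \<in> {1..<d}" using D(4,5) by simp
  note [simp] = Arm_adj Leg_adj Sh_bij[OF s]
  note F = formulasD[OF formulas_Sh[OF D(1)]]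
  obtain u where u: "t = Suc u" using D(4) by (cases t) auto
  have tA: "\<not> match ?\<tau> t"
    using Leg_not_Arm[OF s, of "Suc t"] t by (auto simp: match_def)
  have mSuc: "match ?\<tau> (Suc t) \<longleftrightarrow> Suc (Suc t) \<in> Arm d k \<sigma> \<and> cl \<sigma> t = cl \<sigma> (Suc (Suc t))"
    using t by (auto simp: match_def)
  have mu: "match ?\<tau> u \<longleftrightarrow> u \<in> Leg d k \<sigma> \<and> cl \<sigma> u = cl \<sigma> (Suc t)"
    using t by (auto simp: match_def u)
  have ySuc: "y (Suc t) (V ?\<tau>) = (if match ?\<tau> (Suc t) then \<ominus> V (adj (Suc t) \<circ> ?\<tau>) else \<zero>)"
    using F(1)[of "Suc t"] F(3)[of "Suc t"] tA td by auto
  have yt: "y t (V ?\<tau>) = (if match ?\<tau> u then V (adj u \<circ> ?\<tau>) else \<zero>)"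
    using F(2)[of u] F(3)[of t] tA td by (auto simp: u)
  have clSuc: "Suc (Suc t) \<in> Arm d k \<sigma> \<Longrightarrow> cl \<sigma> (Suc (Suc t)) = up (cl \<sigma> (Suc t))"
    using cl_Arm[OF s t(2)] .
  have clu: "u \<in> Leg d k \<sigma> \<Longrightarrow> cl \<sigma> u = up (cl \<sigma> t)"
    using cl_Leg[OF s, of u] t by (simp add: u)
  have closed: "match ?\<tau> (Suc t) \<Longrightarrow> V (adj (Suc t) \<circ> ?\<tau>) \<in> carrier M"
     "match ?\<tau> u \<Longrightarrow> V (adj u \<circ> ?\<tau>) \<in> carrier M"
    using V_closed[OF descentD(1)[OF D(1)]] by (auto simp: match_def)
  have eq: "p t (V \<sigma>) = p t (p t (V ?\<tau>))" using D(3) by simp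
  note neq = up_up_neq[OF s, of t] up_up_neq[OF s, of "Suc t"] up_cl_neq[OF s, of t]
  show ?thesis
  proof (cases "cl \<sigma> t = cl \<sigma> (Suc t)")
    case True
    then show ?thesis using eq p_p[OF D(1) td] by simp
  next
    case ne: False
    show ?thesis
    proof (cases "cl \<sigma> t = up (cl \<sigma> (Suc t))")
      case True
      then have nn: "cl \<sigma> (Suc t) \<noteq> up (cl \<sigma> t)" "\<not> match ?\<tau> u" using neq clu mu td by auto
      \<comment> \<open>The swap exchanges the residues at t and t+1, so for \<open>?\<tau>\<close>
        the opposite branch of psi_t^2 applies.\<close>
      have "p t (V \<sigma>) = y t (V ?\<tau>) \<ominus> y (Suc t) (V ?\<tau>)"
        using eq p_p[OF D(1) td] ne nn True by auto
      moreover have "match ?\<tau> (Suc t) \<longleftrightarrow> Suc (Suc t) \<in> Arm d k \<sigma>" using mSuc clSuc True by auto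
      ultimately show ?thesis
        using ySuc yt nn ne True closed by (auto simp: a_minus_def)
    next
      case nup: False
      show ?thesis
      proof (cases "cl \<sigma> (Suc t) = up (cl \<sigma> t)")
        case True
        then have nn: "\<not> match ?\<tau> (Suc t)" using neq clSuc mSuc td by auto
        have "p t (V \<sigma>) = y (Suc t) (V ?\<tau>) \<ominus> y t (V ?\<tau>)"
          using eq p_p[OF D(1) td] ne nup True by auto
        moreover have "match ?\<tau> u \<longleftrightarrow> u \<in> Leg d k \<sigma>" using mu clu True by auto
        ultimately show ?thesis
          using ySuc yt nn ne True nup closed by (auto simp: a_minus_def u)
      next
        case False
        then show ?thesis using eq p_p[OF D(1) td] ne nup by auto
      qed
    qed
  qed
qed

lemma y_V:
  assumes s: "\<sigma> \<in> Sh d k" and r: "r \<in> {1..d}"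
  shows "y r (V \<sigma>) =
    (if c \<sigma> r = c \<sigma> (r + 1) \<and> r \<in> Leg d k \<sigma> \<and> r + 1 \<in> Arm d k \<sigma> then \<ominus> V (adj r \<circ> \<sigma>)
     else if c \<sigma> (r - 1) = c \<sigma> r \<and> r - 1 \<in> Leg d k \<sigma> \<and> r \<in> Arm d k \<sigma> then V (adj (r - 1) \<circ> \<sigma>)
     else \<zero>)"
proof -
  note F = formulasD[OF formulas_Sh[OF s]]
  obtain u where u: "r = Suc u" using r by (cases r) auto
  \<comment> \<open>Outside {1..d} the sequence \<open>c \<sigma>\<close> is
    \<open>undefined\<close>; the arm condition on r+1 rules out d+1, and the leg condition on r-1
    rules out 0.\<close>
  have m1: "match \<sigma> r \<longleftrightarrow> c \<sigma> r = c \<sigma> (r + 1) \<and> r \<in> Leg d k \<sigma> \<and> r + 1 \<in> Arm d k \<sigma>"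
    using r Arm_range[OF s, of "r + 1"] c_eq_cl[of r \<sigma>] c_eq_cl[of "r + 1" \<sigma>] by (auto simp: match_def)
  have m2: "match \<sigma> u \<longleftrightarrow> c \<sigma> (r - 1) = c \<sigma> r \<and> r - 1 \<in> Leg d k \<sigma> \<and> r \<in> Arm d k \<sigma>"
    using r Leg_range[OF s, of u] c_eq_cl[of r \<sigma>] c_eq_cl[of u \<sigma>] by (auto simp: match_def u)
  show ?thesis
    unfolding m1[symmetric] m2[symmetric] using F(1)[of r] F(2)[of u] F(3)[OF r] by (auto simp: u)
qed

lemma p_V_all:
  assumes s: "\<sigma> \<in> Sh d k" and r: "r \<in> {2..d - 1}"
  shows "p r (V \<sigma>) =
    (if r \<in> Arm d k \<sigma> \<and> r + 1 \<in> Leg d k \<sigma> \<or>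
        c \<sigma> (r + 1) \<notin> {c \<sigma> r, (c \<sigma> r + 1) mod int e, (c \<sigma> r - 1) mod int e}
       then V (adj r \<circ> \<sigma>)
     else if r \<in> Leg d k \<sigma> \<and> r + 1 \<in> Arm d k \<sigma> \<and> r + 2 \<in> Arm d k \<sigma> \<and> arrow e (c \<sigma> r) (c \<sigma> (r + 1))
       then V (adj (r + 1) \<circ> adj r \<circ> \<sigma>)
     else if r - 1 \<in> Leg d k \<sigma> \<and> r \<in> Leg d k \<sigma> \<and> r + 1 \<in> Arm d k \<sigma> \<and> arrow e (c \<sigma> (r + 1)) (c \<sigma> r)
       then \<ominus> V (adj (r - 1) \<circ> adj r \<circ> \<sigma>)
     else if r - 1 \<in> Leg d k \<sigma> \<and> r \<in> Arm d k \<sigma> \<and> r + 1 \<in> Arm d k \<sigma> \<and> c \<sigma> r = c \<sigma> (r - 1)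
       then V (adj r \<circ> adj (r - 1) \<circ> \<sigma>)
     else if r \<in> Leg d k \<sigma> \<and> r + 1 \<in> Leg d k \<sigma> \<and> r + 2 \<in> Arm d k \<sigma> \<and> c \<sigma> (r + 1) = c \<sigma> (r + 2)
       then \<ominus> V (adj r \<circ> adj (r + 1) \<circ> \<sigma>)
     else \<zero>)" (is "_ = ?rhs")
proof -
  note F = formulasD[OF formulas_Sh[OF s]]
  obtain u where u: "r = Suc u" "1 \<le> u" using r by (cases r) auto
  have rd: "r \<in> {1..d}" "r + 1 \<in> {1..d}" "u \<in> {1..d}" using r u by auto
  have c: "c \<sigma> r = cl \<sigma> r" "c \<sigma> (r + 1) = cl \<sigma> (r + 1)" "c \<sigma> u = cl \<sigma> u"
    using rd c_eq_cl by auto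
  have c2: "r + 2 \<in> Arm d k \<sigma> \<Longrightarrow> c \<sigma> (r + 2) = cl \<sigma> (r + 2)"
    using Arm_range[OF s, of "r + 2"] c_eq_cl[of "r + 2"] by auto
  have arrow: "arrow e (c \<sigma> r) (c \<sigma> (r + 1)) \<longleftrightarrow> cl \<sigma> r = up (cl \<sigma> (r + 1))"
    "arrow e (c \<sigma> (r + 1)) (c \<sigma> r) \<longleftrightarrow> cl \<sigma> (r + 1) = up (cl \<sigma> r)"
    unfolding c using cl_range[OF s rd(1)] cl_range[OF s rd(2)] by (simp_all add: arrow_iff)
  \<comment> \<open>The excluded residue \<open>(c \<sigma> r - 1) mod int e\<close> is an arrow
    condition, which \<open>arrow(1)\<close> turns into an equation in \<open>up\<close>.\<close>
  have far: "c \<sigma> (r + 1) \<notin> {c \<sigma> r, (c \<sigma> r + 1) mod int e, (c \<sigma> r - 1) mod int e} \<longleftrightarrow>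
      cl \<sigma> r \<noteq> cl \<sigma> (r + 1) \<and> cl \<sigma> (r + 1) \<noteq> up (cl \<sigma> r) \<and> cl \<sigma> r \<noteq> up (cl \<sigma> (r + 1))"
    using arrow(1) unfolding arrow_def c up_def by auto
  have excl: "x \<in> Leg d k \<sigma> \<Longrightarrow> x \<notin> Arm d k \<sigma>" for x
    by (rule Leg_not_Arm[OF s])
  have cover: "r \<in> Leg d k \<sigma> \<longleftrightarrow> r \<notin> Arm d k \<sigma>" "r + 1 \<in> Leg d k \<sigma> \<longleftrightarrow> r + 1 \<notin> Arm d k \<sigma>"
    using Leg_iff_not_Arm[OF s] r by auto
  have neq: "up (up (cl \<sigma> r)) \<noteq> cl \<sigma> r" "up (up (cl \<sigma> (Suc r))) \<noteq> cl \<sigma> (Suc r)"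
    "up (cl \<sigma> r) \<noteq> cl \<sigma> r" "up (cl \<sigma> (Suc r)) \<noteq> cl \<sigma> (Suc r)"
    using up_up_neq[OF s] up_cl_neq[OF s] rd by auto
  consider "r \<in> Arm d k \<sigma>" "r + 1 \<in> Leg d k \<sigma>" | "r \<in> Leg d k \<sigma>" "r + 1 \<in> Arm d k \<sigma>"
    | "r \<in> Arm d k \<sigma>" "r + 1 \<in> Arm d k \<sigma>" | "r \<in> Leg d k \<sigma>" "r + 1 \<in> Leg d k \<sigma>"
    using cover by blast
  then show ?thesis
  proof cases
    case 1
    then show ?thesis using p_V[OF s] by simp
  next
    case 2
    have na: "r \<notin> Arm d k \<sigma>" "r + 1 \<notin> Leg d k \<sigma>" using 2 excl by auto
    have "p r (V \<sigma>) = (if cl \<sigma> r = cl \<sigma> (r + 1) then \<zero>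
     else if cl \<sigma> r = up (cl \<sigma> (r + 1))
       then (if r + 2 \<in> Arm d k \<sigma> then V (adj (r + 1) \<circ> adj r \<circ> \<sigma>) else \<zero>)
     else if cl \<sigma> (r + 1) = up (cl \<sigma> r)
       then (if r - 1 \<in> Leg d k \<sigma> then \<ominus> V (adj (r - 1) \<circ> adj r \<circ> \<sigma>) else \<zero>)
     else V (adj r \<circ> \<sigma>))"
      using p_Leg_Arm[OF s 2(1)] 2(2) by (simp add: o_assoc)
    then show ?thesis
      unfolding far arrow using 2 na neq by (simp split: if_split)
  next
    case 3
    \<comment> \<open>Neighbouring arm residues differ by one, so the clause for distant residues
      cannot apply.\<close>
    have up: "cl \<sigma> (r + 1) = up (cl \<sigma> r)" using cl_Arm[OF s, of r] 3 by simp
    have nl: "r \<notin> Leg d k \<sigma>" "r + 1 \<notin> Leg d k \<sigma>" using 3 excl by auto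
    have "p r (V \<sigma>) = (if u \<in> Leg d k \<sigma> \<and> cl \<sigma> u = cl \<sigma> r then V (adj r \<circ> adj u \<circ> \<sigma>) else \<zero>)"
      using F(4)[of u] 3 by (simp add: u o_assoc)
    moreover have "r - 1 = u" using u by simp
    ultimately show ?thesis
      unfolding far arrow using 3 nl up c by (simp add: eq_commute[of "cl \<sigma> r" "cl \<sigma> u"])
  next
    case 4
    have up: "cl \<sigma> r = up (cl \<sigma> (r + 1))" using cl_Leg[OF s, of r] 4 by simp
    have nl: "r \<notin> Arm d k \<sigma>" "r + 1 \<notin> Arm d k \<sigma>" using 4 excl by auto
    have "p r (V \<sigma>) = (if r + 2 \<in> Arm d k \<sigma> \<and> cl \<sigma> (r + 1) = cl \<sigma> (r + 2)
        then \<ominus> V (adj r \<circ> adj (r + 1) \<circ> \<sigma>) else \<zero>)"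
      using F(5)[of r] 4 by (simp add: o_assoc)
    then show ?thesis
      unfolding far arrow using 4 nl up c(2) c2 by auto
  qed
qed

text \<open>For \<open>j = 2\<close>, the first Garnir relation says that \<open>\<psi>\<^sub>1\<close> kills this vector.\<close>

lemma V_single_descent:
  assumes "\<sigma> \<in> Sh d k" "j \<in> Leg d k \<sigma>" "\<And>r. 2 \<le> r \<Longrightarrow> r < j \<Longrightarrow> r \<in> Arm d k \<sigma>"
    "\<And>t. t \<in> Leg d k \<sigma> \<Longrightarrow> Suc t \<in> Arm d k \<sigma> \<Longrightarrow> t = j"
  shows "j \<le> Suc (d - k) \<and> V \<sigma> = foldr p [j..<Suc (d - k)] (V id)"
  using assms
proof (induction "card (inversions d \<sigma>)" arbitrary: \<sigma> j rule: less_induct)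
  case less
  note s = less.prems(1)
  show ?case
  proof (cases "Suc j \<in> Arm d k \<sigma>")
    case True
    note D = descentD[OF s less.prems(2) True]
    let ?\<tau> = "adj j \<circ> \<sigma>"
    have excl: "x \<in> Leg d k \<sigma> \<Longrightarrow> x \<notin> Arm d k \<sigma>" for x
      by (rule Leg_not_Arm[OF s])
    \<comment> \<open>The swap moves the leg entry up to j+1, the only place where a descent can
      remain. The bound is carried along so that j can be split off the front of the
      interval.\<close>
    have "Suc j \<le> Suc (d - k) \<and> V ?\<tau> = foldr p [Suc j..<Suc (d - k)] (V id)"
    proof (rule less.hyps[OF D(2,1)])
      show "Suc j \<in> Leg d k ?\<tau>" using less.prems(2) by (simp add: Leg_adj)
      show "r \<in> Arm d k ?\<tau>" if "2 \<le> r" "r < Suc j" for r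
        using less.prems(3)[of r] True that by (cases "r = j") (simp_all add: Arm_adj)
      show "t = Suc j" if t: "t \<in> Leg d k ?\<tau>" "Suc t \<in> Arm d k ?\<tau>" for t
      proof (rule ccontr)
        assume ne: "t \<noteq> Suc j"
        have "t \<noteq> j" using t(1) excl True by (auto simp: Leg_adj)
        moreover have "Suc t \<noteq> j"
          using t(1) excl less.prems(3)[of t] Leg_range[OF D(1) t(1)] ne by (auto simp: Leg_adj)
        ultimately show False
          using t ne less.prems(4)[of t] by (simp add: Leg_adj Arm_adj)
      qed
    qed
    then show ?thesis using D(3) upt_conv_Cons[of j "Suc (d - k)"] by (simp del: upt_Suc)
  next
    case False
    then have id: "\<sigma> = id" using less.prems(4) Sh_no_descent_imp_id[OF s] by blast
    then have "d - k < j" using less.prems(2) by (simp add: Leg_id)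
    moreover have "j \<le> Suc (d - k)"
    proof (rule ccontr)
      assume "\<not> ?thesis"
      then have "Suc (d - k) \<in> Arm d k id"
        using less.prems(3)[of "Suc (d - k)"] id kd by (simp add: Suc_le_eq)
      then show False
        unfolding Arm_id by simp
    qed
    ultimately show ?thesis using id by simp
  qed
qed

lemma p_1_V:
  assumes "\<sigma> \<in> Sh d k" "2 \<le> d" shows "p 1 (V \<sigma>) = \<zero>"
  using assms(1)
proof (induction "card (inversions d \<sigma>)" arbitrary: \<sigma> rule: less_induct)
  case less
  note s = less.prems
  show ?case
  proof (cases "\<exists>t. t \<in> Leg d k \<sigma> \<and> Suc t \<in> Arm d k \<sigma>")
    case False
    then have id: "\<sigma> = id" using Sh_no_descent_imp_id[OF s] by blast
    show ?thesis
    proof (cases "d - k = 1")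
      case True
      \<comment> \<open>For d - k = 1 the product in the Garnir relation of the corner node is psi_1
        alone.\<close>
      then show ?thesis using p_Garnir id assms(2) by (simp add: upt_conv_Cons)
    next
      case False
      then show ?thesis using id p_Arm_id[of 1] kd by simp
    qed
  next
    case ex: True
    show ?thesis
    proof (cases "\<exists>t. t \<in> Leg d k \<sigma> \<and> Suc t \<in> Arm d k \<sigma> \<and> t \<noteq> 2")
      case True
      then obtain t where t: "t \<in> Leg d k \<sigma>" "Suc t \<in> Arm d k \<sigma>" "t \<noteq> 2" by blast
      note D = descentD[OF s t(1,2)]
      have "p 1 (V \<sigma>) = p t (p 1 (V (adj t \<circ> \<sigma>)))"
        using D(3-5) t(3) p_p_comm[OF D(1), of t 1] by simp
      then show ?thesis using less.hyps[OF D(2,1)] D(4,5) by (simp add: p_zero)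
    next
      case False
      then have two: "2 \<in> Leg d k \<sigma>" using ex by blast
      have "2 \<le> Suc (d - k) \<and> V \<sigma> = foldr p [2..<Suc (d - k)] (V id)"
        \<comment> \<open>With 2 in the leg no smaller arm entries are asked for.\<close>
        by (rule V_single_descent[OF s two]) (use False in auto)
      moreover have "k > 0" using two Leg_def[of d k \<sigma>] by (cases "k = 0") auto
      moreover have "[1..<Suc (d - k)] = 1 # [2..<Suc (d - k)]"
        using kd upt_conv_Cons[of 1 "Suc (d - k)"] by (simp add: numeral_2_eq_2 del: upt_Suc)
      ultimately show ?thesis
        using p_Garnir by (simp del: upt_Suc)
    qed
  qed
qed

end

section \<open>Modules over KLR algebras\<close>

abbreviation klr_free_algebra :: "nat \<Rightarrow> int multiset \<Rightarrow> 'a::comm_ring_1 klr_free ring" where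
  "klr_free_algebra e \<alpha> \<equiv> free_algebra (klr_gens e \<alpha>)"

lemma perm_seq_res_seqs:
  assumes w: "w permutes {1..size \<alpha>}" and i: "i \<in> res_seqs e \<alpha>"
  shows "perm_seq (size \<alpha>) w i \<in> res_seqs e \<alpha>"
proof -
  let ?X = "{1..size \<alpha>}"
  note q = permutes_inv[OF w]
  have "image_mset (perm_seq (size \<alpha>) w i) (mset_set ?X) = image_mset (i \<circ> pinv w) (mset_set ?X)"
    by (rule image_mset_cong) (simp add: perm_seq_def)
  also have "\<dots> = image_mset i (image_mset (pinv w) (mset_set ?X))"
    by (simp add: multiset.map_comp)
  also have "image_mset (pinv w) (mset_set ?X) = mset_set ?X"
    using image_mset_mset_set[OF permutes_inj_on[OF q], of ?X] permutes_image[OF q] by simp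
  also have "image_mset i (mset_set ?X) = \<alpha>"
    using i by (simp add: res_seqs_def)
  finally have 1: "image_mset (perm_seq (size \<alpha>) w i) (mset_set ?X) = \<alpha>" .
  have "perm_seq (size \<alpha>) w i \<in> ?X \<rightarrow>\<^sub>E {0..<int e}"
  proof (rule PiE_I)
    fix r assume "r \<in> ?X"
    then have "pinv w r \<in> ?X" using permutes_in_image[OF q] by blast
    then show "perm_seq (size \<alpha>) w i r \<in> {0..<int e}"
      using i \<open>r \<in> ?X\<close> PiE_mem[of i ?X "\<lambda>_. {0..<int e}"] by (simp add: res_seqs_def perm_seq_def)
  qed (auto simp: perm_seq_def)
  with 1 show ?thesis by (simp add: res_seqs_def)
qed

lemma finite_res_seqs: "finite (res_seqs e \<alpha>)"
  by (rule finite_subset[of _ "{1..size \<alpha>} \<rightarrow>\<^sub>E {0..<int e}"]) (auto simp: res_seqs_def intro: finite_PiE)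

lemma free_algebra_closed:
  fixes f g :: "'x list \<Rightarrow>\<^sub>0 'a::comm_ring_1"
  shows "f \<in> carrier (free_algebra X) \<Longrightarrow> g \<in> carrier (free_algebra X) \<Longrightarrow> f * g \<in> carrier (free_algebra X)"
    and "f \<in> carrier (free_algebra X) \<Longrightarrow> g \<in> carrier (free_algebra X) \<Longrightarrow> f + g \<in> carrier (free_algebra X)"
    and "f \<in> carrier (free_algebra X) \<Longrightarrow> g \<in> carrier (free_algebra X) \<Longrightarrow> f - g \<in> carrier (free_algebra X)"
    and "1 \<in> carrier (free_algebra X :: ('x list \<Rightarrow>\<^sub>0 'a) ring)"
    and "0 \<in> carrier (free_algebra X :: ('x list \<Rightarrow>\<^sub>0 'a) ring)"
proof -
  interpret ring "free_algebra X :: ('x list \<Rightarrow>\<^sub>0 'a) ring" by (rule free_algebra_ring)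
  show "f \<in> carrier (free_algebra X) \<Longrightarrow> g \<in> carrier (free_algebra X) \<Longrightarrow> f * g \<in> carrier (free_algebra X)"
    using m_closed[of f g] by simp
  show "f \<in> carrier (free_algebra X) \<Longrightarrow> g \<in> carrier (free_algebra X) \<Longrightarrow> f + g \<in> carrier (free_algebra X)"
    using a_closed[of f g] by simp
  show "f \<in> carrier (free_algebra X) \<Longrightarrow> g \<in> carrier (free_algebra X) \<Longrightarrow> f - g \<in> carrier (free_algebra X)"
    using minus_closed[of f g] free_algebra_minus[of f X g] by simp
  show "1 \<in> carrier (free_algebra X :: ('x list \<Rightarrow>\<^sub>0 'a) ring)" using one_closed by simp
  show "0 \<in> carrier (free_algebra X :: ('x list \<Rightarrow>\<^sub>0 'a) ring)" using zero_closed by simp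
qed

lemma free_algebra_sum_closed:
  assumes "finite A" "\<And>x. x \<in> A \<Longrightarrow> f x \<in> carrier (free_algebra X)"
  shows "sum f A \<in> carrier (free_algebra X)"
  using assms by (induction A rule: finite_induct) (simp_all add: free_algebra_closed)

lemma klr_gen_closed:
  "i \<in> res_seqs e \<alpha> \<Longrightarrow> fe i \<in> carrier (klr_free_algebra e \<alpha>)"
  "r \<in> {1..size \<alpha>} \<Longrightarrow> fy r \<in> carrier (klr_free_algebra e \<alpha>)"
  "r \<in> {1..<size \<alpha>} \<Longrightarrow> fpsi r \<in> carrier (klr_free_algebra e \<alpha>)"
  by (auto intro!: gen_closed simp: klr_gens_def)

text \<open>Needed for the relations to generate an ideal. The membership that is not immediate is
  that s_r maps residue sequences of \<alpha> to such sequences.\<close>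

lemma klr_rel_closed:
  assumes "klr_rel e \<alpha> a b"
  shows "a \<in> carrier (klr_free_algebra e \<alpha>) \<and> b \<in> carrier (klr_free_algebra e \<alpha>)"
  using assms
proof cases
  case sum_e
  then show ?thesis
    by (auto intro!: free_algebra_closed free_algebra_sum_closed klr_gen_closed finite_res_seqs)
next
  case (psi_e r i)
  then show ?thesis
    using perm_seq_res_seqs[OF adj_permutes[of r "size \<alpha>"]]
    by (auto intro!: free_algebra_closed klr_gen_closed)
qed (auto intro!: free_algebra_closed klr_gen_closed)

lemma klr_ideal_ideal: "ideal (klr_ideal e \<alpha> :: 'a::comm_ring_1 klr_free set) (klr_free_algebra e \<alpha>)"
proof -
  interpret ring "klr_free_algebra e \<alpha> :: 'a klr_free ring" by (rule free_algebra_ring)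
  show ?thesis
    unfolding klr_ideal_def
    by (rule genideal_ideal) (auto intro!: free_algebra_closed dest: klr_rel_closed)
qed

lemma klr_ring: "ring (klr e \<alpha> :: 'a::comm_ring_1 klr_elt ring)"
  unfolding klr_def by (rule ideal.quotient_is_ring[OF klr_ideal_ideal])

definition klr_proj :: "nat \<Rightarrow> int multiset \<Rightarrow> 'a::comm_ring_1 klr_free \<Rightarrow> 'a klr_elt" where
  "klr_proj e \<alpha> f = klr_ideal e \<alpha> +>\<^bsub>klr_free_algebra e \<alpha>\<^esub> f"

lemma klr_proj_hom: "klr_proj e \<alpha> \<in> ring_hom (klr_free_algebra e \<alpha>) (klr e \<alpha>)"
proof -
  have "klr_proj e \<alpha> = (+>\<^bsub>klr_free_algebra e \<alpha>\<^esub>) (klr_ideal e \<alpha> :: 'a klr_free set)"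
    by (simp add: klr_proj_def fun_eq_iff)
  then show ?thesis
    unfolding klr_def using ideal.rcos_ring_hom[OF klr_ideal_ideal] by simp
qed

lemma klr_proj_closed:
  "f \<in> carrier (klr_free_algebra e \<alpha>) \<Longrightarrow> klr_proj e \<alpha> f \<in> carrier (klr e \<alpha>)"
  by (rule ring_hom_closed[OF klr_proj_hom])

lemma klr_closed:
  "i \<in> res_seqs e \<alpha> \<Longrightarrow> klr_e e \<alpha> i \<in> carrier (klr e \<alpha>)"
  "r \<in> {1..size \<alpha>} \<Longrightarrow> klr_y e \<alpha> r \<in> carrier (klr e \<alpha>)"
  "r \<in> {1..<size \<alpha>} \<Longrightarrow> klr_psi e \<alpha> r \<in> carrier (klr e \<alpha>)"
  using klr_proj_closed klr_gen_closed
  unfolding klr_e_def klr_y_def klr_psi_def klr_of_def klr_proj_def by blast+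

lemma klr_rel_proj:
  assumes "klr_rel e \<alpha> a (b :: 'a::comm_ring_1 klr_free)"
  shows "klr_proj e \<alpha> a = klr_proj e \<alpha> b"
proof -
  let ?F = "klr_free_algebra e \<alpha> :: 'a klr_free ring"
  interpret F: ring ?F by (rule free_algebra_ring)
  interpret ideal "klr_ideal e \<alpha> :: 'a klr_free set" ?F by (rule klr_ideal_ideal)
  have ab: "a \<in> carrier ?F" "b \<in> carrier ?F" using klr_rel_closed[OF assms] by auto
  have "{a - b |a b. klr_rel e \<alpha> a b} \<subseteq> (klr_ideal e \<alpha> :: 'a klr_free set)"
    unfolding klr_ideal_def
    by (rule F.genideal_self) (auto intro!: free_algebra_closed dest: klr_rel_closed)
  then have "a - b \<in> klr_ideal e \<alpha>" using assms by blast
  then have "a \<in> klr_ideal e \<alpha> +>\<^bsub>?F\<^esub> b"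
    by (auto simp: a_r_coset_def' intro!: bexI[of _ "a - b"])
  then show ?thesis
    unfolding klr_proj_def using a_repr_independence' ab by metis
qed


section \<open>KLR relations as identities on weight vectors\<close>

locale klr_module = left_module "klr e \<alpha> :: 'a::comm_ring_1 klr_elt ring" M
  for e \<alpha> and M :: "('a::comm_ring_1 klr_elt, 'b, 'n) module_scheme" (structure)
begin

abbreviation "d \<equiv> size \<alpha>"
abbreviation "F \<equiv> klr_free_algebra e \<alpha> :: 'a klr_free ring"

text \<open>The free algebra acts through its quotient, so a relation can be applied exactly as
  stated and then unfolded letter by letter.\<close>

definition act :: "'a klr_free \<Rightarrow> 'b \<Rightarrow> 'b" where
  "act f x = klr_proj e \<alpha> f \<odot>\<^bsub>M\<^esub> x"

abbreviation "E i \<equiv> (\<odot>\<^bsub>M\<^esub>) (klr_e e \<alpha> i)"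
abbreviation "Y r \<equiv> (\<odot>\<^bsub>M\<^esub>) (klr_y e \<alpha> r)"
abbreviation "P r \<equiv> (\<odot>\<^bsub>M\<^esub>) (klr_psi e \<alpha> r)"

lemma EYP_closed:
  "i \<in> res_seqs e \<alpha> \<Longrightarrow> x \<in> carrier M \<Longrightarrow> E i x \<in> carrier M"
  "r \<in> {1..d} \<Longrightarrow> x \<in> carrier M \<Longrightarrow> Y r x \<in> carrier M"
  "r \<in> {1..<d} \<Longrightarrow> x \<in> carrier M \<Longrightarrow> P r x \<in> carrier M"
  by (simp_all add: smult_closed klr_closed)

lemma act_gen:
  "act (fe i) x = E i x" "act (fy r) x = Y r x" "act (fpsi r) x = P r x"
  by (simp_all add: act_def klr_proj_def klr_e_def klr_y_def klr_psi_def klr_of_def)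

lemma act_simps:
  assumes "x \<in> carrier M"
  shows "f \<in> carrier F \<Longrightarrow> g \<in> carrier F \<Longrightarrow> act (f * g) x = act f (act g x)"
    and "f \<in> carrier F \<Longrightarrow> g \<in> carrier F \<Longrightarrow> act (f + g) x = act f x \<oplus> act g x"
    and "f \<in> carrier F \<Longrightarrow> g \<in> carrier F \<Longrightarrow> act (f - g) x = act f x \<ominus> act g x"
    and "act 1 x = x" and "act 0 x = \<zero>"
proof -
  interpret h: ring_hom_ring F "klr e \<alpha>" "klr_proj e \<alpha>"
    by (intro ring_hom_ringI2 free_algebra_ring klr_ring klr_proj_hom)
  show "act (f * g) x = act f (act g x)" if "f \<in> carrier F" "g \<in> carrier F"
    using h.hom_mult[OF that] smult_assoc[OF klr_proj_closed klr_proj_closed assms] that by (simp add: act_def)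
  show "act (f + g) x = act f x \<oplus> act g x" if "f \<in> carrier F" "g \<in> carrier F"
    using h.hom_add[OF that] smult_l_distr[OF klr_proj_closed klr_proj_closed assms] that by (simp add: act_def)
  show "act (f - g) x = act f x \<ominus> act g x" if fg: "f \<in> carrier F" "g \<in> carrier F"
  proof -
    have "f - g = f \<oplus>\<^bsub>F\<^esub> (\<ominus>\<^bsub>F\<^esub> g)" using fg by (simp add: free_algebra_uminus)
    then have "klr_proj e \<alpha> (f - g) = klr_proj e \<alpha> f \<oplus>\<^bsub>klr e \<alpha>\<^esub> (\<ominus>\<^bsub>klr e \<alpha>\<^esub> klr_proj e \<alpha> g)"
      using fg by (simp only: h.hom_add h.hom_a_inv h.R.a_inv_closed)
    then show ?thesis
      using fg klr_proj_closed[of f] klr_proj_closed[of g] assms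
      by (simp add: act_def smult_l_distr smult_l_minus a_minus_def)
  qed
  show "act 1 x = x" using h.hom_one smult_one[OF assms] by (simp add: act_def)
  show "act 0 x = \<zero>" using h.hom_zero smult_l_null[OF assms] by (simp add: act_def)
qed

lemma act_rel: "klr_rel e \<alpha> f g \<Longrightarrow> act f x = act g x"
  by (simp add: act_def klr_rel_proj)

text \<open>On such vectors an idempotent can be inserted or dropped on the right of a word, which
  makes the relations ending in e(i) applicable.\<close>

definition weight :: "(nat \<Rightarrow> int) \<Rightarrow> 'b \<Rightarrow> bool" where
  "weight i x \<longleftrightarrow> i \<in> res_seqs e \<alpha> \<and> x \<in> carrier M \<and> E i x = x"

lemma weightD: "weight i x \<Longrightarrow> i \<in> res_seqs e \<alpha>" "weight i x \<Longrightarrow> x \<in> carrier M" "weight i x \<Longrightarrow> E i x = x"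
  by (simp_all add: weight_def)

lemmas act_expand = act_simps act_gen EYP_closed free_algebra_closed klr_gen_closed

lemma E_weight:
  assumes x: "weight i x" and j: "j \<in> res_seqs e \<alpha>"
  shows "E j x = (if i = j then x else \<zero>)"
proof -
  have "E j x = E j (E i x)" using x by (simp add: weight_def)
  also have "\<dots> = act (fe j * fe i) x" using weightD[OF x] j by (simp add: act_expand)
  also have "\<dots> = act (if j = i then fe j else 0) x" using weightD[OF x] j by (intro act_rel klr_rel.intros)
  also have "\<dots> = (if i = j then x else \<zero>)" using weightD[OF x] j by (auto simp: act_expand)
  finally show ?thesis .
qed

lemma P_weight:
  assumes x: "weight i x" and r: "r \<in> {1..<d}"
  shows "weight (perm_seq d (adj r) i) (P r x)"
proof -
  have s: "perm_seq d (adj r) i \<in> res_seqs e \<alpha>"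
    using perm_seq_res_seqs[OF adj_permutes[of r d]] r weightD[OF x] by simp
  have "P r x = P r (E i x)" using x by (simp add: weight_def)
  also have "\<dots> = act (fpsi r * fe i) x" using weightD[OF x] r by (simp add: act_expand)
  also have "\<dots> = act (fe (perm_seq d (adj r) i) * fpsi r) x" using weightD[OF x] r by (intro act_rel klr_rel.intros)
  also have "\<dots> = E (perm_seq d (adj r) i) (P r x)" using weightD[OF x] r s by (simp add: act_expand)
  finally show ?thesis using s weightD[OF x] r by (simp add: weight_def EYP_closed)
qed

lemma Y_P_comm:
  assumes "x \<in> carrier M" "r \<in> {1..<d}" "s \<in> {1..d}" "s \<noteq> r" "s \<noteq> Suc r"
  shows "Y s (P r x) = P r (Y s x)"
  using act_rel[OF psi_y[OF assms(2-5)], of x] assms by (simp add: act_expand)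

lemma P_P_comm:
  assumes "x \<in> carrier M" "r \<in> {1..<d}" "s \<in> {1..<d}" "Suc s < r \<or> Suc r < s"
  shows "P r (P s x) = P s (P r x)"
proof -
  have "\<bar>int r - int s\<bar> > 1" using assms(4) by auto
  from act_rel[OF psi_psi[OF assms(2,3) this], of x] assms show ?thesis by (simp add: act_expand)
qed

lemma act_mult_fe:
  assumes "weight i x" "f \<in> carrier F"
  shows "act (f * fe i) x = act f x"
  using assms weightD[OF assms(1)] by (simp add: act_expand)

lemma P_Y_Suc:
  assumes x: "weight i x" and r: "r \<in> {1..<d}"
  shows "P r (Y (Suc r) x) = Y r (P r x) \<oplus> (if i r = i (Suc r) then x else \<zero>)"
proof -
  have r': "r \<in> {1..d}" "Suc r \<in> {1..d}" using r by auto
  show ?thesis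
    using act_rel[OF psi_y_Suc[OF r weightD(1)[OF x]], of x] weightD[OF x] r r'
    by (simp add: act_mult_fe[OF x] act_expand del: mult_cancel_right)
qed

lemma Y_Suc_P:
  assumes x: "weight i x" and r: "r \<in> {1..<d}"
  shows "Y (Suc r) (P r x) = P r (Y r x) \<oplus> (if i r = i (Suc r) then x else \<zero>)"
proof -
  have r': "r \<in> {1..d}" "Suc r \<in> {1..d}" using r by auto
  show ?thesis
    using act_rel[OF y_Suc_psi[OF r weightD(1)[OF x]], of x] weightD[OF x] r r'
    by (simp add: act_mult_fe[OF x] act_expand)
qed

lemma P_P:
  assumes x: "weight i x" and r: "r \<in> {1..<d}"
  shows "P r (P r x) =
    (if i r = i (Suc r) then \<zero>
     else if arrow e (i r) (i (Suc r)) then Y (Suc r) x \<ominus> Y r x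
     else if arrow e (i (Suc r)) (i r) then Y r x \<ominus> Y (Suc r) x
     else x)"
proof -
  have r': "r \<in> {1..d}" "Suc r \<in> {1..d}" using r by auto
  show ?thesis
    using act_rel[OF psi_square[OF r weightD(1)[OF x]], of x] weightD[OF x] r r'
    by (simp add: act_mult_fe[OF x] act_expand)
qed

lemma P_braid:
  assumes x: "weight i x" and r: "1 \<le> r" "r + 2 \<le> d"
  shows "P r (P (Suc r) (P r x)) =
    (if i (r + 2) = i r \<and> arrow e (i r) (i (Suc r)) then P (Suc r) (P r (P (Suc r) x)) \<oplus> x
     else if i (r + 2) = i r \<and> arrow e (i (Suc r)) (i r) then P (Suc r) (P r (P (Suc r) x)) \<ominus> x
     else P (Suc r) (P r (P (Suc r) x)))"
proof -
  have r': "r \<in> {1..<d}" "Suc r \<in> {1..<d}" using r by auto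
  show ?thesis
    using act_rel[OF braid[OF r weightD(1)[OF x]], of x] weightD[OF x] r'
    by (simp add: act_mult_fe[OF x] act_expand)
qed

end

section \<open>Words of hook shuffles and of Garnir tableaux\<close>

context hook_shape
begin

text \<open>Shuffles are fully commutative: commuting generators may be exchanged in the induction
  because two distinct descents of a shuffle are never adjacent.\<close>

lemma reduced_words_Sh_act_eq:
  fixes p :: "nat \<Rightarrow> 'm \<Rightarrow> 'm"
  assumes closed: "\<And>r x. r \<in> {1..<d} \<Longrightarrow> x \<in> X \<Longrightarrow> p r x \<in> X"
    and comm: "\<And>r t x. \<lbrakk>r \<in> {1..<d}; t \<in> {1..<d}; Suc t < r \<or> Suc r < t; x \<in> X\<rbrakk> \<Longrightarrow> p r (p t x) = p t (p r x)"
    and z: "z \<in> X"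
  shows "\<lbrakk>\<sigma> \<in> Sh d k; reduced_expr adj {1..<d} \<sigma> rs; reduced_expr adj {1..<d} \<sigma> rs'\<rbrakk>
    \<Longrightarrow> foldr p rs z = foldr p rs' z"
proof (induction rs arbitrary: \<sigma> rs' rule: length_induct)
  case (1 rs)
  note s = \<open>\<sigma> \<in> Sh d k\<close>
  note perm = Sh_permutes[OF s]
  have len: "length rs = length rs'"
    using 1(3,4) unfolding reduced_expr_adj_iff[OF perm] by simp
  show ?case
  proof (cases rs)
    case Nil
    then show ?thesis using len by simp
  next
    case (Cons r u)
    then obtain t v where v: "rs' = t # v" using len by (cases rs') auto
    note R = reduced_expr_adj_Cons[OF perm 1(3)[unfolded Cons]]
    note T = reduced_expr_adj_Cons[OF perm 1(4)[unfolded v]]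
    have r: "1 \<le> r" "r < d" and t: "1 \<le> t" "t < d" using R(1) T(1) by auto
    note r' = Sh_descent[OF s r R(2)] and t' = Sh_descent[OF s t T(2)]
    have sr: "adj r \<circ> \<sigma> \<in> Sh d k" using Sh_swap[OF s] r' by blast
    have st: "adj t \<circ> \<sigma> \<in> Sh d k" using Sh_swap[OF s] t' by blast
    have IH: "foldr p w z = foldr p w' z"
      if "length w < length rs" "\<tau> \<in> Sh d k" "reduced_expr adj {1..<d} \<tau> w" "reduced_expr adj {1..<d} \<tau> w'" for w w' \<tau>
      using 1(1) that by blast
    show ?thesis
    proof (cases "r = t")
      case True
      then show ?thesis using IH[of u "adj r \<circ> \<sigma>" v] sr R(3) T(3) Cons v by simp
    next
      case False
      have ne: "t \<noteq> Suc r" "r \<noteq> Suc t" using r' t' Leg_not_Arm[OF s] by auto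
      then have far: "Suc t < r \<or> Suc r < t" using False by arith
      let ?\<tau> = "adj t \<circ> (adj r \<circ> \<sigma>)"
      have swap: "?\<tau> = adj r \<circ> (adj t \<circ> \<sigma>)"
        using adj_comm[of r t] ne False by (metis comp_assoc)
      have tr: "t \<in> Leg d k (adj r \<circ> \<sigma>)" "Suc t \<in> Arm d k (adj r \<circ> \<sigma>)"
        using t' ne False by (simp_all add: Arm_adj Leg_adj)
      have rt: "r \<in> Leg d k (adj t \<circ> \<sigma>)" "Suc r \<in> Arm d k (adj t \<circ> \<sigma>)"
        using r' ne False by (simp_all add: Arm_adj Leg_adj)
      have tau: "?\<tau> \<in> Sh d k" using Sh_swap[OF sr] tr by blast
      \<comment> \<open>Diamond argument: \<open>?\<tau>\<close> lies below both shuffles, and a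
        reduced word \<open>w\<close> of it gives t w and r w to compare with the two tails.\<close>
      obtain w where w: "reduced_expr adj {1..<d} ?\<tau> w"
        using ex_word_card_inversions[OF Sh_permutes[OF tau]] reduced_expr_adj_iff[OF Sh_permutes[OF tau]]
        by blast
      have tw: "reduced_expr adj {1..<d} (adj r \<circ> \<sigma>) (t # w)"
        using reduced_expr_adj_ConsI[OF Sh_permutes[OF sr] w t] pinv_gr[OF sr tr] by blast
      have rw: "reduced_expr adj {1..<d} (adj t \<circ> \<sigma>) (r # w)"
        using reduced_expr_adj_ConsI[OF Sh_permutes[OF st] w[unfolded swap] r] pinv_gr[OF st rt] by blast
      have wX: "foldr p w z \<in> X"
      proof -
        have "set w \<subseteq> {1..<d}" using w by (simp add: reduced_expr_def)
        then show ?thesis by (induction w) (auto simp: z closed)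
      qed
      have "foldr p rs z = p r (foldr p u z)" by (simp add: Cons)
      also have "foldr p u z = foldr p (t # w) z"
        using IH[OF _ sr R(3) tw] Cons by simp
      also have "p r (foldr p (t # w) z) = p t (foldr p (r # w) z)"
        using comm[OF R(1) T(1) far wX] by simp
      also have "foldr p (r # w) z = foldr p v z"
        using IH[OF _ st T(3) rw] v len by simp
      finally show ?thesis by (simp add: v)
    qed
  qed
qed

end

text \<open>A cycle moving m+n down to m. The Garnir tableaux of a hook differ from the initial
  tableau by such cycles.\<close>

lemma word_prod_adj_upt:
  "word_prod adj [m..<m + n] x = (if x = m + n then m else if m \<le> x \<and> x < m + n then Suc x else x)"
proof (induction n arbitrary: x)
  case (Suc n)
  have "word_prod adj [m..<m + Suc n] x = word_prod adj [m..<m + n] (adj (m + n) x)"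
    by (simp add: word_prod_append word_prod_simps)
  also have "\<dots> = (if x = m + Suc n then m else if m \<le> x \<and> x < m + Suc n then Suc x else x)"
  proof -
    consider "x = m + n" | "x = Suc (m + n)" | "x \<noteq> m + n" "x \<noteq> Suc (m + n)" by blast
    then show ?thesis by cases (simp_all add: Suc.IH)
  qed
  finally show ?case .
qed (simp add: word_prod_simps)

text \<open>The only left descent of the cycle is m, and removing it leaves the cycle on the next
  interval. Hence any choice of reduced words picks this one.\<close>

lemma reduced_word_upt_unique:
  assumes "1 \<le> m" "m + n \<le> d" "reduced_expr adj {1..<d} (word_prod adj [m..<m + n]) rs"
  shows "rs = [m..<m + n]"
  using assms
proof (induction n arbitrary: m rs)
  case 0
  have nil: "[m..<m + 0] = []" by simp
  from 0(3) show ?case unfolding nil word_prod_simps reduced_expr_id .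
next
  case (Suc n)
  let ?w = "word_prod adj [m..<m + Suc n]"
  have w: "?w permutes {1..d}"
    using Suc.prems by (intro word_prod_adj_permutes) auto
  note val = word_prod_adj_upt[of m "Suc n"]
  have "?w (m + Suc n) \<noteq> m + Suc n" by (subst val) simp
  then have "rs \<noteq> []"
    using Suc.prems(3) by (auto simp: reduced_expr_def word_prod_simps)
  then obtain r u where rs: "rs = r # u" by (cases rs) auto
  note R = reduced_expr_adj_Cons[OF w Suc.prems(3)[unfolded rs]]
  have inv: "pinv ?w x = (if x = m then m + Suc n else if m < x \<and> x \<le> m + Suc n then x - 1 else x)" for x
    by (rule permutes_inv_eq[OF w, THEN iffD2], subst val) auto
  have "r = m"
    using R(2) unfolding inv by (auto split: if_splits)
  have "[m..<m + Suc n] = m # [Suc m..<Suc m + n]"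
    by (simp add: upt_conv_Cons del: upt_Suc)
  then have tail: "adj m \<circ> ?w = word_prod adj [Suc m..<Suc m + n]"
    by (simp only: word_prod_simps adj_comp_adj)
  have "u = [Suc m..<Suc m + n]"
    by (rule Suc.IH) (use Suc.prems R(3) \<open>r = m\<close> tail in simp_all)
  then show ?case
    using rs \<open>r = m\<close> by (simp add: upt_conv_Cons del: upt_Suc)
qed


text \<open>For j <= e the transpositions are disjoint, so the product exchanges two blocks of
  length j; for j = e these are consecutive bricks.\<close>

lemma word_prod_transpose_shift:
  assumes "j \<le> e"
  shows "word_prod (\<lambda>z. transpose z (z + e)) [m..<m + j] x =
    (if m \<le> x \<and> x < m + j then x + e else if m + e \<le> x \<and> x < m + e + j then x - e else x)"
  using assms
proof (induction j arbitrary: x)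
  case (Suc j)
  have "word_prod (\<lambda>z. transpose z (z + e)) [m..<m + Suc j] x =
      word_prod (\<lambda>z. transpose z (z + e)) [m..<m + j] (transpose (m + j) (m + j + e) x)"
    by (simp add: word_prod_append word_prod_simps)
  also have "\<dots> = (if m \<le> x \<and> x < m + Suc j then x + e
      else if m + e \<le> x \<and> x < m + e + Suc j then x - e else x)"
    using Suc.prems by (subst Suc.IH) (auto simp: transpose_def)
  finally show ?case .
qed (simp add: word_prod_simps)

lemma brick_perm_involution:
  assumes "1 \<le> r" shows "brick_perm e \<mu> A r \<circ> brick_perm e \<mu> A r = id"
proof -
  define n where "n = Min (garnir_tab e \<mu> A ` set (bricks e \<mu> A ! 0))"
  define m where "m = n + r * e - e"
  \<comment> \<open>With r >= 1 the subtraction defining \<open>m\<close> does not truncate.\<close>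
  have "n + r * e = m + e"
    using assms by (cases r) (simp_all add: m_def)
  then have "brick_perm e \<mu> A r = word_prod (\<lambda>z. transpose z (z + e)) [m..<m + e]"
    by (simp add: brick_perm_def Let_def m_def n_def)
  then show ?thesis
    by (auto simp: fun_eq_iff word_prod_transpose_shift)
qed

lemma word_prod_rev_inverse:
  "(\<And>r. r \<in> set rs \<Longrightarrow> s r \<circ> s r = id) \<Longrightarrow> word_prod s rs \<circ> word_prod s (rev rs) = id"
proof (induction rs)
  case (Cons r rs)
  have "word_prod s (r # rs) \<circ> word_prod s (rev (r # rs)) =
      s r \<circ> (word_prod s rs \<circ> word_prod s (rev rs)) \<circ> s r"
    by (simp add: word_prod_append word_prod_simps o_assoc)
  then show ?case using Cons by simp
qed (simp add: word_prod_simps)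

lemma expr_length_id: "expr_length s N id = 0"
  unfolding expr_length_def by (rule Least_eq_0) (auto intro: exI[of _ "[]"] simp: word_prod_simps)

lemma expr_length_eq_0:
  assumes "u \<in> generated_perms s N" "expr_length s N u = 0" shows "u = id"
proof -
  have "\<exists>l rs. set rs \<subseteq> N \<and> word_prod s rs = u \<and> length rs = l"
    using assms(1) by (auto simp: generated_perms_def)
  from LeastI_ex[OF this] show ?thesis
    using assms(2) by (auto simp: expr_length_def word_prod_simps)
qed

text \<open>If all bricks lie in the upper row, then the parabolic subgroup is everything and the
  identity is the only representative.\<close>

lemma garnir_reps_eq_id:
  assumes "bricks_upper e \<mu> A = bricks e \<mu> A"
  shows "garnir_reps e \<mu> A = {id}"
proof -
  define N where "N = {1..<length (bricks e \<mu> A)}"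
  define s where "s = brick_perm e \<mu> A"
  let ?G = "generated_perms s N"
  \<comment> \<open>All b bricks are upper, and b is not among the labels 1, ..., b-1, so no
    generator is removed.\<close>
  have N: "N - {length (bricks_upper e \<mu> A)} = N" using assms by (auto simp: N_def)
  have reps: "garnir_reps e \<mu> A = {u \<in> ?G. \<forall>v\<in>?G. expr_length s N u \<le> expr_length s N (u \<circ> v)}"
    unfolding garnir_reps_def Let_def N_def[symmetric] s_def[symmetric] N ..
  have id: "id \<in> ?G" by (auto simp: generated_perms_def word_prod_simps intro: exI[of _ "[]"])
  show ?thesis
  proof (intro equalityI subsetI)
    fix u assume u: "u \<in> garnir_reps e \<mu> A"
    then obtain rs where rs: "set rs \<subseteq> N" "u = word_prod s rs"
      by (auto simp: reps generated_perms_def)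
    \<comment> \<open>The inverse of u lies in the same group, so the minimality of u is tested
      against length zero.\<close>
    have "word_prod s (rev rs) \<in> ?G"
      using rs(1) unfolding generated_perms_def by (intro CollectI exI[of _ "rev rs"]) simp
    moreover have "u \<circ> word_prod s (rev rs) = id"
      unfolding rs(2) using rs(1)
      by (intro word_prod_rev_inverse) (auto simp: s_def N_def intro!: brick_perm_involution)
    ultimately have "expr_length s N u \<le> expr_length s N id"
      using u by (force simp: reps)
    then show "u \<in> {id}" using u expr_length_eq_0[of u s N] by (simp add: expr_length_id reps)
  qed (use id in \<open>simp add: reps expr_length_id\<close>)
qed

text \<open>The entries of the initial tableau exhaust {1..d}, so the conditions determine a
  permutation; this evaluates the \<open>THE\<close> in \<open>tab_perm\<close>.\<close>

lemma (in hook_shape) tab_perm_eqI: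
  assumes w: "w permutes {1..d}" and T: "\<And>N. N \<in> young (hook d k) \<Longrightarrow> w (init_tab (hook d k) N) = T N"
  shows "tab_perm (hook d k) T = w"
  unfolding tab_perm_def sum_list_hook
proof (rule the_equality)
  fix w' assume w': "w' permutes {1..d} \<and> (\<forall>N\<in>young (hook d k). w' (init_tab (hook d k) N) = T N)"
  show "w' = w"
  proof
    fix x show "w' x = w x"
    proof (cases "x \<in> {1..d}")
      case True
      then obtain N where "N \<in> young (hook d k)" "x = init_tab (hook d k) N"
        using bij_betw_imp_surj_on[OF bij_init_tab_hook] by blast
      then show ?thesis using w' T by simp
    next
      case False
      then show ?thesis using w w' permutes_not_in by metis
    qed
  qed
qed (use w T in blast)

lemma concat_consecutive_upt: "concat (map (\<lambda>m. [m * e + 1..<m * e + 1 + e]) [0..<b]) = [1..<b * e + 1]"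
proof (induction b)
  case (Suc b)
  have "[1..<Suc b * e + 1] = [1..<b * e + 1] @ [b * e + 1..<b * e + 1 + e]"
    using upt_add_eq_append[of 1 "b * e + 1" e] by (simp add: add_ac)
  then show ?case using Suc by simp
qed simp

lemma map_of_zip_Pair_Suc:
  "map_of (zip (map (Pair x) ys) (map Suc ys)) N =
    (if fst N = x \<and> snd N \<in> set ys then Some (Suc (snd N)) else None)"
  by (induction ys) (auto simp: prod_eq_iff)

section \<open>Garnir tableaux of a hook\<close>

context hook_shape
begin

lemma nth_hook: "hook d k ! 0 = d - k" "1 \<le> x \<Longrightarrow> x \<le> k \<Longrightarrow> hook d k ! x = 1"
  by (simp_all add: hook_def nth_Cons')

lemma garnir_node_hook: "garnir_node (hook d k) A \<longleftrightarrow> snd A = 1 \<and> 1 \<le> fst A \<and> fst A \<le> k"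
  using kd by (cases A) (auto simp: garnir_node_def young_hook)

context
  assumes k0: "0 < k"
begin

lemma belt_hook_1: "belt (hook d k) (1, 1) = map (Pair 1) [1..<Suc (d - k)] @ [(2, 1)]"
proof -
  have "map (Pair (Suc 1)) [1..<Suc 1] = [(2, 1 :: nat)]" by (simp add: numeral_2_eq_2)
  then show ?thesis unfolding belt.simps diff_self_eq_0 nth_hook by (simp only: diff_self_eq_0)
qed

lemma set_belt_hook_1: "set (belt (hook d k) (1, 1)) = {1} \<times> {1..d - k} \<union> {(2, 1)}"
  unfolding belt_hook_1 by auto

text \<open>The belt has a single node in row 2, too short for a brick; in row 1 the residue
  condition says that e divides the distance to column 1.\<close>

lemma brick_in_belt_hook_1:
  assumes "N \<in> set (belt (hook d k) (1, 1))"
  shows "set (brick e N) \<subseteq> set (belt (hook d k) (1, 1)) \<and> res e N = res e (1, 1) \<longleftrightarrow>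
    fst N = 1 \<and> snd N + e \<le> Suc (d - k) \<and> (snd N - 1) mod e = 0"
proof -
  obtain w z where N: "N = (w, z)" by (cases N)
  have brick: "set (brick e N) = {w} \<times> {z..<z + e}" by (auto simp: N)
  show ?thesis
  proof (cases "w = 1")
    case True
    then have z: "1 \<le> z" "z \<le> d - k" using assms unfolding set_belt_hook_1 N by auto
    have "int z - 1 = int (z - 1)" using z by simp
    then have "res e N = int ((z - 1) mod e)" using True by (simp only: N res.simps of_nat_1 zmod_int)
    then have "res e N = res e (1, 1) \<longleftrightarrow> (z - 1) mod e = 0" by simp
    moreover have "set (brick e N) \<subseteq> set (belt (hook d k) (1, 1)) \<longleftrightarrow> z + e \<le> Suc (d - k)"
    proof
      assume sub: "set (brick e N) \<subseteq> set (belt (hook d k) (1, 1))"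
      have "(1, z + e - 1) \<in> set (brick e N)" using e3 by (auto simp: brick True)
      then have "(1, z + e - 1) \<in> set (belt (hook d k) (1, 1))" by (rule subsetD[OF sub])
      then show "z + e \<le> Suc (d - k)" unfolding set_belt_hook_1 by auto
    next
      assume "z + e \<le> Suc (d - k)"
      then show "set (brick e N) \<subseteq> set (belt (hook d k) (1, 1))"
        unfolding brick set_belt_hook_1 using z True by auto
    qed
    ultimately show ?thesis using True by (simp add: N)
  next
    case False
    then have "N = (2, 1)" using assms unfolding set_belt_hook_1 N by auto
    moreover have "(2, 2) \<in> set (brick e N)" using e3 unfolding brick using calculation N by auto
    ultimately show ?thesis unfolding set_belt_hook_1 by auto
  qed
qed

text \<open>The brick starting in column m e + 1 fits into the row exactly if (m+1) e <=
  d-k.\<close>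

lemma bricks_hook_1: "bricks e (hook d k) (1, 1) = map (\<lambda>m. brick e (1, m * e + 1)) [0..<(d - k) div e]"
proof -
  let ?a = "d - k" and ?b = "(d - k) div e"
  let ?Q = "\<lambda>z. z + e \<le> Suc ?a \<and> (z - 1) mod e = 0"
  have e0: "0 < e" using e3 by simp
  have "filter ?Q [1..<Suc ?a] = map (\<lambda>m. m * e + 1) [0..<?b]"
  proof (rule sorted_distinct_set_unique)
    show "sorted (map (\<lambda>m. m * e + 1) [0..<?b])" "distinct (map (\<lambda>m. m * e + 1) [0..<?b])"
      using e0 by (auto simp: sorted_map distinct_map inj_on_def intro!: sorted_wrt_mono_rel[OF _ sorted_upt])
    show "set (filter ?Q [1..<Suc ?a]) = set (map (\<lambda>m. m * e + 1) [0..<?b])"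
    proof (intro equalityI subsetI)
      fix z assume z: "z \<in> set (filter ?Q [1..<Suc ?a])"
      then have "e dvd z - 1" by auto
      then obtain m where "z - 1 = e * m" by (rule dvdE)
      then have "z = m * e + 1" using z by (auto simp: mult.commute)
      moreover from this have "Suc m * e \<le> ?a" using z by simp
      then have "m < ?b" using less_eq_div_iff_mult_less_eq[OF e0, of "Suc m" ?a] by simp
      ultimately show "z \<in> set (map (\<lambda>m. m * e + 1) [0..<?b])" by (force simp: image_iff)
    next
      fix z assume "z \<in> set (map (\<lambda>m. m * e + 1) [0..<?b])"
      then obtain m where m: "m < ?b" "z = m * e + 1" by auto
      then have "Suc m * e \<le> ?a" using less_eq_div_iff_mult_less_eq[OF e0, of "Suc m" ?a] by simp
      then have "z + e \<le> Suc ?a" "1 \<le> z" "z < Suc ?a" using m(2) e3 by simp_all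
      moreover have "(z - 1) mod e = 0" using m(2) by simp
      ultimately show "z \<in> set (filter ?Q [1..<Suc ?a])" by (simp del: upt_Suc)
    qed
  qed (simp_all add: sorted_wrt_filter del: upt_Suc)
  moreover have "filter (\<lambda>N. set (brick e N) \<subseteq> set (belt (hook d k) (1, 1)) \<and> res e N = res e (1, 1))
      (belt (hook d k) (1, 1)) = map (Pair 1) (filter ?Q [1..<Suc ?a])"
  proof -
    have "filter (\<lambda>N. set (brick e N) \<subseteq> set (belt (hook d k) (1, 1)) \<and> res e N = res e (1, 1))
      (belt (hook d k) (1, 1)) =
      filter (\<lambda>N. fst N = 1 \<and> snd N + e \<le> Suc (d - k) \<and> (snd N - 1) mod e = 0) (belt (hook d k) (1, 1))"
      by (rule filter_cong[OF refl]) (rule brick_in_belt_hook_1)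
    then show ?thesis unfolding belt_hook_1 by (simp add: filter_map o_def del: upt_Suc)
  qed
  ultimately show ?thesis unfolding bricks_def by (simp add: o_def)
qed

lemma bricks_upper_hook_1: "bricks_upper e (hook d k) (1, 1) = bricks e (hook d k) (1, 1)"
  unfolding bricks_upper_def bricks_hook_1 using e3
  by (intro filter_True) (auto simp: upt_conv_Cons simp del: upt_Suc)

lemma concat_bricks_hook_1:
  "concat (bricks e (hook d k) (1, 1)) = map (Pair 1) [1..<(d - k) div e * e + 1]"
proof -
  have "concat (bricks e (hook d k) (1, 1)) =
      map (Pair 1) (concat (map (\<lambda>m. [m * e + 1..<m * e + 1 + e]) [0..<(d - k) div e]))"
    unfolding bricks_hook_1 by (simp add: map_concat o_def)
  then show ?thesis unfolding concat_consecutive_upt .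
qed

text \<open>The bricks followed by the remaining nodes run through row 1 in order, so the filling
  does not depend on how the row is cut into bricks.\<close>

lemma garnir_nodes_hook_1:
  "garnir_D e (hook d k) (1, 1) @ concat (bricks e (hook d k) (1, 1)) @ garnir_C e (hook d k) (1, 1) =
    (2, 1) # map (Pair 1) [1..<Suc (d - k)]"
proof -
  let ?c = "(d - k) div e * e + 1"
  have split: "[1..<Suc (d - k)] = [1..<?c] @ [?c..<Suc (d - k)]"
  proof -
    have "?c + (Suc (d - k) - ?c) = Suc (d - k)"
      by (rule le_add_diff_inverse) (use div_times_less_eq_dividend[of "d - k" e] in simp)
    then show ?thesis
      using upt_add_eq_append[of 1 ?c "Suc (d - k) - ?c"] by (simp only: le_add2)
  qed
  have "garnir_D e (hook d k) (1, 1) = [(2, 1)]"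
    unfolding garnir_D_def concat_bricks_hook_1 unfolding belt_hook_1
    by (auto simp: filter_empty_conv simp del: upt_Suc)
  moreover have "garnir_C e (hook d k) (1, 1) = map (Pair 1) [?c..<Suc (d - k)]"
  proof -
    have "garnir_C e (hook d k) (1, 1) = map (Pair 1) (filter (\<lambda>y. y \<notin> {1..<?c}) [1..<Suc (d - k)])"
    proof -
      have mem: "(1, y) \<in> set (map (Pair 1) [1..<?c]) \<longleftrightarrow> y \<in> {1..<?c}" for y :: nat
        unfolding set_map set_upt image_iff by blast
      have row: "fst (1 :: nat, y :: nat) = 1 \<longleftrightarrow> True" "fst (2 :: nat, y) = 1 \<longleftrightarrow> False" for y by simp_all
      show ?thesis
        unfolding garnir_C_def concat_bricks_hook_1 unfolding belt_hook_1
        by (simp only: filter_append filter_map o_def fst_conv mem row filter.simps simp_thms) simp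
    qed
    also have "filter (\<lambda>y. y \<notin> {1..<?c}) [1..<Suc (d - k)] = [?c..<Suc (d - k)]"
      unfolding split by (simp add: filter_empty_conv filter_id_conv del: upt_Suc)
    finally show ?thesis .
  qed
  ultimately show ?thesis
    unfolding concat_bricks_hook_1 split by simp
qed

lemma garnir_tab_hook_1:
  assumes "N \<in> young (hook d k)"
  shows "garnir_tab e (hook d k) (1, 1) N =
    (if N = (2, 1) then 1 else if fst N = 1 then Suc (snd N) else init_tab (hook d k) N)"
proof -
  have 21: "(2, 1) \<in> young (hook d k)" using k0 by (simp add: young_hook)
  have "init_tab (hook d k) ` set (belt (hook d k) (1, 1)) = {1..<Suc (Suc (d - k))}"
  proof -
    have "init_tab (hook d k) (1, y) = y" if "y \<in> {1..d - k}" for y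
      using that init_tab_hook[of 1 y] by (simp add: young_hook del: init_tab.simps)
    then have "init_tab (hook d k) ` ({1} \<times> {1..d - k}) = {1..d - k}"
      by (auto simp: image_def simp del: init_tab.simps One_nat_def)
    then show ?thesis
      unfolding set_belt_hook_1 image_Un using init_tab_hook[OF 21] by (auto simp del: init_tab.simps)
  qed
  moreover have "[1..<Suc (Suc (d - k))] = 1 # map Suc [1..<Suc (d - k)]"
    by (simp add: map_Suc_upt upt_conv_Cons del: upt_Suc)
  ultimately have "sorted_list_of_set (init_tab (hook d k) ` set (belt (hook d k) (1, 1))) = 1 # map Suc [1..<Suc (d - k)]"
    by (simp del: upt_Suc)
  then show ?thesis
    unfolding garnir_tab_def garnir_nodes_hook_1 using assms
    by (auto simp: map_of_zip_Pair_Suc young_hook simp del: upt_Suc init_tab.simps split: option.split)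
qed

lemma tab_perm_hook_1:
  "tab_perm (hook d k) (garnir_tab e (hook d k) (1, 1)) = word_prod adj [1..<Suc (d - k)]"
proof (rule tab_perm_eqI)
  show "word_prod adj [1..<Suc (d - k)] permutes {1..d}"
    using k0 kd by (intro word_prod_adj_permutes) auto
  fix N assume N: "N \<in> young (hook d k)"
  show "word_prod adj [1..<Suc (d - k)] (init_tab (hook d k) N) = garnir_tab e (hook d k) (1, 1) N"
  proof -
    have cycle: "word_prod adj [1..<Suc (d - k)] y =
        (if y = Suc (d - k) then 1 else if 1 \<le> y \<and> y \<le> d - k then Suc y else y)" for y
      using word_prod_adj_upt[of 1 "d - k" y] by (simp del: upt_Suc)
    have init: "init_tab (hook d k) N = (if fst N = 1 then snd N else d - k + fst N - 1)"
      using N init_tab_hook[of "fst N" "snd N"] by (simp del: init_tab.simps)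
    show ?thesis
      unfolding garnir_tab_hook_1[OF N] cycle init using N kd by (auto simp: young_hook)
  qed
qed

section \<open>Garnir nodes of the leg below the corner\<close>

context
  fixes x :: nat
  assumes x: "2 \<le> x" "x \<le> k"
begin

lemma belt_hook_2: "belt (hook d k) (x, 1) = [(x, 1), (Suc x, 1)]"
proof -
  have "hook d k ! (x - 1) = 1" using x by (intro nth_hook) auto
  then show ?thesis unfolding belt.simps by simp
qed

lemma bricks_hook_2: "bricks e (hook d k) (x, 1) = []"
proof -
  have "\<not> set (brick e N) \<subseteq> set (belt (hook d k) (x, 1))" for N
  proof -
    obtain w z where N: "N = (w, z)" by (cases N)
    have "(w, z) \<in> set (brick e N)" "(w, Suc z) \<in> set (brick e N)" using e3 by (auto simp: N)
    then show ?thesis unfolding belt_hook_2 by auto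
  qed
  then have "filter (\<lambda>N. set (brick e N) \<subseteq> set (belt (hook d k) (x, 1)) \<and> res e N = res e (x, 1))
      (belt (hook d k) (x, 1)) = []"
    unfolding filter_empty_conv by blast
  then show ?thesis
    unfolding bricks_def by (simp only: list.map)
qed

text \<open>Without bricks, \<open>garnir_D\<close> is the lower node and \<open>garnir_C\<close>
  the upper one; the former receives the smaller entry, so the two entries are exchanged.\<close>

lemma garnir_tab_hook_2:
  assumes "N \<in> young (hook d k)"
  shows "garnir_tab e (hook d k) (x, 1) N =
    (if N = (x, 1) then d - k + x else if N = (Suc x, 1) then d - k + x - 1 else init_tab (hook d k) N)"
proof -
  have "init_tab (hook d k) (x, 1) = d - k + x - 1" "init_tab (hook d k) (Suc x, 1) = d - k + x"
    using init_tab_hook[of x 1] init_tab_hook[of "Suc x" 1] x by (simp_all add: young_hook)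
  then have "sorted_list_of_set (init_tab (hook d k) ` set (belt (hook d k) (x, 1))) = [d - k + x - 1, d - k + x]"
    unfolding belt_hook_2 using x by (simp add: insort_is_Cons del: init_tab.simps)
  then show ?thesis
    unfolding garnir_tab_def garnir_C_def garnir_D_def bricks_hook_2 unfolding belt_hook_2
    by simp
qed

lemma tab_perm_hook_2:
  "tab_perm (hook d k) (garnir_tab e (hook d k) (x, 1)) = word_prod adj [d - k + x - 1..<d - k + x]"
proof (rule tab_perm_eqI)
  show "word_prod adj [d - k + x - 1..<d - k + x] permutes {1..d}"
    using x kd by (intro word_prod_adj_permutes) auto
  fix N assume N: "N \<in> young (hook d k)"
  show "word_prod adj [d - k + x - 1..<d - k + x] (init_tab (hook d k) N) = garnir_tab e (hook d k) (x, 1) N"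
  proof -
    have swap: "word_prod adj [d - k + x - 1..<d - k + x] y =
        (if y = d - k + x then d - k + x - 1 else if y = d - k + x - 1 then d - k + x else y)" for y
    proof -
      have "[d - k + x - 1..<d - k + x] = [d - k + x - 1..<d - k + x - 1 + 1]" using x by simp
      then show ?thesis
        using word_prod_adj_upt[of "d - k + x - 1" 1 y] x by (auto simp del: upt_Suc)
    qed
    have init: "init_tab (hook d k) N = (if fst N = 1 then snd N else d - k + fst N - 1)"
      using N init_tab_hook[of "fst N" "snd N"] by (simp del: init_tab.simps)
    show ?thesis
    proof (cases "fst N = 1")
      case True
      then have "snd N \<le> d - k" using N by (auto simp: young_hook)
      then show ?thesis
        unfolding garnir_tab_hook_2[OF N] swap init using True x by (cases N) simp
    next
      case False
      then obtain z where z: "N = (z, 1)" "2 \<le> z" using N by (auto simp: young_hook)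
      have "d - k + z - 1 = d - k + x \<longleftrightarrow> z = Suc x" "d - k + z - 1 = d - k + x - 1 \<longleftrightarrow> z = x"
        using x z(2) by auto
      then show ?thesis
        unfolding garnir_tab_hook_2[OF N] swap init using z x by simp
    qed
  qed
qed

end

end

end

section \<open>Specht modules of hooks\<close>

text \<open>Makes the family intersected in \<open>gen_left_ideal\<close> nonempty.\<close>

lemma (in ring) left_ideal_carrier: "left_ideal (carrier R) R"
  unfolding left_ideal_def
  by (auto intro!: additive_subgroupI add.subgroupI)

lemma (in ring) gen_left_ideal:
  assumes S: "S \<subseteq> carrier R"
  shows "left_ideal (gen_left_ideal R S) R" "S \<subseteq> gen_left_ideal R S"
proof -
  let ?\<J> = "{J. left_ideal J R \<and> S \<subseteq> J}"
  have ne: "?\<J> \<noteq> {}" using left_ideal_carrier S by blast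
  have "subgroup (\<Inter>?\<J>) (add_monoid R)"
    using ne by (intro add.subgroups_Inter) (auto simp: left_ideal_def additive_subgroup_def)
  then show "left_ideal (gen_left_ideal R S) R"
    unfolding left_ideal_def gen_left_ideal_def additive_subgroup_def by auto
  show "S \<subseteq> gen_left_ideal R S" by (auto simp: gen_left_ideal_def)
qed

lemma (in ring) left_ideal_set_add:
  assumes "left_ideal I R" "left_ideal J R"
  shows "left_ideal (I <+>\<^bsub>R\<^esub> J) R" "I \<subseteq> I <+>\<^bsub>R\<^esub> J" "J \<subseteq> I <+>\<^bsub>R\<^esub> J"
proof -
  interpret I: additive_subgroup I R using assms(1) by (simp add: left_ideal_def)
  interpret J: additive_subgroup J R using assms(2) by (simp add: left_ideal_def)
  have mem: "x \<in> I <+>\<^bsub>R\<^esub> J \<longleftrightarrow> (\<exists>a\<in>I. \<exists>b\<in>J. x = a \<oplus> b)" for x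
    by (auto simp: set_add_def')
  show "left_ideal (I <+>\<^bsub>R\<^esub> J) R"
    unfolding left_ideal_def
  proof (intro conjI ballI)
    show "additive_subgroup (I <+>\<^bsub>R\<^esub> J) R"
      by (rule add_additive_subgroups) unfold_locales
    fix x r assume "x \<in> I <+>\<^bsub>R\<^esub> J" and r: "r \<in> carrier R"
    then obtain a b where ab: "a \<in> I" "b \<in> J" "x = a \<oplus> b" unfolding mem by blast
    then have "r \<otimes> x = r \<otimes> a \<oplus> r \<otimes> b" using r by (simp add: r_distr)
    moreover have "r \<otimes> a \<in> I" "r \<otimes> b \<in> J" using assms ab r by (auto simp: left_ideal_def)
    ultimately show "r \<otimes> x \<in> I <+>\<^bsub>R\<^esub> J" unfolding mem by blast
  qed
  show "I \<subseteq> I <+>\<^bsub>R\<^esub> J"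
  proof
    fix x assume "x \<in> I"
    then show "x \<in> I <+>\<^bsub>R\<^esub> J" unfolding mem by (intro bexI[of _ x] bexI[of _ \<zero>]) simp_all
  qed
  show "J \<subseteq> I <+>\<^bsub>R\<^esub> J"
  proof
    fix x assume "x \<in> J"
    then show "x \<in> I <+>\<^bsub>R\<^esub> J" unfolding mem by (intro bexI[of _ \<zero>] bexI[of _ x]) simp_all
  qed
qed

lemma perm_seq_comp:
  assumes "w permutes {1..d}" "1 \<le> t" "t < d"
  shows "perm_seq d (adj t \<circ> w) i = perm_seq d (adj t) (perm_seq d w i)"
proof
  fix r
  show "perm_seq d (adj t \<circ> w) i r = perm_seq d (adj t) (perm_seq d w i) r"
    using permutes_in_image[OF adj_permutes[OF assms(2,3)], of r]
    by (simp add: perm_seq_def inv_adj_comp[OF assms(1)])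
qed

lemma perm_seq_id: "i \<in> res_seqs e \<alpha> \<Longrightarrow> perm_seq (size \<alpha>) id i = i"
proof
  fix r assume "i \<in> res_seqs e \<alpha>"
  then have "i \<in> {1..size \<alpha>} \<rightarrow>\<^sub>E {0..<int e}" by (simp add: res_seqs_def)
  from PiE_arb[OF this, of r] show "perm_seq (size \<alpha>) id i r = i r"
    by (cases "r \<in> {1..size \<alpha>}") (auto simp: perm_seq_def)
qed

text \<open>The sum runs over the identity alone, whose tau is an empty product. Evaluating the
  finite sum requires its summand to lie in the carrier, hence the premise
  \<open>closed\<close>.\<close>

lemma garnir_eq_psi_perm:
  fixes e \<mu> rd A
  defines "w \<equiv> tab_perm \<mu> (garnir_tab e \<mu> A)"
  assumes upper: "bricks_upper e \<mu> A = bricks e \<mu> A"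
    and closed: "psi_perm e (cont e \<mu>) rd w \<in> carrier (klr e (cont e \<mu>) :: 'a::comm_ring_1 klr_elt ring)"
  shows "garnir e rd \<mu> A = (psi_perm e (cont e \<mu>) rd w :: 'a klr_elt)"
proof -
  interpret ring "klr e (cont e \<mu>) :: 'a klr_elt ring" by (rule klr_ring)
  \<comment> \<open>The word picked by \<open>SOME\<close> is empty, since the identity has no other
    reduced expression.\<close>
  have "garnir_tau_perm e rd \<mu> A id = (\<one>\<^bsub>klr e (cont e \<mu>)\<^esub> :: 'a klr_elt)"
    by (simp add: garnir_tau_perm_def Let_def reduced_expr_id)
  then show ?thesis
    unfolding garnir_def Let_def garnir_reps_eq_id[OF upper] w_def[symmetric]
    using closed by (simp add: finsum_insert)
qed

section \<open>The Specht module of a hook as an instance of the abstract action\<close>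

locale specht_hook = hook_shape e d k for e d k +
  fixes rd :: "(nat \<Rightarrow> nat) \<Rightarrow> nat list"
    and M :: "('a::comm_ring_1 klr_elt, 'a klr_elt set) module"
  assumes rd: "reduced_choice d rd"
    and M: "M = specht e rd (hook d k)"
begin

abbreviation "\<mu> \<equiv> hook d k"
abbreviation "\<alpha> \<equiv> cont e \<mu>"
abbreviation "R \<equiv> klr e \<alpha> :: 'a klr_elt ring"
abbreviation "J \<equiv> specht_ideal e rd \<mu> :: 'a klr_elt set"
abbreviation "z \<equiv> specht_z e rd \<mu> :: 'a klr_elt set"
abbreviation "V \<equiv> specht_vec e rd \<mu> :: (nat \<Rightarrow> nat) \<Rightarrow> 'a klr_elt set"
abbreviation "P r \<equiv> (\<odot>\<^bsub>M\<^esub>) (klr_psi e \<alpha> r)"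
abbreviation "Y r \<equiv> (\<odot>\<^bsub>M\<^esub>) (klr_y e \<alpha> r)"

lemma size_cont: "size \<alpha> = d"
  using bij_betw_same_card[OF bij_init_tab_hook] by (simp add: cont_def)

lemma base_res_res_seqs: "base_res \<in> res_seqs e \<alpha>"
proof -
  let ?g = "inv_into (young \<mu>) (init_tab \<mu>)"
  have g: "bij_betw ?g {1..d} (young \<mu>)"
    by (rule bij_betw_inv_into[OF bij_init_tab_hook])
  have "image_mset base_res (mset_set {1..d}) = image_mset (res e \<circ> ?g) (mset_set {1..d})"
    by (rule image_mset_cong) (simp add: res_seq_def sum_list_hook)
  also have "\<dots> = image_mset (res e) (image_mset ?g (mset_set {1..d}))"
    by (simp add: multiset.map_comp)
  also have "image_mset ?g (mset_set {1..d}) = mset_set (young \<mu>)"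
    using image_mset_mset_set[OF bij_betw_imp_inj_on[OF g]] bij_betw_imp_surj_on[OF g] by simp
  finally have "image_mset base_res (mset_set {1..d}) = \<alpha>" by (simp add: cont_def)
  moreover have "base_res \<in> {1..d} \<rightarrow>\<^sub>E {0..<int e}"
  proof (rule PiE_I)
    fix j assume "j \<in> {1..d}"
    then show "base_res j \<in> {0..<int e}" using e3 by (simp add: base_res)
  qed (auto simp: res_seq_def sum_list_hook)
  ultimately show ?thesis by (simp add: res_seqs_def size_cont)
qed

lemma klr_hook_closed:
  "i \<in> res_seqs e \<alpha> \<Longrightarrow> klr_e e \<alpha> i \<in> carrier R"
  "r \<in> {1..d} \<Longrightarrow> klr_y e \<alpha> r \<in> carrier R"
  "r \<in> {1..<d} \<Longrightarrow> klr_psi e \<alpha> r \<in> carrier R"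
  by (rule klr_closed; simp add: size_cont)+

lemma rd_reduced: "w permutes {1..d} \<Longrightarrow> reduced_expr adj {1..<d} w (rd w)"
  using rd by (simp add: reduced_choice_def)

lemma rd_set: "w permutes {1..d} \<Longrightarrow> set (rd w) \<subseteq> {1..<d}"
  using rd_reduced[of w] by (simp add: reduced_expr_def)

interpretation R: ring R by (rule klr_ring)

lemma psi_word_closed:
  "set rs \<subseteq> {1..<d} \<Longrightarrow> foldr (\<lambda>r a. klr_psi e \<alpha> r \<otimes>\<^bsub>R\<^esub> a) rs \<one>\<^bsub>R\<^esub> \<in> carrier R"
  by (induction rs) (simp_all add: klr_hook_closed)

lemma psi_perm_closed: "w permutes {1..d} \<Longrightarrow> psi_perm e \<alpha> rd w \<in> carrier R"
  unfolding psi_perm_def by (intro psi_word_closed rd_set)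

lemma garnir_hook:
  assumes A: "garnir_node \<mu> A"
  shows "tab_perm \<mu> (garnir_tab e \<mu> A) permutes {1..d}"
    "garnir e rd \<mu> A = (psi_perm e \<alpha> rd (tab_perm \<mu> (garnir_tab e \<mu> A)) :: 'a klr_elt)"
proof -
  obtain x where x: "A = (x, 1)" "1 \<le> x" "x \<le> k" using A by (cases A) (auto simp: garnir_node_hook)
  have upper: "bricks_upper e \<mu> A = bricks e \<mu> A"
    and perm: "tab_perm \<mu> (garnir_tab e \<mu> A) permutes {1..d}"
  proof -
    consider "x = 1" | "2 \<le> x" using x by linarith
    then have "bricks_upper e \<mu> A = bricks e \<mu> A \<and> tab_perm \<mu> (garnir_tab e \<mu> A) permutes {1..d}"
    proof cases
      case 1
      then have "0 < k" using x by simp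
      moreover have "word_prod adj [1..<Suc (d - k)] permutes {1..d}"
        using x kd by (intro word_prod_adj_permutes) auto
      ultimately show ?thesis
        unfolding x(1) 1 using bricks_upper_hook_1 tab_perm_hook_1 by metis
    next
      case 2
      have "0 < k" using x by simp
      have "bricks e \<mu> A = []" unfolding x(1) using bricks_hook_2[OF \<open>0 < k\<close> 2 x(3)] .
      moreover have "word_prod adj [d - k + x - 1..<d - k + x] permutes {1..d}"
        using x 2 kd by (intro word_prod_adj_permutes) auto
      ultimately show ?thesis
        using tab_perm_hook_2[OF \<open>0 < k\<close> 2 x(3)] by (simp add: x(1) bricks_upper_def)
    qed
    then show "bricks_upper e \<mu> A = bricks e \<mu> A" "tab_perm \<mu> (garnir_tab e \<mu> A) permutes {1..d}"
      by blast+
  qed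
  show "tab_perm \<mu> (garnir_tab e \<mu> A) permutes {1..d}" by (rule perm)
  show "garnir e rd \<mu> A = (psi_perm e \<alpha> rd (tab_perm \<mu> (garnir_tab e \<mu> A)) :: 'a klr_elt)"
    by (rule garnir_eq_psi_perm[OF upper psi_perm_closed[OF perm]])
qed

abbreviation "gens1 \<equiv> {klr_e e \<alpha> j \<ominus>\<^bsub>R\<^esub> (if j = base_res then \<one>\<^bsub>R\<^esub> else \<zero>\<^bsub>R\<^esub>) |j. j \<in> res_seqs e \<alpha>}"
abbreviation "gens2 \<equiv> {klr_y e \<alpha> r :: 'a klr_elt |r. r \<in> {1..sum_list \<mu>}}"
abbreviation "gens3 \<equiv> {klr_psi e \<alpha> r :: 'a klr_elt |r. \<exists>x y y'. (x, y) \<in> young \<mu> \<and> (x, y') \<in> young \<mu> \<and>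
              init_tab \<mu> (x, y) = r \<and> init_tab \<mu> (x, y') = Suc r}"
abbreviation "gens4 \<equiv> {garnir e rd \<mu> A :: 'a klr_elt |A. garnir_node \<mu> A}"

lemma specht_ideal_hook:
  shows "left_ideal J R" "gens1 \<subseteq> J" "gens2 \<subseteq> J" "gens3 \<subseteq> J" "gens4 \<subseteq> J"
proof -
  have 1: "gens1 \<subseteq> carrier R" using klr_hook_closed(1) by auto
  have 2: "gens2 \<subseteq> carrier R" using klr_hook_closed(2) by (auto simp: sum_list_hook)
  have 3: "gens3 \<subseteq> carrier R"
  proof
    fix a assume "a \<in> gens3"
    then obtain x y y' where "(x, y) \<in> young \<mu>" "(x, y') \<in> young \<mu>"
      "a = klr_psi e \<alpha> (init_tab \<mu> (x, y))" "init_tab \<mu> (x, y') = Suc (init_tab \<mu> (x, y))"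
      by auto
    \<comment> \<open>As r+1 is an entry too, r < d and psi_r is one of the generators.\<close>
    moreover from this have "init_tab \<mu> (x, y) \<in> {1..d}" "Suc (init_tab \<mu> (x, y)) \<in> {1..d}"
      using bij_betwE[OF bij_init_tab_hook] by metis+
    ultimately show "a \<in> carrier R" using klr_hook_closed(3) by simp
  qed
  have 4: "gens4 \<subseteq> carrier R" using garnir_hook psi_perm_closed by auto
  have J: "J = gen_left_ideal R gens1 <+>\<^bsub>R\<^esub> gen_left_ideal R gens2 <+>\<^bsub>R\<^esub> gen_left_ideal R gens3
      <+>\<^bsub>R\<^esub> gen_left_ideal R gens4"
    unfolding specht_ideal_def J1_def J2_def J3_def J4_def Let_def ..
  note G1 = R.gen_left_ideal[OF 1] and G2 = R.gen_left_ideal[OF 2]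
    and G3 = R.gen_left_ideal[OF 3] and G4 = R.gen_left_ideal[OF 4]
  note A = R.left_ideal_set_add[OF G1(1) G2(1)]
  note B = R.left_ideal_set_add[OF A(1) G3(1)]
  note C = R.left_ideal_set_add[OF B(1) G4(1)]
  show "left_ideal J R" unfolding J by (rule C(1))
  show "gens1 \<subseteq> J" unfolding J by (rule order_trans[OF G1(2) order_trans[OF A(2) order_trans[OF B(2) C(2)]]])
  show "gens2 \<subseteq> J" unfolding J by (rule order_trans[OF G2(2) order_trans[OF A(3) order_trans[OF B(2) C(2)]]])
  show "gens3 \<subseteq> J" unfolding J by (rule order_trans[OF G3(2) order_trans[OF B(3) C(2)]])
  show "gens4 \<subseteq> J" unfolding J by (rule order_trans[OF G4(2) C(3)])
qed

lemma M_quot: "M = quot_left_module R J"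
  by (simp add: M specht_def)

lemma klr_module_M: "klr_module e \<alpha> M"
  unfolding klr_module_def M_quot by (rule left_module_quot[OF klr_ring specht_ideal_hook(1)])

interpretation K: klr_module e \<alpha> M by (rule klr_module_M)

lemma z_closed: "z \<in> carrier M"
  unfolding M_quot specht_z_def Let_def
  by (rule left_coset_closed[OF klr_ring specht_ideal_hook(1) R.one_closed])

lemma smult_z: "a \<in> carrier R \<Longrightarrow> a \<odot>\<^bsub>M\<^esub> z = J +>\<^bsub>R\<^esub> a"
  unfolding M_quot specht_z_def Let_def
  using left_coset_smult[OF klr_ring specht_ideal_hook(1) _ R.one_closed] by simp

lemma smult_z_eq_zero: "a \<in> J \<Longrightarrow> a \<in> carrier R \<Longrightarrow> a \<odot>\<^bsub>M\<^esub> z = \<zero>\<^bsub>M\<^esub>"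
  using left_coset_eq_zero[OF klr_ring specht_ideal_hook(1)] by (simp add: smult_z) (simp add: M_quot)

lemma psi_word_smult:
  "set rs \<subseteq> {1..<d} \<Longrightarrow> x \<in> carrier M \<Longrightarrow>
    foldr (\<lambda>r a. klr_psi e \<alpha> r \<otimes>\<^bsub>R\<^esub> a) rs \<one>\<^bsub>R\<^esub> \<odot>\<^bsub>M\<^esub> x = foldr P rs x"
  by (induction rs) (simp_all add: K.smult_one K.smult_assoc klr_hook_closed psi_word_closed)

lemma psi_perm_smult_z: "w permutes {1..d} \<Longrightarrow> psi_perm e \<alpha> rd w \<odot>\<^bsub>M\<^esub> z = foldr P (rd w) z"
  unfolding psi_perm_def by (intro psi_word_smult rd_set z_closed)

lemma V_eq: "w permutes {1..d} \<Longrightarrow> V w = foldr P (rd w) z"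
  by (simp add: specht_vec_def M[symmetric] psi_perm_smult_z)

lemma V_id: "V id = z"
  using V_eq[OF permutes_id] rd_reduced[OF permutes_id] by (simp add: reduced_expr_id)

lemma P_word_closed: "set rs \<subseteq> {1..<d} \<Longrightarrow> foldr P rs z \<in> carrier M"
  by (induction rs) (simp_all add: z_closed K.smult_closed klr_hook_closed)

lemma V_closed: "w permutes {1..d} \<Longrightarrow> V w \<in> carrier M"
  using P_word_closed[OF rd_set] by (simp only: V_eq)

text \<open>The generator of J_1 for the initial residue sequence gives this. From z the property
  spreads to all \<open>V w\<close>, which is what makes relations ending in an idempotent
  applicable.\<close>

lemma weight_z: "K.weight base_res z"
proof -
  note e = klr_hook_closed(1)[OF base_res_res_seqs]
  have "klr_e e \<alpha> base_res \<ominus>\<^bsub>R\<^esub> \<one>\<^bsub>R\<^esub> \<in> gens1"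
    using base_res_res_seqs by force
  then have "(klr_e e \<alpha> base_res \<ominus>\<^bsub>R\<^esub> \<one>\<^bsub>R\<^esub>) \<odot>\<^bsub>M\<^esub> z = \<zero>\<^bsub>M\<^esub>"
    using specht_ideal_hook(2) e by (intro smult_z_eq_zero) auto
  moreover have "(klr_e e \<alpha> base_res \<ominus>\<^bsub>R\<^esub> \<one>\<^bsub>R\<^esub>) \<odot>\<^bsub>M\<^esub> z = klr_e e \<alpha> base_res \<odot>\<^bsub>M\<^esub> z \<oplus>\<^bsub>M\<^esub> (\<ominus>\<^bsub>M\<^esub> z)"
    using e z_closed by (simp add: a_minus_def K.smult_l_distr K.smult_l_minus K.smult_one)
  ultimately have "klr_e e \<alpha> base_res \<odot>\<^bsub>M\<^esub> z = z"
    using K.smult_closed[OF e z_closed] z_closed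
    by (metis K.M.add.inv_closed K.M.minus_equality K.M.minus_minus)
  then show ?thesis
    unfolding K.weight_def using base_res_res_seqs z_closed by simp
qed

lemma weight_word:
  "set rs \<subseteq> {1..<d} \<Longrightarrow> K.weight (perm_seq d (word_prod adj rs) base_res) (foldr P rs z)"
proof (induction rs)
  case Nil
  have "perm_seq d id base_res = base_res"
    using perm_seq_id[OF base_res_res_seqs] unfolding size_cont .
  then show ?case
    unfolding word_prod_simps foldr.simps id_apply using weight_z by (simp only:)
next
  case (Cons r rs)
  have "word_prod adj rs permutes {1..d}" using Cons.prems by (intro word_prod_adj_permutes) auto
  then have "perm_seq d (word_prod adj (r # rs)) base_res
      = perm_seq d (adj r) (perm_seq d (word_prod adj rs) base_res)"
    unfolding word_prod_simps using Cons.prems by (intro perm_seq_comp) auto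
  then show ?case
    using K.P_weight[OF Cons.IH, of r] Cons.prems by (simp add: size_cont)
qed

lemma weight_V: "w permutes {1..d} \<Longrightarrow> K.weight (c w) (V w)"
proof -
  assume w: "w permutes {1..d}"
  have "word_prod adj (rd w) = w" using rd_reduced[OF w] unfolding reduced_expr_def by blast
  with weight_word[OF rd_set[OF w]] show ?thesis by (simp only: V_eq[OF w])
qed

text \<open>By uniqueness of its reduced word, \<open>rd\<close> assigns the interval to the cycle,
  so the Garnir generator acts on z as this very product.\<close>

lemma garnir_z:
  assumes "garnir_node \<mu> A" "tab_perm \<mu> (garnir_tab e \<mu> A) = word_prod adj [m..<m + n]" "1 \<le> m" "m + n \<le> d"
  shows "foldr P [m..<m + n] z = \<zero>\<^bsub>M\<^esub>"
proof -
  note G = garnir_hook[OF assms(1), unfolded assms(2)]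
  have "rd (word_prod adj [m..<m + n]) = [m..<m + n]"
    by (rule reduced_word_upt_unique[OF assms(3,4) rd_reduced[OF G(1)]])
  then have "foldr P [m..<m + n] z = psi_perm e \<alpha> rd (word_prod adj [m..<m + n]) \<odot>\<^bsub>M\<^esub> z"
    using psi_perm_smult_z[OF G(1)] by simp
  also have "\<dots> = \<zero>\<^bsub>M\<^esub>"
  proof (rule smult_z_eq_zero)
    have "garnir e rd \<mu> A \<in> gens4" using assms(1) by blast
    then show "psi_perm e \<alpha> rd (word_prod adj [m..<m + n]) \<in> J"
      using specht_ideal_hook(5) G(2) by auto
  qed (rule psi_perm_closed[OF G(1)])
  finally show ?thesis .
qed

lemma hook_action_M: "hook_action e d k M Y P V"
proof -
  have cl: "c \<sigma> r = cl \<sigma> r" if "r \<in> {1..d}" for \<sigma> r using that by (rule c_eq_cl)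
  note W = weight_V[OF Sh_permutes] and Vc = V_closed[OF Sh_permutes]
  have arrow: "arrow e (cl \<sigma> r) (cl \<sigma> s) \<longleftrightarrow> cl \<sigma> r = up (cl \<sigma> s)"
    if "\<sigma> \<in> Sh d k" "r \<in> {1..d}" "s \<in> {1..d}" for \<sigma> r s
    using arrow_iff cl_range that by blast
  show ?thesis
  proof unfold_locales
    show "V \<sigma> \<in> carrier M" if "\<sigma> \<in> Sh d k" for \<sigma> using Vc that .
    show "Y r x \<in> carrier M" if "r \<in> {1..d}" "x \<in> carrier M" for r x
      using that by (simp add: K.smult_closed klr_hook_closed)
    show "P r x \<in> carrier M" if "r \<in> {1..<d}" "x \<in> carrier M" for r x
      using that by (simp add: K.smult_closed klr_hook_closed)
    show "P r \<zero>\<^bsub>M\<^esub> = \<zero>\<^bsub>M\<^esub>" if "r \<in> {1..<d}" for r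
      using that by (simp add: K.smult_r_null klr_hook_closed)
    show "P r (\<ominus>\<^bsub>M\<^esub> x) = \<ominus>\<^bsub>M\<^esub> P r x" if "r \<in> {1..<d}" "x \<in> carrier M" for r x
      using that by (simp add: K.smult_r_minus klr_hook_closed)
    show "P t (V \<sigma>) = V (adj t \<circ> \<sigma>)" if s: "\<sigma> \<in> Sh d k" and t: "t \<in> Arm d k \<sigma>" "Suc t \<in> Leg d k \<sigma>" for \<sigma> t
    proof -
      have st: "adj t \<circ> \<sigma> \<in> Sh d k" using Sh_swap[OF s] t by blast
      have td: "1 \<le> t" "t < d" using Arm_range[OF s t(1)] Leg_range[OF s t(2)] by auto
      have mem: "t \<in> Leg d k (adj t \<circ> \<sigma>)" "Suc t \<in> Arm d k (adj t \<circ> \<sigma>)" using t by (simp_all add: Arm_adj Leg_adj)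
      \<comment> \<open>The chosen word of \<sigma> with t in front is reduced, but need not be the
        word that \<open>rd\<close> chooses for s_t \<sigma>; full commutativity identifies their
        actions on z.\<close>
      have "reduced_expr adj {1..<d} (adj t \<circ> \<sigma>) (t # rd \<sigma>)"
      proof (rule reduced_expr_adj_ConsI[OF Sh_permutes[OF st] _ td pinv_gr[OF st mem]])
        show "reduced_expr adj {1..<d} (adj t \<circ> (adj t \<circ> \<sigma>)) (rd \<sigma>)"
          unfolding adj_comp_adj by (rule rd_reduced[OF Sh_permutes[OF s]])
      qed
      note word = this
      have "foldr P (rd (adj t \<circ> \<sigma>)) z = foldr P (t # rd \<sigma>) z"
      proof (rule reduced_words_Sh_act_eq[OF _ _ z_closed st rd_reduced[OF Sh_permutes[OF st]] word])
        show "P r x \<in> carrier M" if "r \<in> {1..<d}" "x \<in> carrier M" for r x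
          using that by (intro K.smult_closed klr_hook_closed)
        show "P r (P t x) = P t (P r x)"
          if "r \<in> {1..<d}" "t \<in> {1..<d}" "Suc t < r \<or> Suc r < t" "x \<in> carrier M" for r t x
          using that by (intro K.P_P_comm) (simp_all only: size_cont)
      qed
      then show ?thesis by (simp add: V_eq[OF Sh_permutes[OF s]] V_eq[OF Sh_permutes[OF st]])
    qed
    show "Y r (V id) = \<zero>\<^bsub>M\<^esub>" if "r \<in> {1..d}" for r
    proof -
      have "klr_y e \<alpha> r \<in> gens2" using that by (auto simp: sum_list_hook)
      then show ?thesis
        unfolding V_id using specht_ideal_hook(3) klr_hook_closed(2)[OF that] by (intro smult_z_eq_zero) auto
    qed
    show "P r (V id) = \<zero>\<^bsub>M\<^esub>" if r: "1 \<le> r" "r < d - k" for r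
    proof -
      have y: "(1, r) \<in> young \<mu>" "(1, Suc r) \<in> young \<mu>" using r by (simp_all add: young_hook)
      moreover have "init_tab \<mu> (1, r) = r" "init_tab \<mu> (1, Suc r) = Suc r"
        using init_tab_hook[OF y(1)] init_tab_hook[OF y(2)] by simp_all
      ultimately have "klr_psi e \<alpha> r \<in> gens3" by blast
      then have "klr_psi e \<alpha> r \<in> J" by (rule subsetD[OF specht_ideal_hook(4)])
      then show ?thesis
        unfolding V_id using klr_hook_closed(3)[of r] r by (intro smult_z_eq_zero) simp_all
    qed
    show "P r (V id) = \<zero>\<^bsub>M\<^esub>" if r: "d - k < r" "r < d" for r
    proof -
      \<comment> \<open>Row x of the first column holds r. Since r and r+1 stand in different rows,
        psi_r z = 0 comes from the Garnir node (x, 1) and not from J_3.\<close>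
      define x where "x = r + 1 - (d - k)"
      have x: "2 \<le> x" "x \<le> k" "d - k + x - 1 = r" "d - k + x = r + 1" "0 < k" using r by (auto simp: x_def)
      have "garnir_node \<mu> (x, 1)" using x by (simp add: garnir_node_hook)
      then have "foldr P [r..<r + 1] z = \<zero>\<^bsub>M\<^esub>"
        using tab_perm_hook_2[OF x(5,1,2)] r unfolding x(3,4) by (intro garnir_z) auto
      then show ?thesis by (simp add: V_id)
    qed
    show "foldr P [1..<Suc (d - k)] (V id) = \<zero>\<^bsub>M\<^esub>" if k: "0 < k"
    proof -
      have "garnir_node \<mu> (1, 1)" using k by (simp add: garnir_node_hook)
      then have "foldr P [1..<1 + (d - k)] z = \<zero>\<^bsub>M\<^esub>"
        using tab_perm_hook_1[OF k] k kd by (intro garnir_z) auto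
      then show ?thesis by (simp add: V_id del: upt_Suc)
    qed
    show "Y r (P t (V \<sigma>)) = P t (Y r (V \<sigma>))"
      if "\<sigma> \<in> Sh d k" "t \<in> {1..<d}" "r \<in> {1..d}" "r \<noteq> t" "r \<noteq> Suc t" for \<sigma> t r
      using that K.Y_P_comm[OF Vc] by (simp add: size_cont)
    show "P r (P t (V \<sigma>)) = P t (P r (V \<sigma>))"
      if "\<sigma> \<in> Sh d k" "t \<in> {1..<d}" "r \<in> {1..<d}" "Suc t < r \<or> Suc r < t" for \<sigma> t r
      using that K.P_P_comm[OF Vc] by (simp add: size_cont)
  next
    fix \<sigma> t assume s: "\<sigma> \<in> Sh d k" and t: "t \<in> {1..<d}"
    then have t': "t \<in> {1..d}" "Suc t \<in> {1..d}" "t \<in> {1..<size \<alpha>}" by (auto simp: size_cont)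
    note clt = cl[OF t'(1), of \<sigma>] cl[OF t'(2), of \<sigma>]
    note ar = arrow[OF s t'(1,2)] arrow[OF s t'(2,1)]
    have closed: "Y t (V \<sigma>) \<in> carrier M" "Y (Suc t) (V \<sigma>) \<in> carrier M" "P t (V \<sigma>) \<in> carrier M"
      "P t (Y (Suc t) (V \<sigma>)) \<in> carrier M" "Y t (P t (V \<sigma>)) \<in> carrier M"
      using t t' Vc[OF s] by (simp_all add: K.smult_closed klr_hook_closed)
    \<comment> \<open>The KLR relation expresses psi_t y_{t+1}; solved for y_t psi_t, its constant
      term changes sign.\<close>
    show "Y t (P t (V \<sigma>)) = P t (Y (Suc t) (V \<sigma>)) \<ominus>\<^bsub>M\<^esub> (if cl \<sigma> t = cl \<sigma> (Suc t) then V \<sigma> else \<zero>\<^bsub>M\<^esub>)"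
      using K.P_Y_Suc[OF W[OF s] t'(3)] closed Vc[OF s]
      by (simp add: clt a_minus_def K.M.a_assoc K.M.r_neg)
    show "Y (Suc t) (P t (V \<sigma>)) = P t (Y t (V \<sigma>)) \<oplus>\<^bsub>M\<^esub> (if cl \<sigma> t = cl \<sigma> (Suc t) then V \<sigma> else \<zero>\<^bsub>M\<^esub>)"
      using K.Y_Suc_P[OF W[OF s] t'(3)] by (simp add: clt)
    show "P t (P t (V \<sigma>)) =
      (if cl \<sigma> t = cl \<sigma> (Suc t) then \<zero>\<^bsub>M\<^esub>
       else if cl \<sigma> t = up (cl \<sigma> (Suc t)) then Y (Suc t) (V \<sigma>) \<ominus>\<^bsub>M\<^esub> Y t (V \<sigma>)
       else if cl \<sigma> (Suc t) = up (cl \<sigma> t) then Y t (V \<sigma>) \<ominus>\<^bsub>M\<^esub> Y (Suc t) (V \<sigma>)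
       else V \<sigma>)"
      using K.P_P[OF W[OF s] t'(3)] unfolding clt ar .
  next
    fix \<sigma> t assume s: "\<sigma> \<in> Sh d k" and t: "1 \<le> t" "Suc (Suc t) \<le> d"
    then have t': "t \<in> {1..d}" "Suc t \<in> {1..d}" "t + 2 \<in> {1..d}" "t + 2 \<le> size \<alpha>" by (auto simp: size_cont)
    note clt = cl[OF t'(1), of \<sigma>] cl[OF t'(2), of \<sigma>] cl[OF t'(3), of \<sigma>]
    note ar = arrow[OF s t'(1,2)] arrow[OF s t'(2,1)]
    show "P t (P (Suc t) (P t (V \<sigma>))) =
      (if cl \<sigma> (Suc (Suc t)) = cl \<sigma> t \<and> cl \<sigma> t = up (cl \<sigma> (Suc t))
         then P (Suc t) (P t (P (Suc t) (V \<sigma>))) \<oplus>\<^bsub>M\<^esub> V \<sigma>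
       else if cl \<sigma> (Suc (Suc t)) = cl \<sigma> t \<and> cl \<sigma> (Suc t) = up (cl \<sigma> t)
         then P (Suc t) (P t (P (Suc t) (V \<sigma>))) \<ominus>\<^bsub>M\<^esub> V \<sigma>
       else P (Suc t) (P t (P (Suc t) (V \<sigma>))))"
      using K.P_braid[OF W[OF s] t(1) t'(4)] unfolding clt ar by (simp only: add_2_eq_Suc')
  qed
qed

lemma e_V:
  assumes s: "\<sigma> \<in> Sh d k"
  shows "(\<forall>j\<in>res_seqs e \<alpha>. klr_e e \<alpha> j \<odot>\<^bsub>M\<^esub> V \<sigma> = (if c \<sigma> = j then V \<sigma> else \<zero>\<^bsub>M\<^esub>))"
  using K.E_weight[OF weight_V[OF Sh_permutes[OF s]]] by blast

end

text \<open>The choice \<open>rd\<close> of reduced words is arbitrary, and \<open>2 \<le> d\<close>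
  guards psi_1, which is a generator only then. Residues at 0 and d+1 are \<open>undefined\<close>,
  but a clause that compares one of them for equality with its neighbour also asks that entry to be
  in the arm or the leg.\<close>

theorem theorem4p3:
  fixes e d k :: nat
    and rd :: "(nat \<Rightarrow> nat) \<Rightarrow> nat list"
    and \<sigma> :: "nat \<Rightarrow> nat"
    and \<alpha> :: "int multiset"
    and i :: "nat \<Rightarrow> int"
    and S :: "('a::comm_ring_1 klr_elt, 'a klr_elt set) module"
    and v :: "(nat \<Rightarrow> nat) \<Rightarrow> 'a klr_elt set"
    and L A :: "nat set"
  defines "\<alpha> \<equiv> cont e (hook d k)"
    and "i \<equiv> perm_seq d \<sigma> (res_seq e (hook d k) (init_tab (hook d k)))"
    and "S \<equiv> specht e rd (hook d k)"
    and "v \<equiv> specht_vec e rd (hook d k)"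
    and "L \<equiv> Leg d k \<sigma>"
    and "A \<equiv> Arm d k \<sigma>"
  assumes "3 \<le> e"
    and "k < d"
    and "reduced_choice d rd"
    and "\<sigma> \<in> Sh d k"
  shows "(\<forall>j\<in>res_seqs e \<alpha>.
            klr_e e \<alpha> j \<odot>\<^bsub>S\<^esub> v \<sigma> = (if i = j then v \<sigma> else \<zero>\<^bsub>S\<^esub>)) \<and>
         (\<forall>r\<in>{1..d}.
            klr_y e \<alpha> r \<odot>\<^bsub>S\<^esub> v \<sigma> =
              (if i r = i (r + 1) \<and> r \<in> L \<and> r + 1 \<in> A
                 then \<ominus>\<^bsub>S\<^esub> v (adj r \<circ> \<sigma>)
               else if i (r - 1) = i r \<and> r - 1 \<in> L \<and> r \<in> A
                 then v (adj (r - 1) \<circ> \<sigma>)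
               else \<zero>\<^bsub>S\<^esub>)) \<and>
         (2 \<le> d \<longrightarrow> klr_psi e \<alpha> 1 \<odot>\<^bsub>S\<^esub> v \<sigma> = \<zero>\<^bsub>S\<^esub>) \<and>
         (\<forall>r\<in>{2..d - 1}.
            klr_psi e \<alpha> r \<odot>\<^bsub>S\<^esub> v \<sigma> =
              (if r \<in> A \<and> r + 1 \<in> L \<or>
                  i (r + 1) \<notin> {i r, (i r + 1) mod int e, (i r - 1) mod int e}
                 then v (adj r \<circ> \<sigma>)
               else if r \<in> L \<and> r + 1 \<in> A \<and> r + 2 \<in> A \<and> arrow e (i r) (i (r + 1))
                 then v (adj (r + 1) \<circ> adj r \<circ> \<sigma>)
               else if r - 1 \<in> L \<and> r \<in> L \<and> r + 1 \<in> A \<and> arrow e (i (r + 1)) (i r)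
                 then \<ominus>\<^bsub>S\<^esub> v (adj (r - 1) \<circ> adj r \<circ> \<sigma>)
               else if r - 1 \<in> L \<and> r \<in> A \<and> r + 1 \<in> A \<and> i r = i (r - 1)
                 then v (adj r \<circ> adj (r - 1) \<circ> \<sigma>)
               else if r \<in> L \<and> r + 1 \<in> L \<and> r + 2 \<in> A \<and> i (r + 1) = i (r + 2)
                 then \<ominus>\<^bsub>S\<^esub> v (adj r \<circ> adj (r + 1) \<circ> \<sigma>)
               else \<zero>\<^bsub>S\<^esub>))"
proof -
  interpret specht_hook e d k rd S
    by unfold_locales (use assms(7-9) in \<open>simp_all add: S_def\<close>)
  interpret A: hook_action e d k S Y P V by (rule hook_action_M)
  show ?thesis
    unfolding \<alpha>_def i_def v_def L_def A_def
  proof (intro conjI impI)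
    show "\<forall>j\<in>res_seqs e (cont e (hook d k)). klr_e e (cont e (hook d k)) j \<odot>\<^bsub>S\<^esub> specht_vec e rd (hook d k) \<sigma> =
       (if c \<sigma> = j then specht_vec e rd (hook d k) \<sigma> else \<zero>\<^bsub>S\<^esub>)"
      by (rule e_V[OF assms(10)])
  qed (use A.y_V[OF assms(10)] A.p_1_V[OF assms(10)] A.p_V_all[OF assms(10)] in blast)+
qed

end
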